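(* Let $n\ge 4$ and $1\le k\le n/2$. (1) Every indecomposable module $M$ of rank $2$ in $\mathrm{CM}(B_{k,n})$ corresponds to a root of $J_{k,n}$, i.e. $\varphi(M)$ is a root of $J_{k,n}$. (2) Every indecomposable module $M$ of rank $3$ in $\mathrm{CM}(B_{3,n})$ corresponds to a root of $J_{3,n}$, i.e. $\varphi(M)$ is a root of $J_{3,n}$ (here $k=3\le n/2$).
   Context: Category. Fix $n\ge 4$, $1\le k\le n/2$, $[n]=\{1,\dots,n\}$. Let $Q_C$ be the quiver with vertex set $\mathbb{Z}/n$ and arrows $x_i:i-1\to i$, $y_i:i\to i-1$ for $i\in\mathbb{Z}/n$. The algebra $B_{k,n}$ is the quotient of the completed path algebra $\widehat{\mathbb{C}Q_C}$ by the ideal generated by the $2n$ relations $xy=yx$ and $x^k=y^{n-k}$ (one of each for each vertex; $x,y$ stand for the appropriate $x_i,y_j$). Its centre is $Z=\mathbb{C}[[t]]$ with $t=\sum_i x_iy_i$. $\mathrm{CM}(B_{k,n})$ is the category of (maximal) Cohen–Macaulay $B_{k,n}$-modules: representations $M=(M_i)$ of $Q_C$ satisfying the relations with all $M_i$ free $Z$-modules of the same finite rank; this common rank is the rank of $M$. For a $k$-subset $I\subset[n]$, $L_I$ is the rank 1 module with $\mathbb{C}[[t]]$ at each vertex, $x_i$ acting as $1$ if $i\in I$ and as $t$ if $i\notin I$, and $y_i$ acting as $t$ if $i\in I$ and as $1$ if $i\notin I$. Every rank 1 module is some $L_I$, and every rank $m$ module has a filtration with $m$ rank 1 factors $L_{I_1},\dots,L_{I_m}$.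 Root system. $J_{k,n}$ is the graph with nodes $1,\dots,n-1$ on a line (successive nodes joined) and a node $n$ attached to node $k$; also the corresponding (simply-laced) Kac–Moody root system, with simple roots $\alpha_1,\dots,\alpha_{n-1}$ and $\beta=\alpha_n$. Its root lattice is identified with $\mathbb{Z}^n(k)=\{x\in\mathbb{Z}^n : k\mid\sum_i x_i\}$ via $\alpha_i=-e_i+e_{i+1}$ ($1\le i\le n-1$), $\beta=e_1+\dots+e_k$, with inner product $(x,y)=\sum_i x_iy_i+\frac{2-k}{k^2}(\sum_i x_i)(\sum_i y_i)$. For $M$ with a filtration with factors $L_{I_1},\dots,L_{I_m}$, let $x(M)=(x_1,\dots,x_n)$, where $x_i$ is the number of $j$ with $i\in I_j$; $\varphi(M)$ is the element of the root lattice corresponding to $x(M)\in\mathbb{Z}^n(k)$. *)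

theory Defs
  imports Complex_Main "HOL-Computational_Algebra.Formal_Power_Series"
begin

section \<open>Cohen--Macaulay modules over the algebra B(k,n)\<close>

text \<open>
  The elements of \<open>\<int>/n\<close> are represented by \<open>1, \<dots>, n\<close>, so that \<open>n\<close> stands for the
  class of \<open>0\<close>. The arrow \<open>x\<^sub>i\<close> goes from \<open>prv n i\<close> to \<open>i\<close>, and \<open>y\<^sub>i\<close> goes from \<open>i\<close> to
  \<open>prv n i\<close>, for \<open>i\<close> in \<open>{1..n}\<close>.
\<close>

definition prv :: "nat \<Rightarrow> nat \<Rightarrow> nat" where
  "prv n i = (if i = 1 then n else i - 1)"

definition nxt :: "nat \<Rightarrow> nat \<Rightarrow> nat" where
  "nxt n i = (if i = n then 1 else i + 1)"

text \<open>
  The \<open>\<complex>[[t]]\<close>-modules sitting at the vertices are submodules \<open>vsp M i\<close> of one ambient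
  \<open>\<complex>[[t]]\<close>-module, which is the type \<open>'a\<close> with the scalar multiplication \<open>scl M\<close>. This is no
  restriction, since any family of modules embeds into its direct sum. The submodules need not
  be independent or distinct. Only the values \<open>vsp M i\<close>, \<open>xmap M i\<close>, \<open>ymap M i\<close> for \<open>i\<close> in
  \<open>{1..n}\<close>, with the maps restricted to their sources, are relevant.
\<close>

record 'a quiver_rep =
  scl :: "complex fps \<Rightarrow> 'a \<Rightarrow> 'a"
  vsp :: "nat \<Rightarrow> 'a set"
  xmap :: "nat \<Rightarrow> 'a \<Rightarrow> 'a"
  ymap :: "nat \<Rightarrow> 'a \<Rightarrow> 'a"

definition linear_map_on ::
  "(complex fps \<Rightarrow> 'a \<Rightarrow> 'a) \<Rightarrow> (complex fps \<Rightarrow> 'b \<Rightarrow> 'b) \<Rightarrow> 'a set \<Rightarrow> 'b set \<Rightarrow>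
   ('a::ab_group_add \<Rightarrow> 'b::ab_group_add) \<Rightarrow> bool" where
  "linear_map_on s s' V W f \<longleftrightarrow>
     f ` V \<subseteq> W \<and>
     (\<forall>u\<in>V. \<forall>v\<in>V. f (u + v) = f u + f v) \<and>
     (\<forall>a. \<forall>v\<in>V. f (s a v) = s' a (f v))"

definition free_of_rank ::
  "(complex fps \<Rightarrow> 'a \<Rightarrow> 'a) \<Rightarrow> nat \<Rightarrow> 'a::ab_group_add set \<Rightarrow> bool" where
  "free_of_rank s m V \<longleftrightarrow>
     (\<exists>B. finite B \<and> card B = m \<and> \<not> module.dependent s B \<and> module.span s B = V)"

text \<open>The action on \<open>v\<close>, sitting at vertex \<open>i\<close>, of the paths \<open>x\<^sup>m\<close> and \<open>y\<^sup>m\<close> starting at \<open>i\<close>.\<close>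

primrec xpath :: "nat \<Rightarrow> 'a quiver_rep \<Rightarrow> nat \<Rightarrow> nat \<Rightarrow> 'a \<Rightarrow> 'a" where
  "xpath n M 0 i v = v"
| "xpath n M (Suc m) i v = xpath n M m (nxt n i) (xmap M (nxt n i) v)"

primrec ypath :: "nat \<Rightarrow> 'a quiver_rep \<Rightarrow> nat \<Rightarrow> nat \<Rightarrow> 'a \<Rightarrow> 'a" where
  "ypath n M 0 i v = v"
| "ypath n M (Suc m) i v = ypath n M m (prv n i) (ymap M i v)"

text \<open>
  \<open>CM_module k n m M\<close>: \<open>M\<close> is a rank \<open>m\<close> object of \<open>CM(B\<^sub>k\<^sub>,\<^sub>n)\<close>. The scalar \<open>t\<close> is \<open>fps_X\<close>; it
  acts as the central element \<open>\<Sum>\<^sub>i x\<^sub>i y\<^sub>i\<close>, whose component at vertex \<open>i\<close> is \<open>x\<^sub>i y\<^sub>i\<close>. The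
  linearity of the arrows over \<open>\<complex>[[t]]\<close> reflects that \<open>t\<close> is central.
\<close>

definition CM_module :: "nat \<Rightarrow> nat \<Rightarrow> nat \<Rightarrow> 'a::ab_group_add quiver_rep \<Rightarrow> bool" where
  "CM_module k n m M \<longleftrightarrow>
     module (scl M) \<and>
     (\<forall>i\<in>{1..n}.
        free_of_rank (scl M) m (vsp M i) \<and>
        linear_map_on (scl M) (scl M) (vsp M (prv n i)) (vsp M i) (xmap M i) \<and>
        linear_map_on (scl M) (scl M) (vsp M i) (vsp M (prv n i)) (ymap M i) \<and>
        (\<forall>v\<in>vsp M i.
           xmap M i (ymap M i v) = scl M fps_X v \<and>
           xmap M i (ymap M i v) = ymap M (nxt n i) (xmap M (nxt n i) v) \<and>
           xpath n M k i v = ypath n M (n - k) i v))"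

definition is_submodule ::
  "nat \<Rightarrow> 'a::ab_group_add quiver_rep \<Rightarrow> (nat \<Rightarrow> 'a set) \<Rightarrow> bool" where
  "is_submodule n M U \<longleftrightarrow>
     (\<forall>i\<in>{1..n}.
        module.subspace (scl M) (U i) \<and> U i \<subseteq> vsp M i \<and>
        xmap M i ` U (prv n i) \<subseteq> U i \<and> ymap M i ` U i \<subseteq> U (prv n i))"

definition is_zero_family :: "nat \<Rightarrow> (nat \<Rightarrow> 'a::ab_group_add set) \<Rightarrow> bool" where
  "is_zero_family n U \<longleftrightarrow> (\<forall>i\<in>{1..n}. U i = {0})"

definition indecomposable_module :: "nat \<Rightarrow> 'a::ab_group_add quiver_rep \<Rightarrow> bool" where
  "indecomposable_module n M \<longleftrightarrow>
     \<not> is_zero_family n (vsp M) \<and>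
     (\<forall>U W. is_submodule n M U \<and> is_submodule n M W \<and>
        (\<forall>i\<in>{1..n}. U i \<inter> W i = {0} \<and> vsp M i = {u + w | u w. u \<in> U i \<and> w \<in> W i})
        \<longrightarrow> is_zero_family n U \<or> is_zero_family n W)"

definition rank1_module :: "nat set \<Rightarrow> complex fps quiver_rep" where
  "rank1_module I =
     \<lparr> scl = (*),
       vsp = (\<lambda>i. UNIV),
       xmap = (\<lambda>i f. if i \<in> I then f else fps_X * f),
       ymap = (\<lambda>i f. if i \<in> I then fps_X * f else f) \<rparr>"

text \<open>
  The family \<open>f\<close> is a homomorphism to \<open>N\<close> from the submodule of \<open>M\<close> given by \<open>U\<close>.
\<close>

definition hom_from_submodule ::
  "nat \<Rightarrow> 'a::ab_group_add quiver_rep \<Rightarrow> (nat \<Rightarrow> 'a set) \<Rightarrow> 'b::ab_group_add quiver_rep \<Rightarrow>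
   (nat \<Rightarrow> 'a \<Rightarrow> 'b) \<Rightarrow> bool" where
  "hom_from_submodule n M U N f \<longleftrightarrow>
     (\<forall>i\<in>{1..n}.
        linear_map_on (scl M) (scl N) (U i) (vsp N i) (f i) \<and>
        (\<forall>v\<in>U (prv n i). f i (xmap M i v) = xmap N i (f (prv n i) v)) \<and>
        (\<forall>v\<in>U i. f (prv n i) (ymap M i v) = ymap N i (f i v)))"

text \<open>The quotient \<open>U / W\<close> of submodules is isomorphic to \<open>N\<close>, via a short exact sequence.\<close>

definition quotient_iso ::
  "nat \<Rightarrow> 'a::ab_group_add quiver_rep \<Rightarrow> (nat \<Rightarrow> 'a set) \<Rightarrow> (nat \<Rightarrow> 'a set) \<Rightarrow>
   'b::ab_group_add quiver_rep \<Rightarrow> bool" where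
  "quotient_iso n M U W N \<longleftrightarrow>
     (\<exists>f. hom_from_submodule n M U N f \<and>
        (\<forall>i\<in>{1..n}. f i ` U i = vsp N i \<and> {v \<in> U i. f i v = 0} = W i))"

definition has_filtration ::
  "nat \<Rightarrow> nat \<Rightarrow> 'a::ab_group_add quiver_rep \<Rightarrow> nat set list \<Rightarrow> bool" where
  "has_filtration k n M Is \<longleftrightarrow>
     (\<exists>F. (\<forall>j\<le>length Is. is_submodule n M (F j)) \<and>
        (\<forall>i\<in>{1..n}. F 0 i = {0} \<and> F (length Is) i = vsp M i) \<and>
        (\<forall>j<length Is.
           Is ! j \<subseteq> {1..n} \<and> card (Is ! j) = k \<and>
           (\<forall>i\<in>{1..n}. F j i \<subseteq> F (Suc j) i) \<and>
           quotient_iso n M (F (Suc j)) (F j) (rank1_module (Is ! j))))"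

text \<open>
  The vector \<open>x(M)\<close>. A filtration exists for every module in \<open>CM(B\<^sub>k\<^sub>,\<^sub>n)\<close> and the vector does not
  depend on it.
\<close>

definition class_vector :: "nat \<Rightarrow> nat \<Rightarrow> 'a::ab_group_add quiver_rep \<Rightarrow> nat \<Rightarrow> int" where
  "class_vector k n M =
     (let Is = (SOME Is. has_filtration k n M Is)
      in (\<lambda>i. int (card {j. j < length Is \<and> i \<in> Is ! j})))"


section \<open>The root system of the graph J(k,n)\<close>

definition J_adj :: "nat \<Rightarrow> nat \<Rightarrow> nat \<Rightarrow> nat \<Rightarrow> bool" where
  "J_adj k n i j \<longleftrightarrow>
     (1 \<le> i \<and> i < n \<and> 1 \<le> j \<and> j < n \<and> (j = i + 1 \<or> i = j + 1)) \<or>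
     (i = k \<and> j = n) \<or> (i = n \<and> j = k)"

definition cartan :: "nat \<Rightarrow> nat \<Rightarrow> nat \<Rightarrow> nat \<Rightarrow> int" where
  "cartan k n i j = (if i = j then 2 else if J_adj k n i j then -1 else 0)"

text \<open>An element of the root lattice is given by its coefficients in the simple roots.\<close>

definition root_lattice :: "nat \<Rightarrow> (nat \<Rightarrow> int) set" where
  "root_lattice n = {c. \<forall>i. i \<notin> {1..n} \<longrightarrow> c i = 0}"

definition simple_root :: "nat \<Rightarrow> nat \<Rightarrow> int" where
  "simple_root i = (\<lambda>j. if j = i then 1 else 0)"

definition root_form :: "nat \<Rightarrow> nat \<Rightarrow> (nat \<Rightarrow> int) \<Rightarrow> (nat \<Rightarrow> int) \<Rightarrow> int" where
  "root_form k n c d = (\<Sum>i\<in>{1..n}. \<Sum>j\<in>{1..n}. cartan k n i j * c i * d j)"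

definition simple_reflection :: "nat \<Rightarrow> nat \<Rightarrow> nat \<Rightarrow> (nat \<Rightarrow> int) \<Rightarrow> nat \<Rightarrow> int" where
  "simple_reflection k n i c = (\<lambda>j. c j - root_form k n c (simple_root i) * simple_root i j)"

inductive_set weyl_group :: "nat \<Rightarrow> nat \<Rightarrow> ((nat \<Rightarrow> int) \<Rightarrow> nat \<Rightarrow> int) set" for k n where
  weyl_id: "id \<in> weyl_group k n"
| weyl_step: "w \<in> weyl_group k n \<Longrightarrow> i \<in> {1..n} \<Longrightarrow> simple_reflection k n i \<circ> w \<in> weyl_group k n"

definition connected_support :: "nat \<Rightarrow> nat \<Rightarrow> (nat \<Rightarrow> int) \<Rightarrow> bool" where
  "connected_support k n c \<longleftrightarrow>
     (let S = {i\<in>{1..n}. c i \<noteq> 0}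
      in \<forall>i\<in>S. \<forall>j\<in>S. (i, j) \<in> {(a, b). a \<in> S \<and> b \<in> S \<and> J_adj k n a b}\<^sup>*)"

definition real_roots :: "nat \<Rightarrow> nat \<Rightarrow> (nat \<Rightarrow> int) set" where
  "real_roots k n = {w (simple_root i) | w i. w \<in> weyl_group k n \<and> i \<in> {1..n}}"

definition fundamental_set :: "nat \<Rightarrow> nat \<Rightarrow> (nat \<Rightarrow> int) set" where
  "fundamental_set k n =
     {c \<in> root_lattice n. c \<noteq> (\<lambda>i. 0) \<and> (\<forall>i. 0 \<le> c i) \<and>
        (\<forall>i\<in>{1..n}. root_form k n c (simple_root i) \<le> 0) \<and> connected_support k n c}"

definition imaginary_roots :: "nat \<Rightarrow> nat \<Rightarrow> (nat \<Rightarrow> int) set" where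
  "imaginary_roots k n =
     {w c | w c. w \<in> weyl_group k n \<and> (c \<in> fundamental_set k n \<or> - c \<in> fundamental_set k n)}"

text \<open>
  Kac's definition of the (infinite) root system of a graph; it is the root system of the
  Kac--Moody algebra of the graph.
\<close>

definition J_roots :: "nat \<Rightarrow> nat \<Rightarrow> (nat \<Rightarrow> int) set" where
  "J_roots k n = real_roots k n \<union> imaginary_roots k n"


section \<open>The identification of the root lattice with \<open>\<int>\<^sup>n(k)\<close>\<close>

text \<open>Vectors in \<open>\<int>\<^sup>n\<close> are functions vanishing outside \<open>{1..n}\<close>.\<close>

definition Zn_k :: "nat \<Rightarrow> nat \<Rightarrow> (nat \<Rightarrow> int) set" where
  "Zn_k k n = {x. (\<forall>i. i \<notin> {1..n} \<longrightarrow> x i = 0) \<and> int k dvd (\<Sum>i\<in>{1..n}. x i)}"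

definition simple_root_vector :: "nat \<Rightarrow> nat \<Rightarrow> nat \<Rightarrow> nat \<Rightarrow> int" where
  "simple_root_vector k n j =
     (if j < n then (\<lambda>i. if i = j + 1 then 1 else if i = j then -1 else 0)
      else (\<lambda>i. if i \<in> {1..k} then 1 else 0))"

definition lattice_to_Zn :: "nat \<Rightarrow> nat \<Rightarrow> (nat \<Rightarrow> int) \<Rightarrow> nat \<Rightarrow> int" where
  "lattice_to_Zn k n c = (\<lambda>i. \<Sum>j\<in>{1..n}. c j * simple_root_vector k n j i)"

definition Zn_form :: "nat \<Rightarrow> nat \<Rightarrow> (nat \<Rightarrow> int) \<Rightarrow> (nat \<Rightarrow> int) \<Rightarrow> rat" where
  "Zn_form k n x y =
     of_int (\<Sum>i\<in>{1..n}. x i * y i) +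
     (2 - of_nat k) / (of_nat k)\<^sup>2 * of_int (\<Sum>i\<in>{1..n}. x i) * of_int (\<Sum>i\<in>{1..n}. y i)"

text \<open>
  \<open>lattice_to_Zn\<close> is a bijection onto \<open>\<int>\<^sup>n(k)\<close> (\<open>bij_betw_lattice_to_Zn\<close>), and it carries the form
  given by the Cartan matrix to the inner product \<open>Zn_form\<close> (\<open>Zn_form_lattice_to_Zn\<close>).
\<close>

lemma lattice_to_Zn_apply:
  assumes "1 \<le> k" "k < n" "i \<in> {1..n}"
  shows "lattice_to_Zn k n c i =
    (if 2 \<le> i then c (i - 1) else 0) - (if i < n then c i else 0) + (if i \<le> k then c n else 0)"
proof -
  have n: "{1..n} = insert n {1..<n}" using assms by auto
  have "lattice_to_Zn k n c i = (if i \<le> k then c n else 0)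
      + (\<Sum>j\<in>{1..<n}. c j * simple_root_vector k n j i)"
    using assms unfolding lattice_to_Zn_def n by (auto simp: simple_root_vector_def)
  also have "(\<Sum>j\<in>{1..<n}. c j * simple_root_vector k n j i)
     = (\<Sum>j\<in>{1..<n}. (if j = i - 1 \<and> 2 \<le> i then c (i - 1) else 0) - (if j = i then c i else 0))"
    using assms by (intro sum.cong) (auto simp: simple_root_vector_def)
  also have "\<dots> = (\<Sum>j\<in>{1..<n}. (if j = i - 1 then (if 2 \<le> i then c (i - 1) else 0) else 0))
     - (\<Sum>j\<in>{1..<n}. (if j = i then c i else 0))"
    unfolding sum_subtractf by (intro arg_cong2[of _ _ _ _ "(-)"] sum.cong) auto
  also have "\<dots> = (if 2 \<le> i then c (i - 1) else 0) - (if i < n then c i else 0)"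
    using assms by (auto simp: sum.delta)
  finally show ?thesis by simp
qed

lemma lattice_to_Zn_outside:
  assumes "1 \<le> k" "k < n" "i \<notin> {1..n}"
  shows "lattice_to_Zn k n c i = 0"
  using assms unfolding lattice_to_Zn_def
  by (intro sum.neutral) (auto simp: simple_root_vector_def)

lemma sum_lattice_to_Zn:
  assumes "1 \<le> k" "k < n" "m \<le> n"
  shows "(\<Sum>i\<in>{1..m}. lattice_to_Zn k n c i) =
    int (min m k) * c n - (if 1 \<le> m \<and> m < n then c m else 0)"
  using \<open>m \<le> n\<close>
proof (induction m)
  case 0 then show ?case by simp
next
  case (Suc m)
  have "lattice_to_Zn k n c (Suc m) = (if 1 \<le> m then c m else 0)
     - (if Suc m < n then c (Suc m) else 0) + (if Suc m \<le> k then c n else 0)"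
    using assms Suc.prems by (subst lattice_to_Zn_apply) auto
  moreover have "(\<Sum>i\<in>{1..Suc m}. lattice_to_Zn k n c i) =
      (int (min m k) * c n - (if 1 \<le> m \<and> m < n then c m else 0)) + lattice_to_Zn k n c (Suc m)"
    using Suc by simp
  moreover have "int (min (Suc m) k) = int (min m k) + (if Suc m \<le> k then 1 else 0)" by auto
  ultimately show ?case using Suc.prems by (simp add: distrib_right)
qed

lemma bij_betw_lattice_to_Zn:
  assumes "1 \<le> k" "k < n"
  shows "bij_betw (lattice_to_Zn k n) (root_lattice n) (Zn_k k n)"
proof (rule bij_betwI')
  fix c d assume c: "c \<in> root_lattice n" and d: "d \<in> root_lattice n"
  show "(lattice_to_Zn k n c = lattice_to_Zn k n d) = (c = d)"
  proof
    assume eq: "lattice_to_Zn k n c = lattice_to_Zn k n d"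
    have "int k * c n = int k * d n"
      using sum_lattice_to_Zn[OF assms, of n c] sum_lattice_to_Zn[OF assms, of n d] eq assms
      by simp
    then have n: "c n = d n" using assms by simp
    have "c i = d i" for i
    proof (cases "i \<in> {1..<n}")
      case True
      then show ?thesis
        using sum_lattice_to_Zn[OF assms, of i c] sum_lattice_to_Zn[OF assms, of i d] eq n by simp
    next
      case False
      then show ?thesis using c d n unfolding root_lattice_def
        by (cases "i = n") auto
    qed
    then show "c = d" by blast
  qed simp
next
  fix c assume "c \<in> root_lattice n"
  show "lattice_to_Zn k n c \<in> Zn_k k n"
    using sum_lattice_to_Zn[OF assms, of n c] assms
    by (simp add: Zn_k_def lattice_to_Zn_outside)
next
  fix x assume x: "x \<in> Zn_k k n"
  then obtain s where s: "(\<Sum>i\<in>{1..n}. x i) = int k * s" unfolding Zn_k_def by auto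
  define c where "c i = (if i \<in> {1..<n} then int (min i k) * s - (\<Sum>l\<in>{1..i}. x l)
     else if i = n then s else 0)" for i
  have "c \<in> root_lattice n" using assms by (auto simp: root_lattice_def c_def)
  moreover have "x i = lattice_to_Zn k n c i" for i
  proof (cases "i \<in> {1..n}")
    case True
    then obtain j where j: "i = Suc j" by (cases i) auto
    have s': "i = n \<Longrightarrow> x (Suc j) + (\<Sum>l\<in>{1..j}. x l) = int k * s" using s unfolding j by (auto simp: add.commute)
    have s1: "(\<Sum>l\<in>{1..Suc j}. x l) = x (Suc j) + (\<Sum>l\<in>{1..j}. x l)" by simp
    show ?thesis
    proof (cases "i = n")
      case n: True
      then have "k \<le> j" "min j k = k" "1 \<le> j" "j < n" "\<not> i \<le> k" "n - 1 = j" using assms j by auto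
      then show ?thesis unfolding lattice_to_Zn_apply[OF assms True]
        using n j s' by (simp add: c_def algebra_simps del: One_nat_def)
    next
      case False
      then have "int (min i k) = int (min j k) + (if i \<le> k then 1 else 0)" "i < n" "j < n"
        using True j by auto
      then show ?thesis unfolding lattice_to_Zn_apply[OF assms True]
        using j s1 by (auto simp: c_def algebra_simps)
    qed
  next
    case False
    then show ?thesis using x lattice_to_Zn_outside[OF assms False] by (simp add: Zn_k_def)
  qed
  ultimately show "\<exists>c\<in>root_lattice n. x = lattice_to_Zn k n c" by blast
qed

lemma sum_simple_root_vector:
  assumes "1 \<le> k" "k < n" "j \<in> {1..n}"
  shows "(\<Sum>i\<in>{1..n}. simple_root_vector k n j i) = (if j = n then int k else 0)"
proof (cases "j = n")
  case True
  have "{1..n} \<inter> {l. l \<le> k} = {1..k}" using assms by auto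
  then show ?thesis using True
    by (simp add: simple_root_vector_def sum.If_cases del: One_nat_def)
next
  case False
  have "(\<Sum>i\<in>{1..n}. simple_root_vector k n j i) =
    (\<Sum>i\<in>{1..n}. (if i = j + 1 then 1 else 0) - (if i = j then 1 else 0))"
    using False assms by (intro sum.cong) (auto simp: simple_root_vector_def)
  then show ?thesis using False assms by (simp add: sum_subtractf)
qed

lemma dot_simple_root_vector:
  assumes "1 \<le> k" "k < n" "i \<in> {1..n}" 
  shows "j < n \<Longrightarrow> 1 \<le> j \<Longrightarrow> (\<Sum>l\<in>{1..n}. x l * simple_root_vector k n j l) = x (j+1) - x j"
    and "(\<Sum>l\<in>{1..n}. x l * simple_root_vector k n n l) = (\<Sum>l\<in>{1..k}. x l)"
proof -
  assume j: "j < n" "1 \<le> j"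
  have "(\<Sum>l\<in>{1..n}. x l * simple_root_vector k n j l) =
    (\<Sum>l\<in>{1..n}. (if l = j + 1 then x l else 0) - (if l = j then x l else 0))"
    using j by (intro sum.cong) (auto simp: simple_root_vector_def)
  then show "(\<Sum>l\<in>{1..n}. x l * simple_root_vector k n j l) = x (j+1) - x j"
    using j by (simp add: sum_subtractf)
next
  have "{1..n} \<inter> {l. l \<le> k} = {1..k}" using assms by auto
  then show "(\<Sum>l\<in>{1..n}. x l * simple_root_vector k n n l) = (\<Sum>l\<in>{1..k}. x l)"
    by (simp add: simple_root_vector_def sum.If_cases if_distrib[of "(*) _"] cong: if_cong del: One_nat_def)
qed

lemma Zn_form_simple_root_vector:
  assumes "1 \<le> k" "k < n" "i \<in> {1..n}" "j \<in> {1..n}"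
  shows "Zn_form k n (simple_root_vector k n i) (simple_root_vector k n j) = of_int (cartan k n i j)"
proof -
  have k0: "(of_nat k :: rat) \<noteq> 0" using assms by simp
  have srnn: "(\<Sum>l\<in>{1..k}. simple_root_vector k n i l) = (if i = n then int k else if i = k then -1 else 0)"
  proof (cases "i = n")
    case True then show ?thesis by (simp add: simple_root_vector_def)
  next
    case False
    have "(\<Sum>l\<in>{1..k}. simple_root_vector k n i l) =
      (\<Sum>l\<in>{1..k}. (if l = i + 1 then 1 else 0) - (if l = i then 1 else 0))"
      using False assms by (intro sum.cong) (auto simp: simple_root_vector_def)
    then show ?thesis using False assms by (auto simp: sum_subtractf)
  qed
  show ?thesis
  proof (cases "j = n")
    case True
    show ?thesis unfolding Zn_form_def sum_simple_root_vector[OF assms(1,2,3)]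
        sum_simple_root_vector[OF assms(1,2,4)] 
      unfolding True dot_simple_root_vector(2)[OF assms(1-3)] srnn
      using assms k0 by (auto simp: cartan_def J_adj_def field_simps power2_eq_square)
  next
    case False
    then have j: "j < n" "1 \<le> j" using assms by auto
    show ?thesis unfolding Zn_form_def sum_simple_root_vector[OF assms(1,2,3)]
        sum_simple_root_vector[OF assms(1,2,4)] dot_simple_root_vector(1)[OF assms(1-3) j]
      using assms j by (auto simp: cartan_def J_adj_def simple_root_vector_def)
  qed
qed

lemma Zn_form_sum_left:
  "Zn_form k n (\<lambda>l. \<Sum>j\<in>A. c j * f j l) y = (\<Sum>j\<in>A. of_int (c j) * Zn_form k n (f j) y)"
proof -
  have 1: "(\<Sum>l\<in>{1..n}. (\<Sum>j\<in>A. c j * f j l) * y l) = (\<Sum>j\<in>A. c j * (\<Sum>l\<in>{1..n}. f j l * y l))"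
    by (simp add: sum_distrib_left sum_distrib_right mult.assoc sum.swap[of _ A])
  have 2: "(\<Sum>l\<in>{1..n}. (\<Sum>j\<in>A. c j * f j l)) = (\<Sum>j\<in>A. c j * (\<Sum>l\<in>{1..n}. f j l))"
    by (simp add: sum_distrib_left sum.swap[of _ A])
  show ?thesis unfolding Zn_form_def 1 2
    by (simp only: of_int_sum of_int_mult distrib_left sum.distrib sum_distrib_left sum_distrib_right ac_simps)
qed

lemma Zn_form_commute: "Zn_form k n x y = Zn_form k n y x"
  by (simp add: Zn_form_def mult.commute mult.left_commute)

lemma Zn_form_lattice_to_Zn:
  assumes "1 \<le> k" "k < n"
  shows "Zn_form k n (lattice_to_Zn k n c) (lattice_to_Zn k n d) = of_int (root_form k n c d)"
proof -
  have "Zn_form k n (lattice_to_Zn k n c) (lattice_to_Zn k n d) =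
    (\<Sum>i\<in>{1..n}. \<Sum>j\<in>{1..n}. of_int (c i) * (of_int (d j) *
      Zn_form k n (simple_root_vector k n j) (simple_root_vector k n i)))"
    unfolding lattice_to_Zn_def Zn_form_sum_left
    by (subst (1) Zn_form_commute) (simp add: Zn_form_sum_left sum_distrib_left)
  also have "\<dots> = (\<Sum>i\<in>{1..n}. \<Sum>j\<in>{1..n}. of_int (cartan k n i j * c i * d j))"
    by (intro sum.cong refl, subst Zn_form_commute)
       (simp add: Zn_form_simple_root_vector[OF assms] mult.commute mult.left_commute)
  finally show ?thesis by (simp add: root_form_def)
qed

definition phi :: "nat \<Rightarrow> nat \<Rightarrow> 'a::ab_group_add quiver_rep \<Rightarrow> nat \<Rightarrow> int" where
  "phi k n M = inv_into (root_lattice n) (lattice_to_Zn k n) (class_vector k n M)"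

end

theory Submission
  imports Defs
begin

text \<open>
  Moving all vertices to one vertex \<open>r\<close> along the arrows \<open>y\<close> turns a module \<open>M\<close> of rank \<open>m\<close> into a chain
  of lattices \<open>L\<^sub>0 \<supseteq> L\<^sub>1 \<supseteq> \<dots> \<supseteq> L\<^sub>n = t\<^sup>k L\<^sub>0\<close> in a free module of rank \<open>m\<close> with \<open>t L\<^sub>i \<subseteq> L\<^sub>i\<^sub>+\<^sub>1\<close>, where the
  entries of the class vector are the dimensions of the quotients of successive lattices. A vector
  \<open>v\<close> and a functional \<open>f\<close> with \<open>f v = 1\<close> and \<open>f(L\<^sub>i) v \<subseteq> L\<^sub>i\<close> for all \<open>i\<close> split off a direct summand
  of rank 1.

  Every chain lying between \<open>L\<^sub>0\<close> and \<open>t\<^sup>2 L\<^sub>0\<close> is diagonal in a suitable basis; this is the Bruhat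
  decomposition for two flags. If an indecomposable module of rank 2 had at least \<open>k - 2\<close> entries
  \<open>2\<close>, rescaling would give such a chain. Hence at least \<open>k + 3\<close> entries are nonzero.

  In rank 3 with \<open>k = 3\<close>, suppose that some entry is at least \<open>2\<close> and take \<open>r\<close> in front of it. Either
  \<open>L\<^sub>1 = t L\<^sub>0\<close>, and the rest of the chain is diagonal, or \<open>L\<^sub>1\<close> is generated by \<open>t L\<^sub>0\<close> and one vector
  \<open>v\<close>. Take \<open>v\<close> in the last lattice \<open>L\<^sub>p\<close> not contained in \<open>t L\<^sub>0\<close>. The chain \<open>L\<^sub>i \<inter> t L\<^sub>0\<close> is diagonal,
  with diagonal chains \<open>C\<^sub>1, C\<^sub>2, C\<^sub>3\<close> of rank 1, and one component splits off if \<open>v\<close> has a trivial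
  coefficient on it modulo \<open>t\<close> times the \<open>p\<close>-th lattice. A homomorphism \<open>C\<^sub>i \<rightarrow> C\<^sub>j\<close> that is an
  isomorphism at \<open>p\<close> can be used to clear the coefficient on \<open>C\<^sub>j\<close>. Each \<open>C\<^sub>i\<close> is given by two jumps, and
  if no such homomorphism exists then the three pairs of jumps are strictly nested, which requires
  six nonzero entries besides those at \<open>1\<close> and \<open>p + 1\<close>. Hence at least \<open>8\<close> entries are nonzero.

  Sorting the class vector by reflections in \<open>\<alpha>\<^sub>1, \<dots>, \<alpha>\<^sub>n\<^sub>-\<^sub>1\<close>, these bounds either put it into the
  fundamental set or make its product with \<open>\<beta>\<close> equal to \<open>1\<close>, in which case subtracting \<open>\<beta>\<close> lowers the rank.
\<close>

section \<open>Dual bases of modules over the power series ring\<close>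

lemma fps_X_dvd_iff: "fps_X dvd (f :: complex fps) \<longleftrightarrow> fps_nth f 0 = 0"
proof
  assume "fps_X dvd f"
  then show "fps_nth f 0 = 0" by (auto elim!: dvdE)
next
  assume "fps_nth f 0 = 0"
  then have "f = fps_X * fps_shift 1 f"
    by (intro fps_ext) (simp add: fps_X_mult_nth)
  then show "fps_X dvd f" by (metis dvd_triv_left)
qed

lemma fps_dvd_one_iff: "(f :: complex fps) dvd 1 \<longleftrightarrow> fps_nth f 0 \<noteq> 0"
  by simp

locale fps_module = module scale
  for scale :: "complex fps \<Rightarrow> 'a::ab_group_add \<Rightarrow> 'a" (infixr \<open>*s\<close> 75)
begin

definition functional :: "'a set \<Rightarrow> ('a \<Rightarrow> complex fps) \<Rightarrow> bool" where
  "functional U f \<longleftrightarrow>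
     (\<forall>u\<in>U. \<forall>v\<in>U. f (u + v) = f u + f v) \<and> (\<forall>a. \<forall>v\<in>U. f (a *s v) = a * f v)"

text \<open>Freeness is handled through a basis together with its coordinate functionals. Indexing
  both by \<open>J\<close> makes it easy to drop or adjoin a single index, which is how summands of
  rank 1 are split off.\<close>

definition dual_basis :: "'j set \<Rightarrow> 'a set \<Rightarrow> ('j \<Rightarrow> 'a) \<Rightarrow> ('j \<Rightarrow> 'a \<Rightarrow> complex fps) \<Rightarrow> bool" where
  "dual_basis J U b f \<longleftrightarrow>
     finite J \<and> subspace U \<and> (\<forall>j\<in>J. b j \<in> U \<and> functional U (f j)) \<and>
     (\<forall>i\<in>J. \<forall>j\<in>J. f i (b j) = (if i = j then 1 else 0)) \<and>
     (\<forall>u\<in>U. u = (\<Sum>j\<in>J. f j u *s b j))"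

lemma functional_add: "functional U f \<Longrightarrow> u \<in> U \<Longrightarrow> v \<in> U \<Longrightarrow> f (u + v) = f u + f v"
  and functional_scale: "functional U f \<Longrightarrow> v \<in> U \<Longrightarrow> f (a *s v) = a * f v"
  by (auto simp: functional_def)

lemma functional_zero: "functional U f \<Longrightarrow> subspace U \<Longrightarrow> f 0 = 0"
  using functional_scale[of U f 0 0] subspace_0[of U] by simp

lemma functional_diff:
  assumes "functional U f" "subspace U" "u \<in> U" "v \<in> U"
  shows "f (u - v) = f u - f v"
proof -
  have "f (u - v + v) = f (u - v) + f v"
    using assms by (intro functional_add) (auto intro: subspace_diff)
  then show ?thesis by simp
qed

lemma functional_sum:
  assumes "functional U f" "subspace U" "\<And>j. j \<in> A \<Longrightarrow> g j \<in> U"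
  shows "f (\<Sum>j\<in>A. g j) = (\<Sum>j\<in>A. f (g j))"
  using assms(3)
proof (induction A rule: infinite_finite_induct)
  case (insert x F)
  then have "(\<Sum>j\<in>F. g j) \<in> U" using assms(2) by (intro subspace_sum) auto
  then show ?case using insert assms(1) by (simp add: functional_add)
qed (use assms functional_zero in auto)

lemma dual_basisD:
  assumes "dual_basis J U b f"
  shows "finite J" "subspace U" "\<And>j. j \<in> J \<Longrightarrow> b j \<in> U" "\<And>j. j \<in> J \<Longrightarrow> functional U (f j)"
    "\<And>i j. i \<in> J \<Longrightarrow> j \<in> J \<Longrightarrow> f i (b j) = (if i = j then 1 else 0)"
    "\<And>u. u \<in> U \<Longrightarrow> (\<Sum>j\<in>J. f j u *s b j) = u"
proof -
  show "finite J" "subspace U" "\<And>j. j \<in> J \<Longrightarrow> b j \<in> U" "\<And>j. j \<in> J \<Longrightarrow> functional U (f j)"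
    "\<And>i j. i \<in> J \<Longrightarrow> j \<in> J \<Longrightarrow> f i (b j) = (if i = j then 1 else 0)"
    using assms unfolding dual_basis_def by blast+
  show "(\<Sum>j\<in>J. f j u *s b j) = u" if "u \<in> U" for u
    using assms that unfolding dual_basis_def by (metis (no_types, lifting))
qed

lemma functional_expand:
  assumes "dual_basis J U b f" "functional U g" "u \<in> U"
  shows "g u = (\<Sum>j\<in>J. f j u * g (b j))"
proof -
  note D = dual_basisD[OF assms(1)]
  have "g u = g (\<Sum>j\<in>J. f j u *s b j)" using D(6) assms(3) by simp
  also have "\<dots> = (\<Sum>j\<in>J. g (f j u *s b j))"
    using D assms(2) by (intro functional_sum) (auto intro: subspace_scale)
  also have "\<dots> = (\<Sum>j\<in>J. f j u * g (b j))"
    using D assms(2) by (intro sum.cong) (auto simp: functional_scale)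
  finally show ?thesis .
qed

text \<open>Both cardinalities are the trace of the identity of \<open>U\<close>.\<close>

lemma dual_basis_card_eq:
  assumes "dual_basis I U v f" "dual_basis J U w g"
  shows "card I = card J"
proof -
  note D = dual_basisD[OF assms(1)] and E = dual_basisD[OF assms(2)]
  have "of_nat (card I) = (\<Sum>i\<in>I. f i (v i))" using D by simp
  also have "\<dots> = (\<Sum>i\<in>I. \<Sum>j\<in>J. g j (v i) * f i (w j))"
    using D by (intro sum.cong refl functional_expand[OF assms(2)]) auto
  also have "\<dots> = (\<Sum>j\<in>J. \<Sum>i\<in>I. f i (w j) * g j (v i))"
    by (subst sum.swap) (simp add: mult.commute)
  also have "\<dots> = (\<Sum>j\<in>J. g j (w j))"
    using E by (intro sum.cong refl functional_expand[OF assms(1), symmetric]) auto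
  also have "\<dots> = of_nat (card J)" using E by simp
  finally have "(of_nat (card I) :: complex fps) = of_nat (card J)" .
  then show ?thesis by (simp only: of_nat_eq_iff)
qed

lemma dual_basis_torsion_free:
  assumes "dual_basis J U b f" "u \<in> U" "a *s u = 0" "a \<noteq> 0"
  shows "u = 0"
proof -
  note D = dual_basisD[OF assms(1)]
  have "f j u = 0" if "j \<in> J" for j
    using functional_scale[OF D(4)[OF that] assms(2), of a] assms D
      functional_zero[OF D(4)[OF that] D(2)] by simp
  then have "(\<Sum>j\<in>J. f j u *s b j) = 0" by (intro sum.neutral) auto
  then show ?thesis using D(6)[OF assms(2)] by simp
qed

lemma free_of_rank_imp_dual_basis:
  assumes "free_of_rank scale m U"
  obtains b f where "dual_basis {..<m} U b f"
proof -
  obtain B where B: "finite B" "card B = m" "independent B" "span B = U"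
    using assms unfolding free_of_rank_def by auto
  obtain b where b: "bij_betw b {..<m} B"
    using ex_bij_betw_nat_finite[OF B(1)] B(2) by (auto simp: atLeast0LessThan)
  define f where "f j u = representation B u (b j)" for j u
  have bB: "b j \<in> B" if "j < m" for j using b that by (auto simp: bij_betw_def)
  have inj: "b i = b j \<longleftrightarrow> i = j" if "i < m" "j < m" for i j
    using b that by (auto simp: bij_betw_def inj_on_def)
  have "dual_basis {..<m} U b f"
    unfolding dual_basis_def
  proof (intro conjI ballI)
    show "finite {..<m}" by simp
    show "subspace U" using B by auto
    show "b j \<in> U" if "j \<in> {..<m}" for j using bB that B span_base by auto
    show "functional U (f j)" for j
      unfolding functional_def f_def B(4)[symmetric]
      using representation_add[OF B(3)] representation_scale[OF B(3)] by auto
    show "f i (b j) = (if i = j then 1 else 0)" if "i \<in> {..<m}" "j \<in> {..<m}" for i j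
      using that representation_basis[OF B(3) bB] inj by (auto simp: f_def)
    show "u = (\<Sum>j\<in>{..<m}. f j u *s b j)" if "u \<in> U" for u
    proof -
      have "(\<Sum>j\<in>{..<m}. f j u *s b j) = (\<Sum>v\<in>B. representation B u v *s v)"
        unfolding f_def by (rule sum.reindex_bij_betw[OF b])
      also have "\<dots> = u"
        using B that by (intro sum_representation_eq) auto
      finally show ?thesis by simp
    qed
  qed
  then show ?thesis by (rule that)
qed

text \<open>As \<open>g v = 1\<close> is a combination of the coordinates \<open>f j v\<close> and
  the ring is local, some \<open>f j v\<close> is a unit. Then \<open>v\<close> can replace
  \<open>b j\<close> in the basis, and the projections of the other basis vectors along
  \<open>v\<close> form a basis of the kernel of \<open>g\<close>.\<close>

lemma dual_basis_kernel:
  assumes "dual_basis J U b f" "v \<in> U" "functional U g" "g v = 1"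
  obtains j b' f' where "j \<in> J" "dual_basis (J - {j}) {u \<in> U. g u = 0} b' f'"
proof -
  note D = dual_basisD[OF assms(1)]
  have "\<exists>j\<in>J. f j v dvd 1"
  proof (rule ccontr)
    assume neg: "\<not> ?thesis"
    have "fps_X dvd f j v * g (b j)" if "j \<in> J" for j
      using neg that unfolding fps_dvd_one_iff by (auto simp: fps_X_dvd_iff)
    then have "fps_X dvd g v"
      unfolding functional_expand[OF assms(1,3,2)] by (rule dvd_sum)
    then show False using assms(4) by (simp add: fps_X_dvd_iff)
  qed
  then obtain j c where j: "j \<in> J" and c: "f j v * c = 1" unfolding dvd_def by metis
  define b' where "b' i = b i - g (b i) *s v" for i
  \<comment> \<open>All the \<open>b' i\<close> together span the kernel, and the multiples of the
    \<open>b' i\<close> by the \<open>f i v\<close> sum to 0. Eliminating \<open>b' j\<close> with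
    the inverse \<open>c\<close> of \<open>f j v\<close> leads to these coordinates.\<close>
  define f' where "f' i u = f i u - c * f i v * f j u" for i u
  have U': "subspace {u \<in> U. g u = 0}"
    using D(2) assms(3) by (auto intro!: subspaceI intro: subspace_0 subspace_add subspace_scale
        simp: functional_add functional_scale functional_zero)
  have gb: "b' i \<in> U \<and> g (b' i) = 0" if "i \<in> J" for i
    using D that assms unfolding b'_def
    by (auto intro!: subspace_diff subspace_scale simp: functional_diff functional_scale subspace_scale)
  have "dual_basis (J - {j}) {u \<in> U. g u = 0} b' f'"
    unfolding dual_basis_def
  proof (intro conjI ballI U')
    show "finite (J - {j})" using D by simp
    show "b' i \<in> {u \<in> U. g u = 0}" if "i \<in> J - {j}" for i using gb that by auto
    show "functional {u \<in> U. g u = 0} (f' i)" if "i \<in> J - {j}" for i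
    proof -
      have "functional U (f i)" "functional U (f j)" using D(4) j that by auto
      then show ?thesis unfolding functional_def f'_def by (auto simp: algebra_simps)
    qed
    show "f' i (b' l) = (if i = l then 1 else 0)" if "i \<in> J - {j}" "l \<in> J - {j}" for i l
    proof -
      have "f h (b' l) = f h (b l) - g (b l) * f h v" if "h \<in> J" for h
      proof -
        have "b l \<in> U" "g (b l) *s v \<in> U" using D(2,3) assms(2) \<open>l \<in> J - {j}\<close>
          by (auto intro: subspace_scale)
        then show ?thesis
          using functional_diff[OF D(4)[OF that] D(2)] functional_scale[OF D(4)[OF that] assms(2)]
          by (simp add: b'_def)
      qed
      then have "f' i (b' l) = f i (b l) - g (b l) * f i v - c * f i v * (f j (b l) - g (b l) * f j v)"
        using that j by (simp add: f'_def)
      also have "\<dots> = f i (b l) - c * f i v * f j (b l) + g (b l) * f i v * (f j v * c - 1)"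
        by (simp add: algebra_simps)
      finally show ?thesis using c D(5) that j by auto
    qed
    show "u = (\<Sum>i\<in>J - {j}. f' i u *s b' i)" if "u \<in> {u \<in> U. g u = 0}" for u
    proof -
      have u: "u \<in> U" "g u = 0" using that by auto
      have fs: "(\<Sum>i\<in>J. f i w *s b' i) = w - g w *s v" if "w \<in> U" for w
      proof -
        have "(\<Sum>i\<in>J. f i w *s b' i) = (\<Sum>i\<in>J. f i w *s b i) - (\<Sum>i\<in>J. f i w * g (b i)) *s v"
          unfolding b'_def by (simp add: scale_right_diff_distrib sum_subtractf scale_sum_left)
        then show ?thesis using D(6) that functional_expand[OF assms(1,3) that] by simp
      qed
      have "(\<Sum>i\<in>J - {j}. f' i u *s b' i) = (\<Sum>i\<in>J. f' i u *s b' i)"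
        using c by (intro sum.mono_neutral_left D(1)) (auto simp: f'_def mult.commute)
      also have "\<dots> = (\<Sum>i\<in>J. f i u *s b' i) - (c * f j u) *s (\<Sum>i\<in>J. f i v *s b' i)"
        by (simp add: f'_def scale_left_diff_distrib sum_subtractf scale_sum_right mult_ac)
      also have "\<dots> = u" using fs u assms by simp
      finally show ?thesis by simp
    qed
  qed
  with j show ?thesis by (rule that)
qed

lemma functional_projection:
  assumes "subspace U" "functional U g" "v \<in> U" "g v = 1" "u \<in> U"
  shows "u - g u *s v \<in> {u \<in> U. g u = 0}"
  using functional_diff[OF assms(2,1,5) subspace_scale[OF assms(1,3)]]
    functional_scale[OF assms(2,3)] assms by (auto intro: subspace_diff subspace_scale)

text \<open>Reverse of \<open>dual_basis_kernel\<close>: \<open>U\<close> is the direct sum of the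
  multiples of \<open>v\<close> and the kernel of \<open>g\<close>, so the old coordinates are
  composed with the projection onto the kernel.\<close>

lemma dual_basis_extend:
  assumes U: "subspace U" and g: "functional U g" and v: "v \<in> U" "g v = 1" and j: "j \<notin> J"
    and db: "dual_basis J {u \<in> U. g u = 0} b f"
  shows "dual_basis (insert j J) U (b(j := v)) ((\<lambda>i u. f i (u - g u *s v))(j := g))"
proof -
  note D = dual_basisD[OF db]
  have pr: "u - g u *s v \<in> {u \<in> U. g u = 0}" if "u \<in> U" for u
    using functional_projection[OF U g v that] .
  show ?thesis
    unfolding dual_basis_def
  proof (intro conjI ballI U)
    show "finite (insert j J)" using D by simp
    show "(b(j := v)) i \<in> U" if "i \<in> insert j J" for i using D(3) that v by auto
    show "functional U (((\<lambda>i u. f i (u - g u *s v))(j := g)) i)" if "i \<in> insert j J" for i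
    proof (cases "i = j")
      case False
      with that have i: "i \<in> J" by simp
      have "f i (x + y - g (x + y) *s v) = f i (x - g x *s v) + f i (y - g y *s v)"
        if "x \<in> U" "y \<in> U" for x y
      proof -
        have "x + y - g (x + y) *s v = (x - g x *s v) + (y - g y *s v)"
          using functional_add[OF g that] by (simp add: scale_left_distrib)
        then show ?thesis using functional_add[OF D(4)[OF i] pr[OF that(1)] pr[OF that(2)]] by metis
      qed
      moreover have "f i (a *s x - g (a *s x) *s v) = a * f i (x - g x *s v)" if "x \<in> U" for a x
      proof -
        have "a *s x - g (a *s x) *s v = a *s (x - g x *s v)"
          using functional_scale[OF g that] by (simp add: scale_right_diff_distrib)
        then show ?thesis using functional_scale[OF D(4)[OF i] pr[OF that]] by metis
      qed
      ultimately show ?thesis using False by (simp add: functional_def)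
    qed (simp add: g)
    show "((\<lambda>i u. f i (u - g u *s v))(j := g)) i ((b(j := v)) l) = (if i = l then 1 else 0)"
      if "i \<in> insert j J" "l \<in> insert j J" for i l
      using that j v D(3,5) functional_zero[OF D(4) D(2)] by auto
    show "u = (\<Sum>i\<in>insert j J. ((\<lambda>i u. f i (u - g u *s v))(j := g)) i u *s (b(j := v)) i)"
      if "u \<in> U" for u
    proof -
      have "(\<Sum>i\<in>J. ((\<lambda>i u. f i (u - g u *s v))(j := g)) i u *s (b(j := v)) i)
        = (\<Sum>i\<in>J. f i (u - g u *s v) *s b i)"
        using j by (intro sum.cong) auto
      also have "\<dots> = u - g u *s v" using D(6)[OF pr[OF that]] .
      finally show ?thesis using j D(1) by simp
    qed
  qed
qed

text \<open>Linear algebra over the complex numbers, acting as constant power series: a basis of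
  \<open>W\<close> stays independent after \<open>v\<close> is adjoined. The result is linear over
  the constants only; \<open>functional_separating\<close> lifts it.\<close>

lemma complex_functional_exists:
  assumes "subspace W" "v \<notin> W"
  obtains g :: "'a \<Rightarrow> complex" where "\<And>x y. g (x + y) = g x + g y"
    "\<And>c x. g (fps_const c *s x) = c * g x" "\<And>w. w \<in> W \<Longrightarrow> g w = 0" "g v = 1"
proof -
  interpret V: vector_space "\<lambda>c. scale (fps_const c)"
    by unfold_locales (auto simp: scale_right_distrib scale_left_distrib simp flip: fps_const_add fps_const_mult)
  interpret VC: vector_space "(*) :: complex \<Rightarrow> complex \<Rightarrow> complex"
    by unfold_locales (auto simp: algebra_simps)
  interpret P: vector_space_pair "\<lambda>c. scale (fps_const c)" "(*) :: complex \<Rightarrow> complex \<Rightarrow> complex" ..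
  have W: "V.subspace W"
    using assms(1) by (auto intro!: V.subspaceI intro: subspace_0 subspace_add subspace_scale)
  obtain B where B: "B \<subseteq> W" "V.independent B" "V.span B = W"
    by (metis V.basis_exists V.span_subspace W)
  have ind: "V.independent (insert v B)" using B assms(2) by (simp add: V.independent_insertI)
  obtain g where g: "Vector_Spaces.linear (\<lambda>c. scale (fps_const c)) (*) g"
      "\<forall>x\<in>insert v B. g x = (if x = v then 1 else 0)"
    using P.linear_independent_extend[OF ind, of "\<lambda>x. if x = v then 1 else 0"] by blast
  interpret g: Vector_Spaces.linear "\<lambda>c. scale (fps_const c)" "(*)" g by fact
  have "g w = 0" if "w \<in> W" for w
  proof -
    have "w \<in> V.span B" using that B by simp
    then show ?thesis
      by (induction rule: V.span_induct_alt) (use g(2) B assms(2) in \<open>auto simp: g.add g.scale\<close>)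
  qed
  then show ?thesis using that[of g] g(2) g.add g.scale by auto
qed

end

section \<open>Chains between a free module and its multiple by the square of the variable\<close>

context fps_module
begin

text \<open>With \<open>X\<close> for \<open>fps_X\<close>, such a chain induces two chains of
  subspaces in the complex vector space \<open>U\<close> modulo \<open>X U\<close>: the images of
  the \<open>N i\<close>, and the classes of those \<open>u\<close> with \<open>X u\<close> in
  \<open>N i\<close>. The exponent 2 ensures that higher powers of \<open>X\<close> impose no
  further condition.\<close>

definition flag :: "nat \<Rightarrow> 'a set \<Rightarrow> (nat \<Rightarrow> 'a set) \<Rightarrow> bool" where
  "flag n U N \<longleftrightarrow> N 0 = U \<and> (\<forall>i\<le>n. subspace (N i) \<and> (\<forall>u\<in>U. fps_X^2 *s u \<in> N i)) \<and>
     (\<forall>i j. i \<le> j \<and> j \<le> n \<longrightarrow> N j \<subseteq> N i)"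

lemma flagD:
  assumes "flag n U N"
  shows "N 0 = U" "\<And>i. i \<le> n \<Longrightarrow> subspace (N i)" "\<And>i u. i \<le> n \<Longrightarrow> u \<in> U \<Longrightarrow> fps_X^2 *s u \<in> N i"
    "\<And>i j. i \<le> j \<Longrightarrow> j \<le> n \<Longrightarrow> N j \<subseteq> N i" "\<And>i. i \<le> n \<Longrightarrow> N i \<subseteq> U"
proof -
  show 1: "N 0 = U" "\<And>i. i \<le> n \<Longrightarrow> subspace (N i)" "\<And>i u. i \<le> n \<Longrightarrow> u \<in> U \<Longrightarrow> fps_X^2 *s u \<in> N i"
    "\<And>i j. i \<le> j \<Longrightarrow> j \<le> n \<Longrightarrow> N j \<subseteq> N i"
    using assms unfolding flag_def by blast+
  show "\<And>i. i \<le> n \<Longrightarrow> N i \<subseteq> U" using 1(1) 1(4)[of 0] by auto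
qed

lemma greatest_index:
  fixes P :: "nat \<Rightarrow> bool"
  assumes "P i" "i \<le> n"
  obtains m where "P m" "m \<le> n" "\<And>j. m < j \<Longrightarrow> j \<le> n \<Longrightarrow> \<not> P j"
proof -
  let ?m = "Max {i. i \<le> n \<and> P i}"
  have fin: "finite {i. i \<le> n \<and> P i}" by simp
  then have "?m \<in> {i. i \<le> n \<and> P i}" using assms by (intro Max_in) auto
  moreover have "\<not> P j" if "?m < j" "j \<le> n" for j
  proof
    assume "P j"
    then have "j \<le> ?m" using that fin by (intro Max_ge) auto
    then show False using that(1) by simp
  qed
  ultimately show ?thesis using that by blast
qed

text \<open>Over the complex numbers \<open>v\<close> is separated from \<open>W\<close> by some
  \<open>h\<close>. Since \<open>X U\<close> lies in \<open>W\<close>, \<open>h u\<close> depends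
  only on the constant terms of the coordinates of \<open>u\<close>, so it is the constant term of
  \<open>g0 u\<close>, where \<open>g0\<close> takes the values of \<open>h\<close> on the basis.
  Dividing by the unit \<open>g0 v\<close> normalises the functional.\<close>

lemma functional_separating:
  assumes db: "dual_basis J U b f" and W: "subspace W" "W \<subseteq> U" "\<And>u. u \<in> U \<Longrightarrow> fps_X *s u \<in> W"
    and v: "v \<in> U" "v \<notin> W"
  obtains g where "functional U g" "g v = 1" "\<And>w. w \<in> W \<Longrightarrow> fps_X dvd g w"
proof -
  note D = dual_basisD[OF db]
  obtain h :: "'a \<Rightarrow> complex" where h: "\<And>x y. h (x + y) = h x + h y"
    "\<And>c x. h (fps_const c *s x) = c * h x" "\<And>w. w \<in> W \<Longrightarrow> h w = 0" "h v = 1"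
    using complex_functional_exists[OF W(1) v(2)] by blast
  have h_sum: "h (sum F A) = (\<Sum>j\<in>A. h (F j))" for F and A :: "'b set"
    using h(1) h(3)[OF subspace_0[OF W(1)]] by (induction A rule: infinite_finite_induct) auto
  define g0 where "g0 u = (\<Sum>j\<in>J. fps_const (h (b j)) * f j u)" for u
  have g0: "functional U g0"
    using D(4) unfolding functional_def g0_def
    by (auto simp: distrib_left sum.distrib sum_distrib_left mult.left_commute)
  have h_scale: "h (a *s u) = fps_nth a 0 * h u" if "u \<in> U" for a u
  proof -
    obtain r where r: "a - fps_const (fps_nth a 0) = fps_X * r"
      using fps_X_dvd_iff[of "a - fps_const (fps_nth a 0)"] by (auto simp: dvd_def)
    have "a = fps_const (fps_nth a 0) + fps_X * r" using r by (simp add: algebra_simps)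
    then have "h (a *s u) = h (fps_const (fps_nth a 0) *s u + fps_X *s (r *s u))"
      by (metis scale_left_distrib scale_scale)
    also have "\<dots> = fps_nth a 0 * h u"
      using h(3)[OF W(3)[OF subspace_scale[OF D(2) that]], of r] by (simp only: h(1,2)) simp
    finally show ?thesis .
  qed
  have g0_0: "fps_nth (g0 u) 0 = h u" if "u \<in> U" for u
  proof -
    have "h u = h (\<Sum>j\<in>J. f j u *s b j)" using D(6)[OF that] by simp
    also have "\<dots> = (\<Sum>j\<in>J. fps_nth (f j u) 0 * h (b j))"
      unfolding h_sum using D(3) by (intro sum.cong) (auto simp: h_scale)
    finally show ?thesis by (simp add: g0_def fps_sum_nth mult.commute)
  qed
  have "g0 v dvd 1" using g0_0[OF v(1)] h by simp
  then obtain c where c: "g0 v * c = 1" unfolding dvd_def by metis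
  have "functional U (\<lambda>u. c * g0 u)"
    using g0 unfolding functional_def by (auto simp: algebra_simps)
  moreover have "fps_X dvd c * g0 w" if "w \<in> W" for w
    using g0_0[of w] h(3)[OF that] that W(2) by (auto simp: fps_X_dvd_iff)
  ultimately show ?thesis using c that[of "\<lambda>u. c * g0 u"] by (simp add: mult.commute)
qed

text \<open>
  Among the primitive vectors \<open>v\<close> of \<open>U\<close> whose multiple \<open>X v\<close> survives longest in the flag,
  one that itself survives longest spans a direct summand of the whole flag.
\<close>

lemma flag_split_vector:
  assumes db: "dual_basis J U b f" and "J \<noteq> {}" and fl: "flag n U N"
  obtains v g a where "v \<in> U" "functional U g" "g v = 1"
    "\<And>i. i \<le> n \<Longrightarrow> fps_X ^ a i *s v \<in> N i" "\<And>i. i \<le> n \<Longrightarrow> a i \<le> (2 :: nat)"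
    "\<And>i u. i \<le> n \<Longrightarrow> u \<in> N i \<Longrightarrow> fps_X ^ a i dvd g u"
proof -
  note D = dual_basisD[OF db] and F = flagD[OF fl]
  define XU where "XU = (*s) fps_X ` U"
  obtain j where j: "j \<in> J" using assms(2) by auto
  have "b j \<notin> XU"
  proof
    assume "b j \<in> XU"
    then obtain u where u: "u \<in> U" "b j = fps_X *s u" by (auto simp: XU_def)
    have "(1 :: complex fps) = fps_X * f j u"
      using D(5)[OF j j] functional_scale[OF D(4)[OF j] u(1)] u(2) by simp
    then have "fps_X dvd (1 :: complex fps)" by (rule dvdI)
    then show False unfolding fps_X_dvd_iff by simp
  qed
  then have "\<exists>v\<in>U. v \<notin> XU \<and> fps_X *s v \<in> N 0"
    using D(2,3) j F(1) by (auto intro: subspace_scale)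
  from greatest_index[where P = "\<lambda>q. \<exists>v\<in>U. v \<notin> XU \<and> fps_X *s v \<in> N q", OF this le0]
  obtain q where q: "\<exists>v\<in>U. v \<notin> XU \<and> fps_X *s v \<in> N q" "q \<le> n"
    and q_max: "\<And>i. q < i \<Longrightarrow> i \<le> n \<Longrightarrow> \<not> (\<exists>v\<in>U. v \<notin> XU \<and> fps_X *s v \<in> N i)" by metis
  have "\<exists>v\<in>N 0. v \<notin> XU \<and> fps_X *s v \<in> N q" using q(1) F(1) by simp
  from greatest_index[where P = "\<lambda>i. \<exists>v\<in>N i. v \<notin> XU \<and> fps_X *s v \<in> N q", OF this le0]
  obtain p where p: "\<exists>v\<in>N p. v \<notin> XU \<and> fps_X *s v \<in> N q" "p \<le> n"
    and p_max: "\<And>i. p < i \<Longrightarrow> i \<le> n \<Longrightarrow> \<not> (\<exists>v\<in>N i. v \<notin> XU \<and> fps_X *s v \<in> N q)" by metis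
  obtain v where v: "v \<in> N p" "v \<notin> XU" "fps_X *s v \<in> N q" using p by auto
  have vU: "v \<in> U" using v(1) F(5)[OF p(2)] by auto
  \<comment> \<open>The functional has to be divisible by \<open>X\<close> on all members of the
    flag after \<open>p\<close>, so \<open>v\<close> is separated from \<open>X U + T\<close>. If
    \<open>p\<close> is the last index, no later member exists and \<open>T\<close> is
    \<open>{0}\<close>.\<close>
  define T where "T = (if p < n then N (Suc p) else {0})"
  define W where "W = {fps_X *s u + w | u w. u \<in> U \<and> w \<in> T}"
  have T: "subspace T" "T \<subseteq> U" using F D(2) by (auto simp: T_def subspace_0)
  have XU: "subspace XU"
  proof (rule subspaceI)
    show "0 \<in> XU" unfolding XU_def using subspace_0[OF D(2)] by (auto intro: image_eqI[of _ _ 0])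
    show "x + y \<in> XU" if xy: "x \<in> XU" "y \<in> XU" for x y
    proof -
      obtain x' y' where "x' \<in> U" "x = fps_X *s x'" "y' \<in> U" "y = fps_X *s y'"
        using xy unfolding XU_def by blast
      then show ?thesis using subspace_add[OF D(2), of x' y']
        by (simp add: XU_def scale_right_distrib[symmetric])
    qed
    show "c *s x \<in> XU" if x: "x \<in> XU" for c x
    proof -
      obtain x' where "x' \<in> U" "x = fps_X *s x'" using x unfolding XU_def by blast
      then show ?thesis using subspace_scale[OF D(2), of x' c]
        by (simp add: XU_def scale_left_commute[of c] del: scale_scale)
    qed
  qed
  have W_eq: "W = {x + y | x y. x \<in> XU \<and> y \<in> T}" by (auto simp: W_def XU_def)
  have W: "subspace W"
    unfolding W_eq
  proof (rule subspaceI)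
    show "0 \<in> {x + y | x y. x \<in> XU \<and> y \<in> T}"
      using subspace_0[OF XU] subspace_0[OF T(1)] by force
    fix x y c assume x: "x \<in> {x + y | x y. x \<in> XU \<and> y \<in> T}"
    then show "c *s x \<in> {x + y | x y. x \<in> XU \<and> y \<in> T}"
      using subspace_scale[OF XU] subspace_scale[OF T(1)] by (auto simp: scale_right_distrib) blast
    assume "y \<in> {x + y | x y. x \<in> XU \<and> y \<in> T}"
    then obtain x1 x2 y1 y2 where "x = x1 + x2" "y = y1 + y2" "x1 \<in> XU" "y1 \<in> XU" "x2 \<in> T" "y2 \<in> T"
      using x by blast
    then show "x + y \<in> {x + y | x y. x \<in> XU \<and> y \<in> T}"
      using subspace_add[OF XU, of x1 y1] subspace_add[OF T(1), of x2 y2]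
      by (intro CollectI exI[of _ "x1 + y1"] exI[of _ "x2 + y2"]) (simp add: algebra_simps)
  qed
  have TW: "T \<subseteq> W" unfolding W_eq using subspace_0[OF XU] by force
  have XW: "XU \<subseteq> W" unfolding W_eq using subspace_0[OF T(1)] by force
  have WU: "W \<subseteq> U" unfolding W_def using T(2) D(2) by (auto intro: subspace_add subspace_scale)
  have "v \<notin> W"
  proof
    assume "v \<in> W"
    then obtain u w where uw: "u \<in> U" "w \<in> T" "v = fps_X *s u + w" by (auto simp: W_def)
    have w: "w \<notin> XU"
    proof
      assume "w \<in> XU"
      then have "fps_X *s u + w \<in> XU" using uw(1) XU by (intro subspace_add) (auto simp: XU_def)
      then show False using v uw by simp
    qed
    then have pn: "p < n" "w \<in> N (Suc p)" using uw(2) subspace_0[OF XU] by (auto simp: T_def split: if_splits)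
    \<comment> \<open>\<open>w\<close> is congruent to \<open>v\<close> modulo \<open>X U\<close>,
      and as \<open>N q\<close> contains \<open>X^2 U\<close>, it meets the condition that defines
      \<open>p\<close>, but one place later.\<close>
    have "fps_X *s w = fps_X *s v - fps_X^2 *s u"
      using uw(3) by (simp add: scale_right_distrib power2_eq_square)
    also have "\<dots> \<in> N q" using v(3) F(2,3) q(2) uw(1) by (intro subspace_diff) auto
    finally show False using p_max[of "Suc p"] pn w by auto
  qed
  have XW': "fps_X *s u \<in> W" if "u \<in> U" for u using XW that by (auto simp: XU_def)
  obtain g where g: "functional U g" "g v = 1" "\<And>w. w \<in> W \<Longrightarrow> fps_X dvd g w"
    using functional_separating[OF db W WU XW' vU \<open>v \<notin> W\<close>] by blast
  \<comment> \<open>After \<open>q\<close> no primitive vector has its \<open>X\<close>-multiple in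
    \<open>N i\<close>. Applied first to \<open>u\<close> and then to \<open>u1\<close>, this shows
    that every element of \<open>N i\<close> is a multiple of \<open>X^2\<close>.\<close>
  have beyond: "fps_X ^ 2 dvd g u" if "q < i" "i \<le> n" "u \<in> N i" for i u
  proof -
    have u: "u \<in> U" using that F(5) by auto
    have "u \<in> XU" using q_max[OF that(1,2)] u that subspace_scale[OF F(2)] by blast
    then obtain u1 where u1: "u1 \<in> U" "u = fps_X *s u1" by (auto simp: XU_def)
    then have "u1 \<in> XU" using q_max[OF that(1,2)] that(3) by blast
    then obtain u2 where u2: "u2 \<in> U" "u1 = fps_X *s u2" by (auto simp: XU_def)
    have "u = fps_X^2 *s u2" using u1 u2 by (simp add: power2_eq_square)
    then show ?thesis using functional_scale[OF g(1) u2(1)] by simp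
  qed
  \<comment> \<open>\<open>v\<close> itself lies in \<open>N i\<close> up to \<open>p\<close>,
    \<open>X v\<close> up to \<open>q\<close>, and \<open>X^2 v\<close> always.\<close>
  define a where "a i = (if i \<le> p then 0 else if i \<le> q then 1 else 2 :: nat)" for i
  show ?thesis
  proof (rule that[of v g a])
    show "fps_X ^ a i *s v \<in> N i" if "i \<le> n" for i
      using F(4)[of i p] F(4)[of i q] F(3)[OF that vU] v p q by (auto simp: a_def)
    show "fps_X ^ a i dvd g u" if "i \<le> n" "u \<in> N i" for i u
    proof (cases "i \<le> p \<or> q < i")
      case False
      then have "u \<in> T" using F(4)[of "Suc p" i] that by (auto simp: T_def)
      then show ?thesis using TW g(3) False by (auto simp: a_def)
    qed (use that beyond in \<open>auto simp: a_def\<close>)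
  qed (use vU g in \<open>auto simp: a_def\<close>)
qed

text \<open>The kernel of the functional from \<open>flag_split_vector\<close> inherits a flag and
  has a basis with one index less, so the splitting can be repeated until the whole flag is
  diagonal.\<close>

lemma flag_split:
  assumes "dual_basis J U b f" and "flag n U N"
  obtains b' f' a where "dual_basis J U b' f'"
    "\<And>i. i \<le> n \<Longrightarrow> N i = {u \<in> U. \<forall>j\<in>J. fps_X ^ a j i dvd f' j u}"
    "\<And>i j. i \<le> n \<Longrightarrow> j \<in> J \<Longrightarrow> a j i \<le> (2 :: nat)"
proof -
  have "\<exists>b' f' a. dual_basis J U b' f' \<and>
    (\<forall>i\<le>n. N i = {u \<in> U. \<forall>j\<in>J. fps_X ^ a j i dvd f' j u}) \<and> (\<forall>i\<le>n. \<forall>j\<in>J. a j i \<le> (2 :: nat))"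
    using assms
  proof (induction "card J" arbitrary: J U b f N)
    case 0
    note D = dual_basisD[OF 0(2)] and F = flagD[OF 0(3)]
    have J: "J = {}" using 0 D by simp
    then have "U \<subseteq> {0}" using D(6) by auto
    then have "N i = U" if "i \<le> n" for i using F(5)[OF that] subspace_0[OF F(2)[OF that]] by auto
    then show ?case using 0(2) J by auto
  next
    case (Suc m)
    note D = dual_basisD[OF Suc(3)] and F = flagD[OF Suc(4)]
    have "J \<noteq> {}" using Suc(2) by auto
    then obtain v g a where v: "v \<in> U" and g: "functional U g" "g v = 1"
      and a: "\<And>i. i \<le> n \<Longrightarrow> fps_X ^ a i *s v \<in> N i" "\<And>i. i \<le> n \<Longrightarrow> a i \<le> (2 :: nat)"
        "\<And>i u. i \<le> n \<Longrightarrow> u \<in> N i \<Longrightarrow> fps_X ^ a i dvd g u"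
      using flag_split_vector[OF Suc(3) _ Suc(4)] by blast
    define U' where "U' = {u \<in> U. g u = 0}"
    obtain j b1 f1 where j: "j \<in> J" and db: "dual_basis (J - {j}) U' b1 f1"
      using dual_basis_kernel[OF Suc(3) v g] unfolding U'_def by blast
    have fl: "flag n U' (\<lambda>i. N i \<inter> U')"
      unfolding flag_def
    proof (intro conjI allI impI ballI)
      show "N 0 \<inter> U' = U'" using F(1) by (auto simp: U'_def)
      show "subspace (N i \<inter> U')" if "i \<le> n" for i
        using F(2)[OF that] dual_basisD(2)[OF db] by (rule subspace_inter)
      show "fps_X\<^sup>2 *s u \<in> N i \<inter> U'" if "i \<le> n" "u \<in> U'" for i u
        using F(3)[OF that(1), of u] that(2) subspace_scale[OF dual_basisD(2)[OF db] that(2), of "fps_X\<^sup>2"]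
        by (auto simp: U'_def)
      show "N i' \<inter> U' \<subseteq> N i \<inter> U'" if "i \<le> i' \<and> i' \<le> n" for i i'
        using F(4) that by blast
    qed
    have "m = card (J - {j})" using Suc(2) j D(1) by simp
    from Suc(1)[OF this db fl] obtain b2 f2 a2 where db2: "dual_basis (J - {j}) U' b2 f2"
      and N': "\<forall>i\<le>n. N i \<inter> U' = {u \<in> U'. \<forall>l\<in>J - {j}. fps_X ^ a2 l i dvd f2 l u}"
      and a2: "\<forall>i\<le>n. \<forall>l\<in>J - {j}. a2 l i \<le> (2 :: nat)" by blast
    define f3 where "f3 = (\<lambda>i u. f2 i (u - g u *s v))(j := g)"
    have db3: "dual_basis J U (b2(j := v)) f3"
      using dual_basis_extend[OF D(2) g(1) v g(2) _ db2[unfolded U'_def], of j]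
      unfolding f3_def insert_Diff[OF j] by simp
    have N_iff: "u \<in> N i \<longleftrightarrow> u \<in> U \<and> (\<forall>l\<in>J. fps_X ^ (a2(j := a)) l i dvd f3 l u)" if i: "i \<le> n" for i u
    proof (cases "u \<in> U \<and> fps_X ^ a i dvd g u")
      case False
      then have "u \<notin> N i" using F(5) a(3) i by auto
      moreover have "\<not> (u \<in> U \<and> (\<forall>l\<in>J. fps_X ^ (a2(j := a)) l i dvd f3 l u))"
        using False j by (auto simp: f3_def dest: bspec[of _ _ j])
      ultimately show ?thesis by blast
    next
      case True
      then obtain c where c: "g u = fps_X ^ a i * c" by (auto simp: dvd_def)
      have gv: "g u *s v \<in> N i"
        using subspace_scale[OF F(2)[OF i] a(1)[OF i], of c] c by (simp add: mult.commute)
      have pr: "u - g u *s v \<in> U'"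
        using functional_projection[OF D(2) g(1) v g(2)] True by (simp add: U'_def)
      \<comment> \<open>As \<open>g u\<close> times \<open>v\<close> lies in \<open>N i\<close>,
        membership of \<open>u\<close> is decided by its projection to the kernel of
        \<open>g\<close>.\<close>
      have "u \<in> N i \<longleftrightarrow> u - g u *s v \<in> N i"
        using subspace_add[OF F(2)[OF i] _ gv, of "u - g u *s v"] subspace_diff[OF F(2)[OF i] _ gv, of u]
        by auto
      also have "\<dots> \<longleftrightarrow> u - g u *s v \<in> N i \<inter> U'" using pr by simp
      also have "\<dots> \<longleftrightarrow> (\<forall>l\<in>J - {j}. fps_X ^ a2 l i dvd f2 l (u - g u *s v))"
        using N' i pr by auto
      also have "\<dots> \<longleftrightarrow> (\<forall>l\<in>J. fps_X ^ (a2(j := a)) l i dvd f3 l u)"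
        using True by (auto simp: f3_def)
      finally show ?thesis using True by simp
    qed
    show ?case
    proof (intro exI[of _ "b2(j := v)"] exI[of _ f3] exI[of _ "a2(j := a)"] conjI allI impI ballI)
      show "N i = {u \<in> U. \<forall>l\<in>J. fps_X ^ (a2(j := a)) l i dvd f3 l u}" if "i \<le> n" for i
        by (intro set_eqI) (simp only: N_iff[OF that] mem_Collect_eq)
    qed (use db3 a a2 in auto)
  qed
  then show ?thesis using that by blast
qed

end

section \<open>The chain of lattices of a module\<close>

text \<open>The representative in \<open>{1..n}\<close> of the class of \<open>r + i\<close>. The
  shifts by 1 come from numbering the vertices from 1 instead of 0.\<close>

definition vtx :: "nat \<Rightarrow> nat \<Rightarrow> nat \<Rightarrow> nat" where
  "vtx n r i = (r - 1 + i) mod n + 1"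

lemma vtx_in: "0 < n \<Longrightarrow> vtx n r i \<in> {1..n}"
  by (simp add: vtx_def Suc_le_eq)

lemma vtx_0: "r \<in> {1..n} \<Longrightarrow> vtx n r 0 = r"
  by (auto simp: vtx_def)

lemma vtx_n: "r \<in> {1..n} \<Longrightarrow> vtx n r n = r"
  unfolding vtx_def mod_add_self2 by auto

lemma prv_in: "q \<in> {1..n} \<Longrightarrow> prv n q \<in> {1..n}"
  and nxt_in: "q \<in> {1..n} \<Longrightarrow> nxt n q \<in> {1..n}"
  and nxt_prv: "q \<in> {1..n} \<Longrightarrow> nxt n (prv n q) = q"
  by (auto simp: prv_def nxt_def)

lemma nxt_vtx: "0 < n \<Longrightarrow> nxt n (vtx n r i) = vtx n r (Suc i)"
  by (auto simp: vtx_def nxt_def mod_Suc)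

lemma prv_vtx_Suc: "0 < n \<Longrightarrow> prv n (vtx n r (Suc i)) = vtx n r i"
  by (auto simp: vtx_def prv_def mod_Suc)

lemma vtx_nxt: "r \<in> {1..n} \<Longrightarrow> vtx n (nxt n r) i = vtx n r (Suc i)"
  by (auto simp: vtx_def nxt_def)

lemma bij_betw_vtx:
  assumes "r \<in> {1..n}"
  shows "bij_betw (vtx n r) {1..n} {1..n}"
proof -
  have "vtx n r ` {1..n} = {1..n}"
  proof (intro equalityI subsetI)
    fix q assume "q \<in> vtx n r ` {1..n}"
    then show "q \<in> {1..n}" using vtx_in[of n r] assms by auto
  next
    fix q assume q: "q \<in> {1..n}"
    show "q \<in> vtx n r ` {1..n}"
    proof (cases "r < q")
      case True
      then have "vtx n r (q - r) = q" "q - r \<in> {1..n}" using q assms by (auto simp: vtx_def)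
      then show ?thesis by (metis imageI)
    next
      case False
      then have "r - 1 + (q + n - r) = q - 1 + n" using q assms by auto
      then have "vtx n r (q + n - r) = q" using q unfolding vtx_def by (simp only: mod_add_self2) auto
      moreover have "q + n - r \<in> {1..n}" using q assms False by auto
      ultimately show ?thesis by (metis imageI)
    qed
  qed
  then show ?thesis by (simp add: bij_betw_def eq_card_imp_inj_on)
qed

section \<open>Modules seen as chains of lattices at one vertex\<close>

locale cm_rep =
  fixes k n m :: nat and M :: "'a::ab_group_add quiver_rep"
  assumes CM: "CM_module k n m M" and n_pos: "0 < n" and k_le_n: "k \<le> n"
begin

sublocale fps_module "scl M"
  using CM by (simp add: fps_module_def CM_module_def)

abbreviation V :: "nat \<Rightarrow> 'a set" where "V \<equiv> vsp M"

lemma free: assumes "q \<in> {1..n}" obtains b f where "dual_basis {..<m} (V q) b f"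
  using CM assms free_of_rank_imp_dual_basis[of m "V q"] unfolding CM_module_def by blast

lemma subspace_V: "q \<in> {1..n} \<Longrightarrow> subspace (V q)"
  by (metis dual_basisD(2) free)

lemma torsion_free: "q \<in> {1..n} \<Longrightarrow> u \<in> V q \<Longrightarrow> scl M a u = 0 \<Longrightarrow> a \<noteq> 0 \<Longrightarrow> u = 0"
  by (metis dual_basis_torsion_free free)

lemma xmap_linear: "q \<in> {1..n} \<Longrightarrow> linear_map_on (scl M) (scl M) (V (prv n q)) (V q) (xmap M q)"
  and ymap_linear: "q \<in> {1..n} \<Longrightarrow> linear_map_on (scl M) (scl M) (V q) (V (prv n q)) (ymap M q)"
  and xmap_ymap: "q \<in> {1..n} \<Longrightarrow> u \<in> V q \<Longrightarrow> xmap M q (ymap M q u) = scl M fps_X u"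
  and xpath_eq_ypath: "q \<in> {1..n} \<Longrightarrow> u \<in> V q \<Longrightarrow> xpath n M k q u = ypath n M (n - k) q u"
  using CM unfolding CM_module_def by blast+

lemma ymap_xmap:
  assumes "q \<in> {1..n}" "u \<in> V (prv n q)"
  shows "ymap M q (xmap M q u) = scl M fps_X u"
proof -
  have "xmap M (prv n q) (ymap M (prv n q) u) = ymap M (nxt n (prv n q)) (xmap M (nxt n (prv n q)) u)"
    using CM prv_in[OF assms(1)] assms(2) unfolding CM_module_def by blast
  then show ?thesis using xmap_ymap prv_in[OF assms(1)] assms(2) nxt_prv[OF assms(1)] by simp
qed

lemma xmap_in: "q \<in> {1..n} \<Longrightarrow> u \<in> V (prv n q) \<Longrightarrow> xmap M q u \<in> V q"
  and ymap_in: "q \<in> {1..n} \<Longrightarrow> u \<in> V q \<Longrightarrow> ymap M q u \<in> V (prv n q)"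
  and ymap_add: "q \<in> {1..n} \<Longrightarrow> u \<in> V q \<Longrightarrow> v \<in> V q \<Longrightarrow> ymap M q (u + v) = ymap M q u + ymap M q v"
  and ymap_scale: "q \<in> {1..n} \<Longrightarrow> u \<in> V q \<Longrightarrow> ymap M q (scl M a u) = scl M a (ymap M q u)"
  using xmap_linear[of q] ymap_linear[of q] unfolding linear_map_on_def by auto

text \<open>
  \<open>Y r i\<close> is the path \<open>y\<^sup>i\<close> that ends at \<open>r\<close>. It is injective, so it turns \<open>M\<close> into a chain of lattices
  \<open>L r 0 \<supseteq> L r 1 \<supseteq> \<dots> \<supseteq> L r n = X\<^sup>k L r 0\<close> in the single free module \<open>V r\<close>.
\<close>

definition Y :: "nat \<Rightarrow> nat \<Rightarrow> 'a \<Rightarrow> 'a" where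
  "Y r i u = ypath n M i (vtx n r i) u"

lemma Y_0 [simp]: "Y r 0 u = u"
  and Y_Suc: "Y r (Suc i) u = Y r i (ymap M (vtx n r (Suc i)) u)"
  using n_pos by (simp_all add: Y_def prv_vtx_Suc)

lemma Y_linear:
  assumes r: "r \<in> {1..n}"
  shows "linear_map_on (scl M) (scl M) (V (vtx n r i)) (V r) (Y r i)"
proof (induction i)
  case 0
  then show ?case using r by (simp add: linear_map_on_def vtx_0)
next
  case (Suc i)
  have q: "vtx n r (Suc i) \<in> {1..n}" using vtx_in n_pos by blast
  note y = ymap_linear[OF q, unfolded prv_vtx_Suc[OF n_pos]]
  show ?case
    unfolding linear_map_on_def Y_Suc
  proof (intro conjI ballI allI)
    show "(\<lambda>u. Y r i (ymap M (vtx n r (Suc i)) u)) ` V (vtx n r (Suc i)) \<subseteq> V r"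
      using y Suc unfolding linear_map_on_def by blast
    fix u v a assume u: "u \<in> V (vtx n r (Suc i))"
    then have yu: "ymap M (vtx n r (Suc i)) u \<in> V (vtx n r i)" using y unfolding linear_map_on_def by blast
    show "Y r i (ymap M (vtx n r (Suc i)) (scl M a u)) = scl M a (Y r i (ymap M (vtx n r (Suc i)) u))"
      using Suc yu ymap_scale[OF q u] unfolding linear_map_on_def by simp
    assume v: "v \<in> V (vtx n r (Suc i))"
    then have yv: "ymap M (vtx n r (Suc i)) v \<in> V (vtx n r i)" using y unfolding linear_map_on_def by blast
    show "Y r i (ymap M (vtx n r (Suc i)) (u + v)) =
        Y r i (ymap M (vtx n r (Suc i)) u) + Y r i (ymap M (vtx n r (Suc i)) v)"
      using Suc yu yv ymap_add[OF q u v] unfolding linear_map_on_def by simp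
  qed
qed

lemma Y_in: "r \<in> {1..n} \<Longrightarrow> u \<in> V (vtx n r i) \<Longrightarrow> Y r i u \<in> V r"
  and Y_add: "r \<in> {1..n} \<Longrightarrow> u \<in> V (vtx n r i) \<Longrightarrow> v \<in> V (vtx n r i) \<Longrightarrow> Y r i (u + v) = Y r i u + Y r i v"
  and Y_scale: "r \<in> {1..n} \<Longrightarrow> u \<in> V (vtx n r i) \<Longrightarrow> Y r i (scl M a u) = scl M a (Y r i u)"
  using Y_linear[of r i] unfolding linear_map_on_def by auto

lemma Y_zero: "r \<in> {1..n} \<Longrightarrow> Y r i 0 = 0"
  using Y_scale[of r 0 i 0] subspace_0[OF subspace_V[OF vtx_in[OF n_pos]]] by simp

lemma Y_diff: "r \<in> {1..n} \<Longrightarrow> u \<in> V (vtx n r i) \<Longrightarrow> v \<in> V (vtx n r i) \<Longrightarrow> Y r i (u - v) = Y r i u - Y r i v"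
  using Y_add[of r "u - v" i v] subspace_diff[OF subspace_V[OF vtx_in[OF n_pos]], of u r i v]
  by (simp add: eq_diff_eq)

text \<open>Each arrow \<open>y\<close> is injective, since \<open>x y\<close> is multiplication by
  \<open>X\<close> on a torsion-free module.\<close>

lemma Y_eq_0:
  assumes r: "r \<in> {1..n}"
  shows "u \<in> V (vtx n r i) \<Longrightarrow> Y r i u = 0 \<Longrightarrow> u = 0"
proof (induction i arbitrary: u)
  case (Suc i)
  have q: "vtx n r (Suc i) \<in> {1..n}" using vtx_in n_pos by blast
  have "ymap M (vtx n r (Suc i)) u \<in> V (vtx n r i)"
    using ymap_in[OF q Suc(2)] by (simp add: prv_vtx_Suc[OF n_pos])
  then have 0: "ymap M (vtx n r (Suc i)) u = 0" using Suc by (simp add: Y_Suc)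
  have "ymap M (vtx n r (Suc i)) 0 = 0"
    using ymap_scale[OF q subspace_0[OF subspace_V[OF q]], of 0] by simp
  then have y0: "xmap M (vtx n r (Suc i)) 0 = 0"
    using xmap_ymap[OF q subspace_0[OF subspace_V[OF q]]] by simp
  have "scl M fps_X u = 0" using xmap_ymap[OF q Suc(2)] 0 y0 by simp
  then show ?case using torsion_free[OF q Suc(2)] by simp
qed simp

lemma ypath_add:
  "ypath n M (a + b) (vtx n r (a + b)) u = ypath n M b (vtx n r b) (ypath n M a (vtx n r (a + b)) u)"
  by (induction a arbitrary: u) (use n_pos in \<open>simp_all add: prv_vtx_Suc\<close>)

lemma ypath_xpath:
  assumes "r \<in> {1..n}" "u \<in> V r"
  shows "ypath n M j (vtx n r j) (xpath n M j r u) = scl M (fps_X ^ j) u"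
  using assms
proof (induction j arbitrary: r u)
  case (Suc j)
  define q where "q = nxt n r"
  have q: "q \<in> {1..n}" and prv: "prv n q = r"
    using nxt_in[OF Suc(2)] prv_vtx_Suc[OF n_pos, of r 0] nxt_vtx[OF n_pos, of r 0] vtx_0[OF Suc(2)]
    by (simp_all add: q_def)
  have u': "xmap M q u \<in> V q" using xmap_in[OF q] Suc(3) prv by simp
  have v: "vtx n r (Suc j) = vtx n q j" "vtx n r 1 = q"
    using vtx_nxt[OF Suc(2)] vtx_0[OF q] by (auto simp: q_def)
  have "ypath n M (Suc j) (vtx n r (Suc j)) (xpath n M (Suc j) r u)
    = ypath n M 1 q (ypath n M j (vtx n q j) (xpath n M j q (xmap M q u)))"
    using ypath_add[of j 1 r] v by (simp add: q_def)
  also have "\<dots> = ymap M q (scl M (fps_X ^ j) (xmap M q u))"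
    using Suc(1)[OF q u'] by simp
  also have "\<dots> = scl M (fps_X ^ Suc j) u"
    using ymap_scale[OF q u'] ymap_xmap[OF q] Suc(3) prv by (simp add: mult.commute)
  finally show ?case .
qed (simp add: vtx_0)

text \<open>In the full turn \<open>y^n\<close>, the relation replaces the first
  \<open>n - k\<close> arrows by \<open>x^k\<close>, and \<open>y^k x^k\<close> collapses to
  \<open>X^k\<close>.\<close>

lemma Y_n:
  assumes "r \<in> {1..n}" "u \<in> V r"
  shows "Y r n u = scl M (fps_X ^ k) u"
proof -
  have "Y r n u = ypath n M k (vtx n r k) (ypath n M (n - k) (vtx n r n) u)"
    using ypath_add[of "n - k" k r u] k_le_n by (simp add: Y_def)
  also have "\<dots> = ypath n M k (vtx n r k) (xpath n M k r u)"
    using vtx_n[OF assms(1)] xpath_eq_ypath[OF assms] by simp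
  also have "\<dots> = scl M (fps_X ^ k) u" by (rule ypath_xpath[OF assms])
  finally show ?thesis .
qed

definition L :: "nat \<Rightarrow> nat \<Rightarrow> 'a set" where
  "L r i = Y r i ` V (vtx n r i)"

lemma L_0: "r \<in> {1..n} \<Longrightarrow> L r 0 = V r"
  by (auto simp: L_def vtx_0)

lemma L_n: "r \<in> {1..n} \<Longrightarrow> L r n = scl M (fps_X ^ k) ` V r"
  using Y_n by (auto simp: L_def vtx_n)

lemma subspace_L:
  assumes "r \<in> {1..n}"
  shows "subspace (L r i)"
proof -
  note S = subspace_V[OF vtx_in[OF n_pos, of r i]]
  show ?thesis
  proof (rule subspaceI)
    show "0 \<in> L r i" unfolding L_def using Y_zero[OF assms, of i] subspace_0[OF S] by (metis imageI)
    fix x y c assume x: "x \<in> L r i"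
    then obtain x' where x': "x' \<in> V (vtx n r i)" "x = Y r i x'" by (auto simp: L_def)
    show "scl M c x \<in> L r i"
      using Y_scale[OF assms x'(1)] subspace_scale[OF S x'(1)] x'(2) unfolding L_def by (metis imageI)
    assume "y \<in> L r i"
    then obtain y' where y': "y' \<in> V (vtx n r i)" "y = Y r i y'" by (auto simp: L_def)
    show "x + y \<in> L r i"
      using Y_add[OF assms x'(1) y'(1)] subspace_add[OF S x'(1) y'(1)] x'(2) y'(2)
      unfolding L_def by (metis imageI)
  qed
qed

lemma L_Suc_subset: "L r (Suc i) \<subseteq> L r i"
  using ymap_in[OF vtx_in[OF n_pos], of _ r "Suc i"]
  by (auto simp: L_def Y_Suc prv_vtx_Suc[OF n_pos])

lemma L_antimono: "i \<le> j \<Longrightarrow> L r j \<subseteq> L r i"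
  by (rule lift_Suc_antimono_le[of "L r", OF L_Suc_subset])

lemma L_subset: "r \<in> {1..n} \<Longrightarrow> L r i \<subseteq> V r"
  using L_antimono[of 0 i r] L_0 by simp

lemma X_L:
  assumes "r \<in> {1..n}" "l \<in> L r i"
  shows "scl M fps_X l \<in> L r (Suc i)"
proof -
  obtain u where u: "u \<in> V (vtx n r i)" "l = Y r i u" using assms by (auto simp: L_def)
  have q: "vtx n r (Suc i) \<in> {1..n}" using vtx_in n_pos by blast
  have u': "u \<in> V (prv n (vtx n r (Suc i)))" using u by (simp add: prv_vtx_Suc[OF n_pos])
  have "Y r (Suc i) (xmap M (vtx n r (Suc i)) u) = scl M fps_X l"
    using ymap_xmap[OF q u'] Y_scale[OF assms(1) u(1)] u(2) by (simp add: Y_Suc)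
  then show ?thesis using xmap_in[OF q u'] unfolding L_def by (metis imageI)
qed

section \<open>Submodules determined at one vertex, and the splitting criterion\<close>

definition ix :: "nat \<Rightarrow> nat \<Rightarrow> nat" where
  "ix r = inv_into {1..n} (vtx n r)"

lemma ix_vtx: "r \<in> {1..n} \<Longrightarrow> i \<in> {1..n} \<Longrightarrow> ix r (vtx n r i) = i"
  using bij_betw_vtx[of r n] by (simp add: ix_def bij_betw_def inv_into_f_f)

lemma ix_in: "r \<in> {1..n} \<Longrightarrow> q \<in> {1..n} \<Longrightarrow> ix r q \<in> {1..n}"
  and vtx_ix: "r \<in> {1..n} \<Longrightarrow> q \<in> {1..n} \<Longrightarrow> vtx n r (ix r q) = q"
  using bij_betw_vtx[of r n] by (simp_all only: ix_def bij_betw_def inv_into_into f_inv_into_f)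

text \<open>Elements of \<open>V q\<close> are compared with \<open>S\<close> inside
  \<open>V r\<close>. Because \<open>ix\<close> takes values in \<open>{1..n}\<close>, the vertex
  \<open>r\<close> itself gets index \<open>n\<close>, and the condition there concerns
  \<open>X^k u\<close> instead of \<open>u\<close>.\<close>

definition pull :: "nat \<Rightarrow> 'a set \<Rightarrow> nat \<Rightarrow> 'a set" where
  "pull r S q = {u \<in> V q. Y r (ix r q) u \<in> S}"

text \<open>The delicate place is the arrow \<open>y\<close> that ends at \<open>r\<close>, where
  the conditions at its two ends differ by the factor \<open>X^k\<close>. Purity of \<open>S\<close>
  makes them equivalent.\<close>

lemma pull_submodule:
  assumes r: "r \<in> {1..n}" and S: "subspace S" "S \<subseteq> V r"
    and pure: "\<And>a u. u \<in> V r \<Longrightarrow> a \<noteq> 0 \<Longrightarrow> scl M a u \<in> S \<Longrightarrow> u \<in> S"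
  shows "is_submodule n M (pull r S)"
  unfolding is_submodule_def
proof (intro ballI conjI)
  fix q assume q: "q \<in> {1..n}"
  have vi: "vtx n r (ix r q) = q" and i: "ix r q \<in> {1..n}" using vtx_ix[OF r q] ix_in[OF r q] by auto
  have lin: "Y r (ix r q) (u + v) = Y r (ix r q) u + Y r (ix r q) v"
    "Y r (ix r q) (scl M a u) = scl M a (Y r (ix r q) u)" if "u \<in> V q" "v \<in> V q" for u v a
    using Y_add[OF r, of u "ix r q" v] Y_scale[OF r, of u "ix r q" a] that vi by auto
  show sub: "subspace (pull r S q)"
    using S(1) subspace_V[OF q] Y_zero[OF r]
    by (auto simp: pull_def lin intro!: subspaceI intro: subspace_0 subspace_add subspace_scale)
  show "pull r S q \<subseteq> V q" by (auto simp: pull_def)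
  \<comment> \<open>An equivalence instead of an implication: it also gives closure under
    \<open>x\<close>, because \<open>y x u\<close> is \<open>X u\<close>.\<close>
  have y_iff: "ymap M q u \<in> pull r S (prv n q) \<longleftrightarrow> u \<in> pull r S q" if u: "u \<in> V q" for u
  proof -
    obtain j where j: "ix r q = Suc j" using i by (cases "ix r q") auto
    have pj: "prv n q = vtx n r j" using prv_vtx_Suc[OF n_pos, of r j] vi j by simp
    have Yj: "Y r (ix r q) u = Y r j (ymap M q u)" using j vi by (simp add: Y_Suc)
    have yu: "ymap M q u \<in> V (vtx n r j)" using ymap_in[OF q u] pj by simp
    show ?thesis
    proof (cases "j = 0")
      case False
      then have "ix r (prv n q) = j" using ix_vtx[OF r, of j] pj i j by simp
      then show ?thesis using u yu Yj pj by (simp add: pull_def)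
    next
      case True
      then have pr: "prv n q = r" using pj vtx_0[OF r] by simp
      have ir: "ix r r = n" using ix_vtx[OF r, of n] vtx_n[OF r] n_pos by simp
      have yr: "ymap M q u \<in> V r" using yu True vtx_0[OF r] by simp
      have "scl M (fps_X ^ k) (ymap M q u) \<in> S \<longleftrightarrow> ymap M q u \<in> S"
        using pure[OF yr, of "fps_X ^ k"] subspace_scale[OF S(1)] by auto
      then show ?thesis using u yr Yj True ir Y_n[OF r yr] pr by (simp add: pull_def)
    qed
  qed
  show "ymap M q ` pull r S q \<subseteq> pull r S (prv n q)"
    using y_iff by (auto simp: pull_def)
  show "xmap M q ` pull r S (prv n q) \<subseteq> pull r S q"
  proof
    fix z assume "z \<in> xmap M q ` pull r S (prv n q)"
    then obtain u where u: "u \<in> pull r S (prv n q)" "z = xmap M q u" by auto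
    have p: "prv n q \<in> {1..n}" using prv_in q by blast
    have uV: "u \<in> V (prv n q)" using u by (simp add: pull_def)
    have "Y r (ix r (prv n q)) (scl M fps_X u) = scl M fps_X (Y r (ix r (prv n q)) u)"
      using Y_scale[OF r, of u "ix r (prv n q)"] uV vtx_ix[OF r p] by simp
    then have "scl M fps_X u \<in> pull r S (prv n q)"
      using u S(1) subspace_V[OF p] by (simp add: pull_def subspace_scale)
    then show "z \<in> pull r S q"
      using y_iff[OF xmap_in[OF q uV]] ymap_xmap[OF q uV] u by simp
  qed
qed

text \<open>The map sending \<open>l\<close> to \<open>f l\<close> times \<open>v\<close> is an
  idempotent on \<open>V r\<close>. As it preserves every \<open>L r i\<close>, pulling back its
  image \<open>A\<close> and its kernel \<open>B\<close> decomposes \<open>M\<close>.\<close>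

lemma decomposable:
  assumes r: "r \<in> {1..n}" and f: "functional (V r) f" and v: "v \<in> V r" "f v = 1"
    and inv: "\<And>i l. i \<in> {1..n} \<Longrightarrow> l \<in> L r i \<Longrightarrow> scl M (f l) v \<in> L r i" and m: "m \<noteq> 1"
  shows "\<not> indecomposable_module n M"
proof
  assume ind: "indecomposable_module n M"
  define A where "A = range (\<lambda>c. scl M c v)"
  define B where "B = {u \<in> V r. f u = 0}"
  note Vr = subspace_V[OF r]
  have A: "subspace A"
    unfolding A_def
  proof (rule subspaceI)
    show "0 \<in> range (\<lambda>c. scl M c v)" by (rule range_eqI[of _ _ 0]) simp
    fix x y c assume x: "x \<in> range (\<lambda>c. scl M c v)"
    then obtain a where "x = scl M a v" by blast
    then have "scl M c x = scl M (c * a) v" by simp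
    then show "scl M c x \<in> range (\<lambda>c. scl M c v)" by simp
    assume "y \<in> range (\<lambda>c. scl M c v)"
    then obtain a b where "x = scl M a v" "y = scl M b v" using x by blast
    then have "x + y = scl M (a + b) v" by (simp add: scale_left_distrib)
    then show "x + y \<in> range (\<lambda>c. scl M c v)" by simp
  qed
  have B: "subspace B"
    using Vr f unfolding B_def
    by (auto intro!: subspaceI intro: subspace_0 subspace_add subspace_scale
        simp: functional_zero functional_add functional_scale)
  have "is_submodule n M (pull r A)"
  proof (rule pull_submodule[OF r A])
    show "A \<subseteq> V r" using v subspace_scale[OF Vr] by (auto simp: A_def)
    fix a u assume u: "u \<in> V r" "a \<noteq> 0" "scl M a u \<in> A"
    then obtain c where c: "scl M a u = scl M c v" by (auto simp: A_def)
    then have "a * f u = c"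
      using functional_scale[OF f u(1), of a] functional_scale[OF f v(1), of c] v(2) by simp
    with c have "scl M a u = scl M (a * f u) v" by simp
    then have "scl M a (u - scl M (f u) v) = 0" by (simp add: scale_right_diff_distrib)
    then have "u - scl M (f u) v = 0"
      by (rule torsion_free[OF r subspace_diff[OF Vr u(1) subspace_scale[OF Vr v(1)]] _ u(2)])
    then have "u = scl M (f u) v" by (simp only: right_minus_eq)
    then show "u \<in> A" unfolding A_def by (rule range_eqI)
  qed
  note subA = this
  have subB: "is_submodule n M (pull r B)"
  proof (rule pull_submodule[OF r B])
    show "B \<subseteq> V r" by (auto simp: B_def)
    show "u \<in> B" if "u \<in> V r" "a \<noteq> 0" "scl M a u \<in> B" for a u
      using that functional_scale[OF f that(1)] by (simp add: B_def)
  qed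
  have split: "pull r A q \<inter> pull r B q = {0} \<and>
      V q = {u + w | u w. u \<in> pull r A q \<and> w \<in> pull r B q}" if q: "q \<in> {1..n}" for q
  proof -
    define i where "i = ix r q"
    have i: "i \<in> {1..n}" "vtx n r i = q" using ix_in[OF r q] vtx_ix[OF r q] by (auto simp: i_def)
    have sA: "subspace (pull r A q)" and sB: "subspace (pull r B q)"
      using subA subB q unfolding is_submodule_def by auto
    have "u = 0" if uAB: "u \<in> pull r A q" "u \<in> pull r B q" for u
    proof -
      obtain c where c: "Y r i u = scl M c v" and u: "f (Y r i u) = 0" "u \<in> V q"
        using uAB by (auto simp: pull_def A_def B_def i_def)
      then have "c = 0" using functional_scale[OF f v(1)] v(2) by simp
      with c u show ?thesis using Y_eq_0[OF r, of u i] i by simp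
    qed
    then have "pull r A q \<inter> pull r B q = {0}" using subspace_0[OF sA] subspace_0[OF sB] by auto
    moreover have "\<exists>a w. u = a + w \<and> a \<in> pull r A q \<and> w \<in> pull r B q" if u: "u \<in> V q" for u
    proof -
      define l where "l = Y r i u"
      have l: "l \<in> L r i" "l \<in> V r" using u i Y_in[OF r, of u i] by (auto simp: L_def l_def)
      obtain a where a: "a \<in> V q" "Y r i a = scl M (f l) v"
        using inv[OF i(1) l(1)] i by (auto simp: L_def)
      then have "a \<in> pull r A q" by (simp add: pull_def A_def flip: i_def)
      moreover have "Y r i (u - a) = l - scl M (f l) v"
        using Y_diff[OF r, of u i a] u a i by (simp add: l_def)
      then have "u - a \<in> pull r B q"
        using functional_projection[OF Vr f v l(2)] subspace_diff[OF subspace_V[OF q] u a(1)]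
        by (simp add: pull_def B_def flip: i_def)
      ultimately show ?thesis by (intro exI[of _ a] exI[of _ "u - a"]) simp
    qed
    moreover have "u + w \<in> V q" if "u \<in> pull r A q" "w \<in> pull r B q" for u w
      using that subspace_add[OF subspace_V[OF q]] by (simp add: pull_def)
    ultimately show ?thesis by blast
  qed
  have "is_zero_family n (pull r A) \<or> is_zero_family n (pull r B)"
    using ind[unfolded indecomposable_module_def, THEN conjunct2, rule_format,
        of "pull r A" "pull r B"] subA subB split by simp
  then have zero: "pull r A r = {0} \<or> pull r B r = {0}" using r by (auto simp: is_zero_family_def)
  have pr: "u \<in> pull r S r \<longleftrightarrow> u \<in> V r \<and> scl M (fps_X ^ k) u \<in> S" for S u
    using ix_vtx[OF r, of n] vtx_n[OF r] n_pos Y_n[OF r, of u] by (auto simp: pull_def)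
  have "scl M (fps_X ^ k) v \<in> A"
    by (simp add: A_def)
  then have vA: "v \<in> pull r A r" using v pr by simp
  have "v \<noteq> 0" using v functional_zero[OF f Vr] by auto
  with zero vA have B0: "pull r B r = {0}" by auto
  \<comment> \<open>With the second summand zero, \<open>v\<close> alone is a basis of
    \<open>V r\<close>, which forces rank 1.\<close>
  have "dual_basis {0 :: nat} (V r) (\<lambda>_. v) (\<lambda>_. f)"
    unfolding dual_basis_def
  proof (intro conjI ballI)
    fix u assume u: "u \<in> V r"
    have "u - scl M (f u) v \<in> B" using functional_projection[OF Vr f v u] by (simp add: B_def)
    then have "u - scl M (f u) v \<in> pull r B r"
      using subspace_scale[OF B] by (simp add: pr) (simp add: B_def)
    then have "u - scl M (f u) v = 0" using B0 by blast
    moreover have "(\<Sum>j\<in>{0 :: nat}. scl M (f u) v) = scl M (f u) v" by simp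
    ultimately show "u = (\<Sum>j\<in>{0 :: nat}. scl M (f u) v)" by (simp only: right_minus_eq)
  qed (use Vr v f in auto)
  moreover obtain b g where "dual_basis {..<m} (V r) b g" using free[OF r] by blast
  ultimately have "card {0 :: nat} = card {..<m}" by (rule dual_basis_card_eq)
  then show False using m by simp
qed

end

section \<open>Filtrations and the class vector\<close>

locale cm_filtration = cm_rep +
  fixes Is :: "nat set list" and F :: "nat \<Rightarrow> nat \<Rightarrow> 'a set"
  assumes F_submodule: "j \<le> length Is \<Longrightarrow> is_submodule n M (F j)"
    and F_0: "i \<in> {1..n} \<Longrightarrow> F 0 i = {0}"
    and F_length: "i \<in> {1..n} \<Longrightarrow> F (length Is) i = V i"
    and F_Suc: "j < length Is \<Longrightarrow> i \<in> {1..n} \<Longrightarrow> F j i \<subseteq> F (Suc j) i"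
    and F_quotient: "j < length Is \<Longrightarrow> quotient_iso n M (F (Suc j)) (F j) (rank1_module (Is ! j))"
begin

lemma F_sub:
  assumes "j \<le> length Is" "i \<in> {1..n}"
  shows "subspace (F j i)" "F j i \<subseteq> V i" "u \<in> F j (prv n i) \<Longrightarrow> xmap M i u \<in> F j i"
    "u \<in> F j i \<Longrightarrow> ymap M i u \<in> F j (prv n i)"
  using F_submodule[OF assms(1)] assms(2) unfolding is_submodule_def by blast+

definition quotient_map :: "nat \<Rightarrow> (nat \<Rightarrow> 'a \<Rightarrow> complex fps) \<Rightarrow> bool" where
  "quotient_map j f \<longleftrightarrow> hom_from_submodule n M (F (Suc j)) (rank1_module (Is ! j)) f \<and>
     (\<forall>i\<in>{1..n}. f i ` F (Suc j) i = UNIV \<and> {v \<in> F (Suc j) i. f i v = 0} = F j i)"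

lemma quotient_map_exists:
  assumes "j < length Is"
  obtains f where "quotient_map j f"
  using F_quotient[OF assms] unfolding quotient_iso_def quotient_map_def
  by (auto simp: rank1_module_def)

lemma quotient_mapD:
  assumes "quotient_map j f" "i \<in> {1..n}"
  shows "functional (F (Suc j) i) (f i)" "\<exists>v\<in>F (Suc j) i. f i v = a"
    "v \<in> F (Suc j) i \<Longrightarrow> f i v = 0 \<longleftrightarrow> v \<in> F j i"
    "v \<in> F (Suc j) (prv n i) \<Longrightarrow>
      f i (xmap M i v) = (if i \<in> Is ! j then f (prv n i) v else fps_X * f (prv n i) v)"
    "v \<in> F (Suc j) i \<Longrightarrow>
      f (prv n i) (ymap M i v) = (if i \<in> Is ! j then fps_X * f i v else f i v)"
proof -
  have h: "hom_from_submodule n M (F (Suc j)) (rank1_module (Is ! j)) f"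
    and U: "f i ` F (Suc j) i = UNIV" and K: "{v \<in> F (Suc j) i. f i v = 0} = F j i"
    using assms unfolding quotient_map_def by blast+
  have l: "linear_map_on (scl M) (scl (rank1_module (Is ! j))) (F (Suc j) i) (vsp (rank1_module (Is ! j)) i) (f i)"
    and x: "\<forall>v\<in>F (Suc j) (prv n i). f i (xmap M i v) = xmap (rank1_module (Is ! j)) i (f (prv n i) v)"
    and y: "\<forall>v\<in>F (Suc j) i. f (prv n i) (ymap M i v) = ymap (rank1_module (Is ! j)) i (f i v)"
    using h assms(2) unfolding hom_from_submodule_def by blast+
  show "functional (F (Suc j) i) (f i)"
    using l by (simp add: linear_map_on_def functional_def rank1_module_def)
  show "\<exists>v\<in>F (Suc j) i. f i v = a" using U by (metis UNIV_I image_iff)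
  show "v \<in> F (Suc j) i \<Longrightarrow> f i v = 0 \<longleftrightarrow> v \<in> F j i" using K by blast
  show "v \<in> F (Suc j) (prv n i) \<Longrightarrow>
      f i (xmap M i v) = (if i \<in> Is ! j then f (prv n i) v else fps_X * f (prv n i) v)"
    using x by (simp add: rank1_module_def)
  show "v \<in> F (Suc j) i \<Longrightarrow>
      f (prv n i) (ymap M i v) = (if i \<in> Is ! j then fps_X * f i v else f i v)"
    using y by (simp add: rank1_module_def)
qed

text \<open>At vertex 1, a preimage of 1 under each quotient map extends a basis of
  \<open>F j\<close> to one of \<open>F (Suc j)\<close>, so the number of factors is the
  rank.\<close>

lemma length_filtration: "length Is = m"
proof -
  have r: "1 \<in> {1..n}" using n_pos by auto
  have "\<exists>b f. dual_basis {..<j} (F j 1) b f" if "j \<le> length Is" for j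
    using that
  proof (induction j)
    case 0
    have "dual_basis {..<0 :: nat} (F 0 1) undefined undefined"
      unfolding dual_basis_def F_0[OF r] by auto
    then show ?case by blast
  next
    case (Suc j)
    then have j: "j < length Is" by simp
    obtain f where qm: "quotient_map j f" using quotient_map_exists[OF j] by blast
    note f = quotient_mapD[OF qm r]
    obtain z where z: "z \<in> F (Suc j) 1" "f 1 z = 1" using f(2) by blast
    have ker: "F j 1 = {u \<in> F (Suc j) 1. f 1 u = 0}" using f(3) F_Suc[OF j r] by blast
    obtain b g where "dual_basis {..<j} (F j 1) b g" using Suc by auto
    then have "dual_basis (insert j {..<j}) (F (Suc j) 1) (b(j := z)) ((\<lambda>i u. g i (u - scl M (f 1 u) z))(j := f 1))"
      unfolding ker using f(1) z F_sub(1)[OF Suc(2) r] by (intro dual_basis_extend) auto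
    then show ?case unfolding lessThan_Suc by blast
  qed
  from this[OF order.refl] obtain b f where "dual_basis {..<length Is} (V 1) b f"
    using F_length[OF r] by auto
  moreover obtain b' f' where "dual_basis {..<m} (V 1) b' f'" using free[OF r] by blast
  ultimately have "card {..<length Is} = card {..<m}" by (rule dual_basis_card_eq)
  then show ?thesis by simp
qed

text \<open>On a factor whose label omits \<open>q\<close>, the arrow \<open>y\<close> at
  \<open>q\<close> is the identity. Surjectivity lifts from the factors to the filtration, one step
  at a time.\<close>

lemma ymap_surj:
  assumes q: "q \<in> {1..n}" and "\<And>j. j < length Is \<Longrightarrow> q \<notin> Is ! j"
  shows "V (prv n q) \<subseteq> ymap M q ` V q"
proof -
  note p = prv_in[OF q]
  have "F j (prv n q) \<subseteq> ymap M q ` F j q" if "j \<le> length Is" for j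
    using that
  proof (induction j)
    case 0
    have "ymap M q 0 = 0" using ymap_scale[OF q subspace_0[OF subspace_V[OF q]], of 0] by simp
    then show ?case using F_0[OF q] F_0[OF p] by simp
  next
    case (Suc j)
    then have j: "j < length Is" by simp
    show ?case
    proof
      fix u assume u: "u \<in> F (Suc j) (prv n q)"
      obtain f where qm: "quotient_map j f" using quotient_map_exists[OF j] by blast
      note f = quotient_mapD[OF qm q] and fp = quotient_mapD[OF qm p]
      obtain w where w: "w \<in> F (Suc j) q" "f q w = f (prv n q) u" using f(2) by blast
      have yw: "ymap M q w \<in> F (Suc j) (prv n q)" using F_sub(4)[OF Suc(2) q w(1)] .
      have "u - ymap M q w \<in> F j (prv n q)"
        using functional_diff[OF fp(1) F_sub(1)[OF Suc(2) p] u yw] f(5)[OF w(1)] w(2) assms(2)[OF j]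
          fp(3)[OF subspace_diff[OF F_sub(1)[OF Suc(2) p] u yw]] by simp
      then obtain w' where w': "w' \<in> F j q" "u - ymap M q w = ymap M q w'" using Suc j by auto
      have w'': "w' \<in> F (Suc j) q" using w' F_Suc[OF j q] by auto
      then have "w \<in> V q" "w' \<in> V q" using w(1) F_sub(2)[OF Suc(2) q] by auto
      then have "u = ymap M q (w' + w)"
        using ymap_add[OF q, of w' w] w'(2) by (simp add: algebra_simps)
      moreover have "w' + w \<in> F (Suc j) q" using subspace_add[OF F_sub(1)[OF Suc(2) q] w'' w(1)] .
      ultimately show "u \<in> ymap M q ` F (Suc j) q" by blast
    qed
  qed
  from this[OF order.refl] show ?thesis using F_length q p by auto
qed

lemma xmap_add: "q \<in> {1..n} \<Longrightarrow> u \<in> V (prv n q) \<Longrightarrow> v \<in> V (prv n q) \<Longrightarrow>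
    xmap M q (u + v) = xmap M q u + xmap M q v"
  using xmap_linear[of q] unfolding linear_map_on_def by auto

text \<open>On a factor whose label contains \<open>q\<close>, the arrow \<open>x\<close> at
  \<open>q\<close> is the identity, so an image under \<open>x\<close> matches \<open>w\<close>
  modulo \<open>F j\<close>.\<close>

lemma F_lift:
  assumes q: "q \<in> {1..n}" and j: "j < length Is" "q \<in> Is ! j" and w: "w \<in> F (Suc j) q"
  obtains u where "u \<in> F (Suc j) (prv n q)" "w - xmap M q u \<in> F j q"
proof -
  note p = prv_in[OF q]
  have Sj: "Suc j \<le> length Is" using j by simp
  obtain f where qm: "quotient_map j f" using quotient_map_exists[OF j(1)] by blast
  note f = quotient_mapD[OF qm q] and fp = quotient_mapD[OF qm p]
  obtain u where u: "u \<in> F (Suc j) (prv n q)" "f (prv n q) u = f q w" using fp(2) by blast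
  have xu: "xmap M q u \<in> F (Suc j) q" using F_sub(3)[OF Sj q u(1)] .
  have "w - xmap M q u \<in> F j q"
    using functional_diff[OF f(1) F_sub(1)[OF Sj q] w xu] f(4)[OF u(1)] u(2) j(2)
      f(3)[OF subspace_diff[OF F_sub(1)[OF Sj q] w xu]] by simp
  with u(1) show ?thesis by (rule that)
qed

lemma F_xmap_surj:
  assumes q: "q \<in> {1..n}"
  shows "j \<le> length Is \<Longrightarrow> (\<And>i. i < j \<Longrightarrow> q \<in> Is ! i) \<Longrightarrow> F j q \<subseteq> xmap M q ` F j (prv n q)"
proof (induction j)
  case 0
  have p: "prv n q \<in> {1..n}" by (rule prv_in[OF q])
  have "xmap M q 0 = 0"
    using xmap_add[OF q subspace_0[OF subspace_V[OF p]] subspace_0[OF subspace_V[OF p]]] by simp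
  then show ?case using F_0[OF q] F_0[OF p] by simp
next
  case (Suc j)
  then have j: "j < length Is" by simp
  note p = prv_in[OF q]
  show ?case
  proof
    fix w assume w: "w \<in> F (Suc j) q"
    obtain u where u: "u \<in> F (Suc j) (prv n q)" "w - xmap M q u \<in> F j q"
      using F_lift[OF q j _ w] Suc(3) by auto
    then obtain u' where u': "u' \<in> F j (prv n q)" "w - xmap M q u = xmap M q u'" using Suc by auto
    have u'': "u' \<in> F (Suc j) (prv n q)" using u' F_Suc[OF j p] by auto
    have "u \<in> V (prv n q)" "u' \<in> V (prv n q)" using u(1) u'' F_sub(2)[OF Suc(2) p] by auto
    then have "xmap M q (u' + u) = w"
      using xmap_add[OF q, of u' u] u'(2) by (simp add: algebra_simps)
    then show "w \<in> xmap M q ` F (Suc j) (prv n q)"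
      using subspace_add[OF F_sub(1)[OF Suc(2) p] u'' u(1)] by blast
  qed
qed

text \<open>At most one factor obstructs surjectivity of \<open>x\<close> at \<open>q\<close>. Below
  it \<open>x\<close> is surjective, at it a lift of the generator 1 supplies \<open>z\<close>, and
  above it \<open>F_lift\<close> reduces to lower steps, so the same \<open>z\<close>
  serves.\<close>

lemma F_xmap_almost_surj:
  assumes q: "q \<in> {1..n}"
  shows "j \<le> length Is \<Longrightarrow> card {i. i < j \<and> q \<notin> Is ! i} \<le> 1 \<Longrightarrow>
    \<exists>z\<in>F j q. \<forall>w\<in>F j q. \<exists>u\<in>F j (prv n q). \<exists>a. w = xmap M q u + scl M a z"
proof (induction j)
  case 0
  have p: "prv n q \<in> {1..n}" by (rule prv_in[OF q])
  have "xmap M q 0 = 0"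
    using xmap_add[OF q subspace_0[OF subspace_V[OF p]] subspace_0[OF subspace_V[OF p]]] by simp
  then show ?case using F_0[OF q] F_0[OF p] by simp
next
  case (Suc j)
  then have j: "j < length Is" by simp
  note p = prv_in[OF q]
  have sub: "card {i. i < j \<and> q \<notin> Is ! i} \<le> card {i. i < Suc j \<and> q \<notin> Is ! i}"
    by (intro card_mono) auto
  show ?case
  proof (cases "q \<in> Is ! j")
    case True
    obtain z where z: "z \<in> F j q"
      "\<forall>w\<in>F j q. \<exists>u\<in>F j (prv n q). \<exists>a. w = xmap M q u + scl M a z"
      using Suc(1,3) j sub by auto
    show ?thesis
    proof (rule bexI[of _ z], rule ballI)
      fix w assume w: "w \<in> F (Suc j) q"
      obtain u where u: "u \<in> F (Suc j) (prv n q)" "w - xmap M q u \<in> F j q"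
        using F_lift[OF q j True w] by auto
      then obtain u' a where u': "u' \<in> F j (prv n q)" "w - xmap M q u = xmap M q u' + scl M a z"
        using z(2) by blast
      have u'': "u' \<in> F (Suc j) (prv n q)" using u' F_Suc[OF j p] by auto
      have "u \<in> V (prv n q)" "u' \<in> V (prv n q)" using u(1) u'' F_sub(2)[OF Suc(2) p] by auto
      then have "w = xmap M q (u' + u) + scl M a z"
        using xmap_add[OF q, of u' u] u'(2) by (simp add: algebra_simps)
      then show "\<exists>u\<in>F (Suc j) (prv n q). \<exists>a. w = xmap M q u + scl M a z"
        using subspace_add[OF F_sub(1)[OF Suc(2) p] u'' u(1)] by blast
    qed (use z F_Suc[OF j q] in auto)
  next
    case False
    have "{i. i < Suc j \<and> q \<notin> Is ! i} = insert j {i. i < j \<and> q \<notin> Is ! i}"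
      using False by (auto simp: less_Suc_eq)
    then have "{i. i < j \<and> q \<notin> Is ! i} = {}" using Suc(3) by simp
    then have surj: "F j q \<subseteq> xmap M q ` F j (prv n q)"
      using F_xmap_surj[OF q, of j] j by auto
    obtain f where qm: "quotient_map j f" using quotient_map_exists[OF j] by blast
    note f = quotient_mapD[OF qm q]
    obtain z where z: "z \<in> F (Suc j) q" "f q z = 1" using f(2) by blast
    show ?thesis
    proof (rule bexI[of _ z], rule ballI)
      fix w assume w: "w \<in> F (Suc j) q"
      have "w - scl M (f q w) z \<in> F j q"
        using functional_projection[OF F_sub(1)[OF Suc(2) q] f(1) z w] f(3) by blast
      then obtain u where "u \<in> F j (prv n q)" "w - scl M (f q w) z = xmap M q u"
        using surj by blast
      then have "u \<in> F (Suc j) (prv n q)" "w = xmap M q u + scl M (f q w) z"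
        using F_Suc[OF j p] by (auto simp: algebra_simps)
      then show "\<exists>u\<in>F (Suc j) (prv n q). \<exists>a. w = xmap M q u + scl M a z" by blast
    qed (rule z)
  qed
qed

end

lemma (in cm_rep) filtration_locale:
  assumes "has_filtration k n M Is"
  obtains F where "cm_filtration k n m M Is F"
proof -
  obtain F where F: "\<forall>j\<le>length Is. is_submodule n M (F j)"
    "\<forall>i\<in>{1..n}. F 0 i = {0} \<and> F (length Is) i = V i"
    "\<forall>j<length Is. Is ! j \<subseteq> {1..n} \<and> card (Is ! j) = k \<and> (\<forall>i\<in>{1..n}. F j i \<subseteq> F (Suc j) i) \<and>
       quotient_iso n M (F (Suc j)) (F j) (rank1_module (Is ! j))"
    using assms unfolding has_filtration_def by blast
  have "cm_filtration k n m M Is F"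
    by unfold_locales (use F in blast)+
  then show ?thesis by (rule that)
qed

section \<open>Ideals of the power series ring, and exponents rising by unit steps\<close>

lemma fps_ideal_eq:
  fixes D :: "complex fps set"
  assumes add: "\<And>x y. x \<in> D \<Longrightarrow> y \<in> D \<Longrightarrow> x + y \<in> D"
    and mult: "\<And>x c. x \<in> D \<Longrightarrow> c * x \<in> D" and k: "fps_X ^ k \<in> D"
  obtains a where "D = {d. fps_X ^ a dvd d}"
proof -
  define a where "a = (LEAST a. fps_X ^ a \<in> D)"
  have a: "fps_X ^ a \<in> D" unfolding a_def using k by (rule LeastI)
  have "fps_X ^ a dvd d" if "d \<in> D" for d
  proof (cases "d = 0")
    case False
    define s where "s = subdegree d"
    have d: "d = fps_shift s d * fps_X ^ s" unfolding s_def by (rule subdegree_decompose)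
    have "fps_nth (fps_shift s d) 0 \<noteq> 0" using False by (simp add: s_def)
    then obtain c where "1 = fps_shift s d * c" by (meson dvdE fps_dvd_one_iff)
    then have "fps_X ^ s = c * d" using d by (metis mult.assoc mult.commute mult.left_neutral)
    then have "fps_X ^ s \<in> D" using mult that by simp
    then have "a \<le> s" unfolding a_def by (rule Least_le)
    then have "(fps_X :: complex fps) ^ a dvd fps_X ^ s" by (rule le_imp_power_dvd)
    also have "fps_X ^ s dvd d" using d by (metis dvd_triv_right)
    finally show ?thesis .
  qed simp
  moreover have "d \<in> D" if "fps_X ^ a dvd d" for d
    using that mult[OF a] by (auto simp: dvd_def mult.commute)
  ultimately show ?thesis using that[of a] by blast
qed

lemma fps_X_power_dvd_iff: "(fps_X :: complex fps) ^ a dvd fps_X ^ b \<longleftrightarrow> a \<le> b"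
proof
  assume "(fps_X :: complex fps) ^ a dvd fps_X ^ b"
  then obtain c :: "complex fps" where c: "fps_X ^ b = fps_X ^ a * c" by (auto simp: dvd_def)
  have "fps_nth ((fps_X :: complex fps) ^ b) b = 1" by simp
  then show "a \<le> b" unfolding c by (auto simp: fps_X_power_mult_nth split: if_splits)
qed (rule le_imp_power_dvd)

text \<open>Shows that the labels built in \<open>filtration_exists\<close> have \<open>k\<close>
  elements: they are the places where an exponent rising from 0 to \<open>k\<close>
  increases.\<close>

lemma card_steps:
  fixes a :: "nat \<Rightarrow> nat"
  assumes "a 0 = 0" and "\<And>i. i < n \<Longrightarrow> a (Suc i) = a i \<or> a (Suc i) = Suc (a i)"
  shows "card {i \<in> {1..n}. a i \<noteq> a (i - 1)} = a n"
proof -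
  have "card {i \<in> {1..j}. a i \<noteq> a (i - 1)} = a j" if "j \<le> n" for j
    using that
  proof (induction j)
    case (Suc j)
    have "{i \<in> {1..Suc j}. a i \<noteq> a (i - 1)} =
      (if a (Suc j) = a j then {} else {Suc j}) \<union> {i \<in> {1..j}. a i \<noteq> a (i - 1)}"
      by (auto simp: le_Suc_eq)
    then have "card {i \<in> {1..Suc j}. a i \<noteq> a (i - 1)} =
      (if a (Suc j) = a j then 0 else 1) + card {i \<in> {1..j}. a i \<noteq> a (i - 1)}" by simp
    then show ?case using Suc assms(2)[of j] by auto
  qed (simp add: assms)
  then show ?thesis by simp
qed

section \<open>Existence of filtrations, and properties of the class vector\<close>

context cm_rep
begin

text \<open>The coordinate submodules \<open>S j\<close> of \<open>V n\<close> pull back to a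
  filtration. The values of \<open>f j\<close> on the part of \<open>L n i\<close> in
  \<open>S (Suc j)\<close> form an ideal, generated by \<open>X^(a j i)\<close>. This exponent rises
  from 0 to \<open>k\<close> in steps of at most 1, and the places where it rises form the label of
  the factor \<open>j\<close>.\<close>

lemma filtration_exists: "\<exists>Is. has_filtration k n M Is \<and> length Is = m"
proof -
  have N: "n \<in> {1..n}" using n_pos by simp
  \<comment> \<open>Base vertex \<open>n\<close> makes positions in the chain agree with vertex
    numbers.\<close>
  have vtx: "vtx n n i = i" if "i \<in> {1..n}" for i
  proof -
    have "n - 1 + i = i - 1 + n" using that by auto
    then show ?thesis using that unfolding vtx_def by (simp only: mod_add_self2) auto
  qed
  have ix: "ix n i = i" if "i \<in> {1..n}" for i using ix_vtx[OF N that] vtx[OF that] by simp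
  obtain b f where db: "dual_basis {..<m} (V n) b f" using free[OF N] by blast
  note D = dual_basisD[OF db]
  define S where "S j = {u \<in> V n. \<forall>l\<in>{..<m}. j \<le> l \<longrightarrow> f l u = 0}" for j
  define F where "F j = pull n (S j)" for j
  have S: "subspace (S j)" for j
  proof (rule subspaceI)
    show "0 \<in> S j" using D(2) functional_zero[OF D(4) D(2)] by (auto simp: S_def subspace_0)
    fix x y c assume x: "x \<in> S j"
    then show "scl M c x \<in> S j"
      using D(2) functional_scale[OF D(4)] by (auto simp: S_def subspace_scale)
    assume "y \<in> S j"
    with x show "x + y \<in> S j"
      using D(2) functional_add[OF D(4)] by (auto simp: S_def subspace_add)
  qed
  have S_pure: "u \<in> S j" if "u \<in> V n" "a \<noteq> 0" "scl M a u \<in> S j" for a u j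
    using that functional_scale[OF D(4)] by (auto simp: S_def)
  have F_sub: "is_submodule n M (F j)" for j
    unfolding F_def using S S_pure by (intro pull_submodule[OF N]) (auto simp: S_def)
  have F_iff: "u \<in> F j i \<longleftrightarrow> u \<in> V i \<and> Y n i u \<in> S j" if "i \<in> {1..n}" for u j i
    using ix[OF that] by (simp add: F_def pull_def)
  define D' where "D' j i = f j ` (L n i \<inter> S (Suc j))" for j i
  have D'_sub: "D' j (Suc i) \<subseteq> D' j i" for i j unfolding D'_def using L_Suc_subset by blast
  have "\<exists>a. D' j i = {d. fps_X ^ a dvd d}" if j: "j < m" and i: "i \<le> n" for j i
  proof -
    have bj: "b j \<in> S (Suc j)" using D(3,5) j by (auto simp: S_def)
    have LS: "L n i \<inter> S (Suc j) \<subseteq> V n" by (auto simp: S_def)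
    have LS': "subspace (L n i \<inter> S (Suc j))" using subspace_L[OF N] S by (rule subspace_inter)
    have fj: "functional (V n) (f j)" using D(4) j by simp
    have "scl M (fps_X ^ k) (b j) \<in> L n n" using L_n[OF N] D(3) j by auto
    then have "scl M (fps_X ^ k) (b j) \<in> L n i \<inter> S (Suc j)"
      using L_antimono[OF i] subspace_scale[OF S bj] by blast
    moreover have "f j (scl M (fps_X ^ k) (b j)) = fps_X ^ k"
      using functional_scale[OF fj D(3)[of j]] D(5)[of j j] j by simp
    ultimately have power: "fps_X ^ k \<in> D' j i" unfolding D'_def by (metis imageI)
    have add: "x + y \<in> D' j i" if "x \<in> D' j i" "y \<in> D' j i" for x y
    proof -
      from that obtain u v where u: "u \<in> L n i \<inter> S (Suc j)" "x = f j u"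
        and v: "v \<in> L n i \<inter> S (Suc j)" "y = f j v" by (auto simp: D'_def)
      then show ?thesis unfolding D'_def
        using functional_add[OF fj subsetD[OF LS u(1)] subsetD[OF LS v(1)]] u(2) v(2) subspace_add[OF LS' u(1) v(1)] by (intro image_eqI[of _ _ "u + v"]) auto
    qed
    have mult: "c * x \<in> D' j i" if "x \<in> D' j i" for x c
    proof -
      from that obtain u where u: "u \<in> L n i \<inter> S (Suc j)" "x = f j u" by (auto simp: D'_def)
      then show ?thesis unfolding D'_def
        using functional_scale[OF fj subsetD[OF LS u(1)]] u(2) subspace_scale[OF LS' u(1), of c] by (intro image_eqI[of _ _ "scl M c u"]) auto
    qed
    show ?thesis by (rule fps_ideal_eq[OF add mult power]) auto
  qed
  note ideal = this
  define a where "a j i = (SOME a. D' j i = {d. fps_X ^ a dvd d})" for j i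
  have a: "D' j i = {d. fps_X ^ a j i dvd d}" if "j < m" "i \<le> n" for j i
    unfolding a_def by (rule someI_ex[OF ideal[OF that]])
  have a_0: "a j 0 = 0" if j: "j < m" for j
  proof -
    have "b j \<in> L n 0 \<inter> S (Suc j)" "f j (b j) = 1" using D(3,5) j L_0[OF N] by (auto simp: S_def)
    then have "1 \<in> D' j 0" unfolding D'_def by (metis imageI)
    then have "(fps_X :: complex fps) ^ a j 0 dvd fps_X ^ 0" using a[OF j] by simp
    then show ?thesis unfolding fps_X_power_dvd_iff by simp
  qed
  have a_n: "a j n = k" if j: "j < m" for j
  proof -
    have fj: "functional (V n) (f j)" using D(4) j by simp
    have bj: "b j \<in> S (Suc j)" using D(3,5) j by (auto simp: S_def)
    have "scl M (fps_X ^ k) (b j) \<in> L n n \<inter> S (Suc j)"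
      using L_n[OF N] D(3) j subspace_scale[OF S bj] by auto
    moreover have "f j (scl M (fps_X ^ k) (b j)) = fps_X ^ k"
      using functional_scale[OF fj D(3)[of j]] D(5)[of j j] j by simp
    ultimately have "fps_X ^ k \<in> D' j n" unfolding D'_def by (metis imageI)
    then have 1: "a j n \<le> k" using a[OF j] by (simp add: fps_X_power_dvd_iff)
    have "fps_X ^ a j n \<in> D' j n" using a[OF j] by simp
    then obtain u where u: "u \<in> V n" "fps_X ^ a j n = f j (scl M (fps_X ^ k) u)"
      by (auto simp: D'_def L_n[OF N])
    then have "(fps_X :: complex fps) ^ k dvd fps_X ^ a j n" using functional_scale[OF fj u(1)] by simp
    then show ?thesis using 1 by (simp add: fps_X_power_dvd_iff)
  qed
  have a_Suc: "a j (Suc i) = a j i \<or> a j (Suc i) = Suc (a j i)" if j: "j < m" and i: "i < n" for j i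
  proof -
    have fj: "functional (V n) (f j)" using D(4) j by simp
    have "fps_X ^ a j (Suc i) \<in> D' j (Suc i)" using a[OF j, of "Suc i"] i by simp
    then have "fps_X ^ a j (Suc i) \<in> D' j i" using D'_sub by blast
    then have le: "a j i \<le> a j (Suc i)" using a[OF j, of i] i by (simp add: fps_X_power_dvd_iff)
    have "fps_X ^ a j i \<in> D' j i" using a[OF j, of i] i by simp
    then obtain u where u: "u \<in> L n i" "u \<in> S (Suc j)" "fps_X ^ a j i = f j u" by (auto simp: D'_def)
    then have "f j (scl M fps_X u) = fps_X ^ Suc (a j i)"
      using functional_scale[OF fj, of u] L_subset[OF N, of i] by auto
    moreover have "scl M fps_X u \<in> L n (Suc i) \<inter> S (Suc j)"
      using X_L[OF N u(1)] subspace_scale[OF S u(2)] by simp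
    ultimately have "fps_X ^ Suc (a j i) \<in> D' j (Suc i)" unfolding D'_def by (metis imageI)
    then have "a j (Suc i) \<le> Suc (a j i)" using a[OF j, of "Suc i"] i by (simp only: fps_X_power_dvd_iff mem_Collect_eq)
    with le show ?thesis by auto
  qed
  define I where "I j = {i \<in> {1..n}. a j i \<noteq> a j (i - 1)}" for j
  \<comment> \<open>The factor at vertex \<open>i\<close> is the ideal generated by
    \<open>X^(a j i)\<close>; division by this power identifies it with the whole ring.\<close>
  define g where "g j i u = fps_shift (a j i) (f j (Y n i u))" for j i u
  have g_eq: "fps_X ^ a j i * g j i u = f j (Y n i u)" if "j < m" "i \<in> {1..n}" "u \<in> F (Suc j) i" for j i u
  proof -
    have "Y n i u \<in> L n i" "Y n i u \<in> S (Suc j)"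
      using F_iff[OF that(2)] that(3) vtx[OF that(2)] by (auto simp: L_def)
    then have "f j (Y n i u) \<in> D' j i" by (auto simp: D'_def)
    then have "fps_X ^ a j i dvd f j (Y n i u)" using a[of j i] that by simp
    then show ?thesis unfolding g_def by (auto simp: dvd_def fps_shift_times_fps_X_power mult.commute[of "fps_X ^ a j i"])
  qed
  have a_I: "a j i = (if i \<in> I j then Suc (a j (i - 1)) else a j (i - 1))" if "j < m" "i \<in> {1..n}" for j i
    using a_Suc[of j "i - 1"] that by (auto simp: I_def)
  have F_V: "F j i \<subseteq> V i" for j i by (auto simp: F_def pull_def)
  have g_y: "g j (prv n i) (ymap M i u) = (if i \<in> I j then fps_X * g j i u else g j i u)"
    if j: "j < m" and i: "i \<in> {1..n}" and u: "u \<in> F (Suc j) i" for j i u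
  proof -
    have p: "prv n i \<in> {1..n}" by (rule prv_in[OF i])
    have yu: "ymap M i u \<in> F (Suc j) (prv n i)" using F_sub i u unfolding is_submodule_def by blast
    have fj: "functional (V n) (f j)" using D(4) j by simp
    have Yi: "Y n i u = Y n (i - 1) (ymap M i u)"
      using Y_Suc[of n "i - 1" u] vtx[OF i] i by (cases i) auto
    have eq: "fps_X ^ a j (i - 1) * g j (prv n i) (ymap M i u) = f j (Y n i u)"
    proof (cases "i = 1")
      case False
      then have "prv n i = i - 1" by (simp add: prv_def)
      then show ?thesis using g_eq[OF j p yu] Yi by simp
    next
      \<comment> \<open>The arrow \<open>y\<close> at vertex 1 ends at \<open>n\<close>, which has
        position \<open>n\<close> and not 0 in the chain. The factor \<open>X^k\<close> from
        \<open>a j n = k\<close> cancels against the full turn in \<open>Y_n\<close>.\<close>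
      case True
      then have pn: "prv n i = n" by (simp add: prv_def)
      have yV: "ymap M i u \<in> V n" using yu F_V pn by auto
      have "fps_X ^ k * g j n (ymap M i u) = f j (Y n n (ymap M i u))"
        using g_eq[OF j p yu] a_n[OF j] pn by simp
      also have "\<dots> = fps_X ^ k * f j (ymap M i u)"
        using Y_n[OF N yV] functional_scale[OF fj yV] by simp
      finally have "g j n (ymap M i u) = f j (ymap M i u)" by simp
      then show ?thesis using True a_0[OF j] Yi pn by simp
    qed
    also have "\<dots> = fps_X ^ a j i * g j i u" using g_eq[OF j i u] by simp
    finally show ?thesis using a_I[OF j i] by (auto simp: mult.assoc mult.left_commute)
  qed
  have "quotient_iso n M (F (Suc j)) (F j) (rank1_module (I j))" if j: "j < m" for j
    unfolding quotient_iso_def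
  proof (intro exI[of _ "g j"] conjI ballI)
    have fj: "functional (V n) (f j)" using D(4) j by simp
    show "hom_from_submodule n M (F (Suc j)) (rank1_module (I j)) (g j)"
      unfolding hom_from_submodule_def
    proof (intro ballI conjI)
      fix i assume i: "i \<in> {1..n}"
      have "f j (Y n i (u + v)) = f j (Y n i u) + f j (Y n i v)" "f j (Y n i (scl M c u)) = c * f j (Y n i u)"
        if "u \<in> F (Suc j) i" "v \<in> F (Suc j) i" for u v c
      proof -
        have uv: "u \<in> V (vtx n n i)" "v \<in> V (vtx n n i)" using that F_V vtx[OF i] by auto
        show "f j (Y n i (u + v)) = f j (Y n i u) + f j (Y n i v)"
          using Y_add[OF N uv] functional_add[OF fj Y_in[OF N uv(1)] Y_in[OF N uv(2)]] by simp
        show "f j (Y n i (scl M c u)) = c * f j (Y n i u)"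
          using Y_scale[OF N uv(1)] functional_scale[OF fj Y_in[OF N uv(1)]] by simp
      qed
      note lin = this
      have sub: "subspace (F (Suc j) i)" using F_sub i unfolding is_submodule_def by blast
      have "g j i (scl M c v) = c * g j i v" if v: "v \<in> F (Suc j) i" for c v
      proof -
        have "fps_X ^ a j i * g j i (scl M c v) = fps_X ^ a j i * (c * g j i v)"
          using lin(2)[OF v v] g_eq[OF j i v] g_eq[OF j i subspace_scale[OF sub v]]
          by (simp add: mult.left_commute)
        then show ?thesis by simp
      qed
      then show "linear_map_on (scl M) (scl (rank1_module (I j))) (F (Suc j) i) (vsp (rank1_module (I j)) i) (g j i)"
        using lin(1) by (auto simp: linear_map_on_def rank1_module_def g_def fps_shift_add)
    next
      fix i v assume i: "i \<in> {1..n}" and v: "v \<in> F (Suc j) (prv n i)"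
      have xv: "xmap M i v \<in> F (Suc j) i" using F_sub i v unfolding is_submodule_def by blast
      have p: "prv n i \<in> {1..n}" by (rule prv_in[OF i])
      have vV: "v \<in> V (prv n i)" using v F_V by auto
      have "Y n (prv n i) (scl M fps_X v) = scl M fps_X (Y n (prv n i) v)"
        using Y_scale[OF N, of v "prv n i"] vV vtx[OF p] by simp
      then have "f j (Y n (prv n i) (scl M fps_X v)) = fps_X * f j (Y n (prv n i) v)"
        using functional_scale[OF fj Y_in[OF N, of v "prv n i"]] vV vtx[OF p] by simp
      moreover have "scl M fps_X v \<in> F (Suc j) (prv n i)"
        using F_sub p v unfolding is_submodule_def by (blast intro: subspace_scale)
      ultimately have "fps_X ^ a j (prv n i) * g j (prv n i) (scl M fps_X v)
          = fps_X ^ a j (prv n i) * (fps_X * g j (prv n i) v)"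
        using g_eq[OF j p v] g_eq[OF j p, of "scl M fps_X v"] by (simp add: mult.left_commute)
      then have gX: "g j (prv n i) (scl M fps_X v) = fps_X * g j (prv n i) v" by simp
      \<comment> \<open>The rule for \<open>x\<close> follows from the rule for \<open>y\<close>
        applied to \<open>x v\<close>, as \<open>y x\<close> is \<open>X\<close>.\<close>
      show "g j i (xmap M i v) = xmap (rank1_module (I j)) i (g j (prv n i) v)"
        using g_y[OF j i xv] ymap_xmap[OF i vV] gX by (simp add: rank1_module_def split: if_splits)
    next
      fix i v assume i: "i \<in> {1..n}" and v: "v \<in> F (Suc j) i"
      show "g j (prv n i) (ymap M i v) = ymap (rank1_module (I j)) i (g j i v)"
        using g_y[OF j i v] by (simp add: rank1_module_def)
    qed
    fix i assume i: "i \<in> {1..n}"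
    have "d \<in> g j i ` F (Suc j) i" for d
    proof -
      have "fps_X ^ a j i * d \<in> D' j i" using a[OF j, of i] i by simp
      then obtain u where u: "u \<in> V i" "Y n i u \<in> S (Suc j)" "fps_X ^ a j i * d = f j (Y n i u)"
        using vtx[OF i] by (auto simp: D'_def L_def)
      then have uF: "u \<in> F (Suc j) i" using F_iff[OF i] by simp
      have "fps_X ^ a j i * g j i u = fps_X ^ a j i * d" using g_eq[OF j i uF] u by simp
      then have "g j i u = d" by simp
      then show ?thesis using uF by blast
    qed
    then show "g j i ` F (Suc j) i = vsp (rank1_module (I j)) i" by (auto simp: rank1_module_def)
    show "{v \<in> F (Suc j) i. g j i v = 0} = F j i"
    proof -
      have "v \<in> F (Suc j) i \<and> g j i v = 0 \<longleftrightarrow> v \<in> F (Suc j) i \<and> f j (Y n i v) = 0" for v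
        using g_eq[OF j i, of v] by auto
      also have "\<dots> v \<longleftrightarrow> v \<in> F j i" for v
      proof -
        have "j \<le> l \<longleftrightarrow> l = j \<or> Suc j \<le> l" for l by auto
        then show ?thesis using j by (auto simp: F_iff[OF i] S_def)
      qed
      finally show ?thesis by blast
    qed
  qed
  note quot = this
  have "has_filtration k n M (map I [0..<m])"
    unfolding has_filtration_def
  proof (intro exI[of _ F] conjI allI impI ballI)
    show "is_submodule n M (F j)" for j by (rule F_sub)
    fix i assume i: "i \<in> {1..n}"
    show "F 0 i = {0}"
    proof -
      have "u = 0" if "u \<in> F 0 i" for u
      proof -
        have u: "u \<in> V i" "Y n i u \<in> S 0" using F_iff[OF i] that by auto
        have "Y n i u \<in> V n" "\<And>l. l < m \<Longrightarrow> f l (Y n i u) = 0" using u(2) by (auto simp: S_def)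
        then have "Y n i u = 0" using D(6)[of "Y n i u"] by simp
        then show ?thesis using Y_eq_0[OF N, of u i] u vtx[OF i] by simp
      qed
      moreover have "0 \<in> F 0 i" using F_sub i unfolding is_submodule_def by (blast intro: subspace_0)
      ultimately show ?thesis by blast
    qed
    show "F (length (map I [0..<m])) i = V i"
      using F_iff[OF i, of _ m] Y_in[OF N, of _ i] vtx[OF i] by (auto simp: S_def)
  next
    fix j i assume j: "j < length (map I [0..<m])" and i: "i \<in> {1..n}"
    show "F j i \<subseteq> F (Suc j) i" using F_iff[OF i] by (auto simp: S_def)
  next
    fix j assume j: "j < length (map I [0..<m])"
    then show "map I [0..<m] ! j \<subseteq> {1..n}" by (auto simp: I_def)
    show "card (map I [0..<m] ! j) = k"
      using j card_steps[of "a j" n] a_0 a_Suc a_n by (simp add: I_def)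
    show "quotient_iso n M (F (Suc j)) (F j) (rank1_module (map I [0..<m] ! j))"
      using j quot by simp
  qed
  then show ?thesis by (intro exI[of _ "map I [0..<m]"]) simp
qed

text \<open>The filtration behind \<open>class_vector\<close> is an arbitrary choice, so only facts
  valid for every filtration are used. Entries equal to 0, equal to \<open>m\<close>, or at least
  \<open>m - 1\<close> restrict the cokernels of the arrows at that vertex; this links the vector to
  the lattices.\<close>

lemma class_vector_properties:
  defines "x \<equiv> class_vector k n M"
  shows "i \<notin> {1..n} \<Longrightarrow> x i = 0" and "0 \<le> x i" and "x i \<le> int m"
    and "(\<Sum>i\<in>{1..n}. x i) = int k * int m"
    and "q \<in> {1..n} \<Longrightarrow> x q = 0 \<Longrightarrow> V (prv n q) \<subseteq> ymap M q ` V q"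
    and "q \<in> {1..n} \<Longrightarrow> x q = int m \<Longrightarrow> V q \<subseteq> xmap M q ` V (prv n q)"
    and "q \<in> {1..n} \<Longrightarrow> x q \<ge> int m - 1 \<Longrightarrow>
      \<exists>z\<in>V q. \<forall>w\<in>V q. \<exists>u\<in>V (prv n q). \<exists>a. w = xmap M q u + scl M a z"
proof -
  define Is where "Is = (SOME Is. has_filtration k n M Is)"
  have filt: "has_filtration k n M Is"
    unfolding Is_def using filtration_exists by (blast intro: someI2)
  obtain F where "cm_filtration k n m M Is F" using filtration_locale[OF filt] by blast
  then interpret F: cm_filtration k n m M Is F .
  have len: "length Is = m" by (rule F.length_filtration)
  have x: "x i = int (card {j. j < m \<and> i \<in> Is ! j})" for i
    unfolding x_def class_vector_def Is_def[symmetric] len Let_def ..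
  have Is: "Is ! j \<subseteq> {1..n}" "card (Is ! j) = k" if "j < m" for j
    using filt that len unfolding has_filtration_def by auto
  show "x i = 0" if "i \<notin> {1..n}"
  proof -
    have "{j. j < m \<and> i \<in> Is ! j} = {}" using Is(1) that by blast
    then show ?thesis unfolding x by simp
  qed
  show "0 \<le> x i" unfolding x by simp
  have "card {j. j < m \<and> i \<in> Is ! j} \<le> card {..<m}" by (intro card_mono) auto
  then show "x i \<le> int m" unfolding x by simp
  have "(\<Sum>i\<in>{1..n}. x i) = (\<Sum>i\<in>{1..n}. \<Sum>j<m. if i \<in> Is ! j then 1 else 0)"
  proof (intro sum.cong refl)
    fix i
    have "{j. j < m \<and> i \<in> Is ! j} = {..<m} \<inter> {j. i \<in> Is ! j}" by auto
    then show "x i = (\<Sum>j<m. if i \<in> Is ! j then 1 else 0)" unfolding x by (simp add: sum.If_cases)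
  qed
  also have "\<dots> = (\<Sum>j<m. \<Sum>i\<in>{1..n}. if i \<in> Is ! j then 1 else 0)" by (rule sum.swap)
  also have "\<dots> = (\<Sum>j<m. int k)"
  proof (intro sum.cong refl)
    fix j assume "j \<in> {..<m}"
    then have "{1..n} \<inter> Is ! j = Is ! j" "card (Is ! j) = k" using Is[of j] by auto
    then show "(\<Sum>i\<in>{1..n}. if i \<in> Is ! j then 1 else 0) = int k" by (simp add: sum.If_cases)
  qed
  finally show "(\<Sum>i\<in>{1..n}. x i) = int k * int m" by simp
  have compl: "card {j. j < m \<and> q \<in> Is ! j} + card {j. j < m \<and> q \<notin> Is ! j} = m" for q
  proof -
    have "{j. j < m \<and> q \<in> Is ! j} \<union> {j. j < m \<and> q \<notin> Is ! j} = {..<m}" by auto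
    then show ?thesis by (subst card_Un_disjoint[symmetric]) auto
  qed
  {
    assume q: "q \<in> {1..n}"
    show "V (prv n q) \<subseteq> ymap M q ` V q" if "x q = 0"
      using F.ymap_surj[OF q] that len unfolding x by auto
    show "V q \<subseteq> xmap M q ` V (prv n q)" if "x q = int m"
    proof -
      have "card {j. j < m \<and> q \<notin> Is ! j} = 0" using that compl[of q] unfolding x by linarith
      then have "q \<in> Is ! i" if "i < m" for i using that by auto
      then show ?thesis using F.F_xmap_surj[OF q, of m] len F.F_length[OF q] F.F_length[OF prv_in[OF q]] by auto
    qed
    show "\<exists>z\<in>V q. \<forall>w\<in>V q. \<exists>u\<in>V (prv n q). \<exists>a. w = xmap M q u + scl M a z" if "x q \<ge> int m - 1"
    proof -
      have "card {j. j < m \<and> q \<notin> Is ! j} \<le> 1" using that compl[of q] unfolding x by linarith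
      then show ?thesis using F.F_xmap_almost_surj[OF q, of m] len F.F_length[OF q] F.F_length[OF prv_in[OF q]] by auto
    qed
  }
qed

end

section \<open>Splitting modules of rank 2 and 3\<close>

lemma two_steps:
  fixes g :: "nat \<Rightarrow> nat"
  assumes g0: "g 0 = 0" and gN: "g N = 2"
    and step: "\<And>s. s < N \<Longrightarrow> g (Suc s) = g s \<or> g (Suc s) = Suc (g s)"
  obtains t1 t2 where "1 \<le> t1" "t1 < t2" "t2 \<le> N" "g t1 \<noteq> g (t1 - 1)" "g t2 \<noteq> g (t2 - 1)"
    "\<And>s. s \<le> N \<Longrightarrow> g s = (if s < t1 then 0 else if s < t2 then 1 else 2)"
proof -
  have mono: "g s \<le> g s'" if "s \<le> s'" "s' \<le> N" for s s'
    using that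
  proof (induction s' rule: dec_induct)
    case (step s')
    then have "g s \<le> g s'" "s' < N" by simp_all
    then show ?case using assms(3)[of s'] by linarith
  qed simp
  have first: "\<exists>t. c \<le> g t \<and> t \<le> N \<and> (\<forall>s<t. g s < c)" if "c \<le> g N" for c
    using LeastI[where P = "\<lambda>s. c \<le> g s", OF that] Least_le[where P = "\<lambda>s. c \<le> g s", OF that]
      not_less_Least[where P = "\<lambda>s. c \<le> g s"] not_le by blast
  obtain t1 where t1: "1 \<le> g t1" "t1 \<le> N" "\<And>s. s < t1 \<Longrightarrow> g s < 1"
    using first[of 1] gN by auto
  obtain t2 where t2: "2 \<le> g t2" "t2 \<le> N" "\<And>s. s < t2 \<Longrightarrow> g s < 2"
    using first[of 2] gN by auto
  have t1_0: "1 \<le> t1" using t1(1) g0 by (cases t1) auto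
  have g1: "g (t1 - 1) = 0" "g t1 = 1"
  proof -
    show "g (t1 - 1) = 0" using t1(3)[of "t1 - 1"] t1_0 by simp
    then show "g t1 = 1" using t1(1) step[of "t1 - 1"] t1_0 t1(2) by (cases t1) auto
  qed
  have "t1 \<le> t2" using t1(3)[of t2] t2(1) by (cases "t2 < t1") auto
  then have less: "t1 < t2" using g1 t2(1) by (cases "t1 = t2") auto
  have g2: "g (t2 - 1) < 2" using t2(3)[of "t2 - 1"] less by auto
  show ?thesis
  proof (rule that[OF t1_0 less t2(2)])
    show "g s = (if s < t1 then 0 else if s < t2 then 1 else 2)" if "s \<le> N" for s
    proof -
      consider "s < t1" | "t1 \<le> s" "s < t2" | "t2 \<le> s" by linarith
      then show ?thesis
      proof cases
        case 1
        then show ?thesis using t1(3)[of s] by simp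
      next
        case 2
        then show ?thesis using t2(3)[of s] mono[of t1 s] that t1(1) by simp
      next
        case 3
        then show ?thesis using mono[of t2 s] mono[of s N] that t2(1) gN less by simp
      qed
    qed
  qed (use g1 g2 t2(1) in auto)
qed

text \<open>
  Pairwise incomparable step functions have strictly nested pairs of jumps, so three of them
  jump at six places.
\<close>

lemma comparable_step_functions:
  fixes g :: "nat \<Rightarrow> nat \<Rightarrow> nat"
  assumes g0: "\<And>j. j < 3 \<Longrightarrow> g j 0 = 0" and gN: "\<And>j. j < 3 \<Longrightarrow> g j N = 2"
    and step: "\<And>j s. j < 3 \<Longrightarrow> s < N \<Longrightarrow> g j (Suc s) = g j s \<or> g j (Suc s) = Suc (g j s)"
    and card: "card {s \<in> {1..N}. \<exists>j<3. g j s \<noteq> g j (s - 1)} \<le> 5"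
  obtains i j where "i < 3" "j < 3" "i \<noteq> j" "\<And>s. s \<le> N \<Longrightarrow> g j s \<le> g i s"
proof -
  define P where "P j s t \<longleftrightarrow> 1 \<le> s \<and> s < t \<and> t \<le> N \<and> g j s \<noteq> g j (s - 1) \<and> g j t \<noteq> g j (t - 1) \<and>
    (\<forall>u\<le>N. g j u = (if u < s then 0 else if u < t then 1 else 2))" for j s t
  have "\<exists>s t. P j s t" if j: "j < 3" for j
  proof (rule two_steps[of "g j" N, OF g0[OF j] gN[OF j] step[OF j]])
    fix t1 t2
    assume "1 \<le> t1" "t1 < t2" "t2 \<le> N" "g j t1 \<noteq> g j (t1 - 1)" "g j t2 \<noteq> g j (t2 - 1)"
      "\<And>s. s \<le> N \<Longrightarrow> g j s = (if s < t1 then 0 else if s < t2 then 1 else 2)"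
    then have "P j t1 t2" unfolding P_def by blast
    then show "\<exists>s t. P j s t" by blast
  qed
  then obtain s t where P: "\<And>j. j < 3 \<Longrightarrow> P j (s j) (t j)" by metis
  have st: "1 \<le> s j" "s j < t j" "t j \<le> N" "g j (s j) \<noteq> g j (s j - 1)" "g j (t j) \<noteq> g j (t j - 1)"
    "\<And>u. u \<le> N \<Longrightarrow> g j u = (if u < s j then 0 else if u < t j then 1 else 2)" if "j < 3" for j
    using P[OF that] unfolding P_def by blast+
  have "\<exists>i<3. \<exists>j<3. i \<noteq> j \<and> s i \<le> s j \<and> t i \<le> t j"
  proof (rule ccontr)
    assume neg: "\<not> ?thesis"
    have ne: "s i \<noteq> s j \<and> t i \<noteq> t j \<and> s i \<noteq> t j" if "i < 3" "j < 3" "i \<noteq> j" for i j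
    proof -
      have "\<not> (s i \<le> s j \<and> t i \<le> t j)" "\<not> (s j \<le> s i \<and> t j \<le> t i)" using neg that by metis+
      then show ?thesis using st(2)[OF that(1)] st(2)[OF that(2)] by linarith
    qed
    have "s 0 \<noteq> t 0" "s 1 \<noteq> t 1" "s 2 \<noteq> t 2" using st(2)[of 0] st(2)[of 1] st(2)[of 2] by simp_all
    then have "distinct [s 0, t 0, s 1, t 1, s 2, t 2]"
      using ne[of 0 1] ne[of 1 0] ne[of 0 2] ne[of 2 0] ne[of 1 2] ne[of 2 1] by auto
    then have "card (set [s 0, t 0, s 1, t 1, s 2, t 2]) = 6" by (subst distinct_card) auto
    moreover have "{s j, t j} \<subseteq> {s \<in> {1..N}. \<exists>j<3. g j s \<noteq> g j (s - 1)}" if "j < 3" for j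
      using st(1-5)[OF that] that by auto
    from this[of 0] this[of 1] this[of 2]
    have "card (set [s 0, t 0, s 1, t 1, s 2, t 2]) \<le> card {s \<in> {1..N}. \<exists>j<3. g j s \<noteq> g j (s - 1)}"
      by (intro card_mono) auto
    ultimately show False using card by simp
  qed
  then obtain i j where ij: "i < 3" "j < 3" "i \<noteq> j" "s i \<le> s j" "t i \<le> t j" by blast
  show ?thesis
  proof (rule that[OF ij(1-3)])
    show "g j u \<le> g i u" if "u \<le> N" for u
      unfolding st(6)[OF ij(1) that] st(6)[OF ij(2) that] using ij(4,5) by auto
  qed
qed

text \<open>The cycle is cut open between \<open>p\<close> and \<open>Suc p\<close>, where no
  exponent changes. Normalising by the values at \<open>p\<close> reduces the claim to
  \<open>comparable_step_functions\<close> with \<open>n - 1\<close> steps. The conclusion says that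
  the rank 1 chain \<open>i\<close> maps to the chain \<open>j\<close> by a homomorphism that is an
  isomorphism at \<open>p\<close>.\<close>

lemma comparable_cyclic_step_functions:
  fixes a :: "nat \<Rightarrow> nat \<Rightarrow> nat"
  assumes p: "1 \<le> p" "p < n"
    and a1: "\<And>j. j < 3 \<Longrightarrow> a j 1 = 0" and an: "\<And>j. j < 3 \<Longrightarrow> a j n = 2"
    and step: "\<And>j i. j < 3 \<Longrightarrow> 1 \<le> i \<Longrightarrow> i < n \<Longrightarrow> a j (Suc i) = a j i \<or> a j (Suc i) = Suc (a j i)"
    and ap: "\<And>j. j < 3 \<Longrightarrow> a j (Suc p) = a j p"
    and card: "card {i \<in> {2..n}. \<exists>j<3. a j i \<noteq> a j (i - 1)} \<le> 5"
  obtains i j where "i < 3" "j < 3" "i \<noteq> j"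
    "\<And>q. 1 \<le> q \<Longrightarrow> q \<le> n \<Longrightarrow> a j q + a i p \<le> a i q + a j p"
proof -
  have mono: "a j i \<le> a j i'" if "j < 3" "1 \<le> i" "i \<le> i'" "i' \<le> n" for j i i'
    using that(3,4)
  proof (induction i' rule: dec_induct)
    case (step i')
    then show ?case using assms(5)[OF that(1), of i'] that(2) by auto
  qed simp
  define \<rho> where "\<rho> s = (if p + 1 + s \<le> n then p + 1 + s else p + 1 + s - n)" for s
  \<comment> \<open>From \<open>n\<close> to 1 the exponents drop from 2 to 0; adding 2 from there
    on turns this drop into a step without a jump.\<close>
  define g where "g j s = (if p + 1 + s \<le> n then a j (\<rho> s) else a j (\<rho> s) + 2) - a j p" for j s
  have le: "a j p \<le> a j (Suc p)" "a j p \<le> 2" if "j < 3" for j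
    using ap[OF that] mono[OF that p(1), of n] an[OF that] p by auto
  \<comment> \<open>By this bound the subtraction in \<open>g\<close> is exact.\<close>
  have ge: "a j p \<le> (if p + 1 + s \<le> n then a j (\<rho> s) else a j (\<rho> s) + 2)" if "j < 3" for j s
    using le[OF that] mono[OF that p(1), of "p + 1 + s"] by (auto simp: \<rho>_def)
  have g_step: "(g j (Suc s) = g j s \<or> g j (Suc s) = Suc (g j s)) \<and>
      (g j (Suc s) \<noteq> g j s \<longrightarrow> \<rho> (Suc s) \<in> {2..n} \<and> a j (\<rho> (Suc s)) \<noteq> a j (\<rho> (Suc s) - 1))"
    if j: "j < 3" and s: "s < n - 1" for j s
  proof -
    consider "p + 1 + Suc s \<le> n" | "p + 1 + s = n" | "n < p + 1 + s" by linarith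
    then show ?thesis
    proof cases
      case 1
      then show ?thesis using step[OF j, of "p + 1 + s"] ge[OF j, of s] ge[OF j, of "Suc s"]
        by (auto simp: g_def \<rho>_def)
    next
      case 2
      then show ?thesis using an[OF j] a1[OF j] by (auto simp: g_def \<rho>_def)
    next
      case 3
      then have q: "1 \<le> p + 1 + s - n" "p + 1 + s - n < n" using s p by auto
      show ?thesis using step[OF j q] ge[OF j, of s] ge[OF j, of "Suc s"] 3 q
        by (auto simp: g_def \<rho>_def Suc_diff_le)
    qed
  qed
  have inj: "inj_on \<rho> {..n - 1}" using p by (auto simp: inj_on_def \<rho>_def split: if_splits)
  have sub: "\<rho> ` {s \<in> {1..n - 1}. \<exists>j<3. g j s \<noteq> g j (s - 1)} \<subseteq> {i \<in> {2..n}. \<exists>j<3. a j i \<noteq> a j (i - 1)}"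
  proof
    fix i assume "i \<in> \<rho> ` {s \<in> {1..n - 1}. \<exists>j<3. g j s \<noteq> g j (s - 1)}"
    then obtain s j where s: "i = \<rho> s" "1 \<le> s" "s \<le> n - 1" "j < 3" "g j s \<noteq> g j (s - 1)" by auto
    then obtain s' where "s = Suc s'" by (cases s) auto
    then show "i \<in> {i \<in> {2..n}. \<exists>j<3. a j i \<noteq> a j (i - 1)}"
      using g_step[OF s(4), of s'] s by auto
  qed
  have "card {s \<in> {1..n - 1}. \<exists>j<3. g j s \<noteq> g j (s - 1)}
      = card (\<rho> ` {s \<in> {1..n - 1}. \<exists>j<3. g j s \<noteq> g j (s - 1)})"
    by (intro card_image[symmetric] inj_on_subset[OF inj]) auto
  also have "\<dots> \<le> card {i \<in> {2..n}. \<exists>j<3. a j i \<noteq> a j (i - 1)}"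
    using sub by (intro card_mono) auto
  finally have card_g: "card {s \<in> {1..n - 1}. \<exists>j<3. g j s \<noteq> g j (s - 1)} \<le> 5" using card by linarith
  have g0: "g j 0 = 0" if "j < 3" for j using ap[OF that] p by (auto simp: g_def \<rho>_def)
  have gN: "g j (n - 1) = 2" if "j < 3" for j using p by (auto simp: g_def \<rho>_def)
  obtain i j where ij: "i < 3" "j < 3" "i \<noteq> j" "\<And>s. s \<le> n - 1 \<Longrightarrow> g j s \<le> g i s"
    by (rule comparable_step_functions[of g "n - 1", OF g0 gN _ card_g]) (use g_step in blast)+
  show ?thesis
  proof (rule that[OF ij(1-3)])
    fix q assume q: "1 \<le> q" "q \<le> n"
    define s where "s = (if p < q then q - (p + 1) else q + n - (p + 1))"
    have s: "s \<le> n - 1" "\<rho> s = q" "p + 1 + s \<le> n \<longleftrightarrow> p < q"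
      using q p by (auto simp: s_def \<rho>_def)
    show "a j q + a i p \<le> a i q + a j p"
      using ij(4)[OF s(1)] ge[OF ij(1), of s] ge[OF ij(2), of s] s(2,3)
      by (auto simp: g_def split: if_splits)
  qed
qed

section \<open>Lattice steps at extreme entries, and modules of rank 2\<close>

context cm_rep
begin

lemma L_step_zero:
  assumes r: "r \<in> {1..n}" and "class_vector k n M (vtx n r (Suc i)) = 0"
  shows "L r (Suc i) = L r i"
proof -
  have q: "vtx n r (Suc i) \<in> {1..n}" using vtx_in n_pos by blast
  have "V (vtx n r i) \<subseteq> ymap M (vtx n r (Suc i)) ` V (vtx n r (Suc i))"
    using class_vector_properties(5)[OF q assms(2)] by (simp add: prv_vtx_Suc[OF n_pos])
  then have "L r i \<subseteq> L r (Suc i)" by (auto simp: L_def Y_Suc)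
  then show ?thesis using L_Suc_subset[of r i] by blast
qed

lemma L_step_full:
  assumes r: "r \<in> {1..n}" and "class_vector k n M (vtx n r (Suc i)) = int m"
  shows "L r (Suc i) \<subseteq> scl M fps_X ` L r i"
proof
  fix l assume "l \<in> L r (Suc i)"
  then obtain w where w: "w \<in> V (vtx n r (Suc i))" "l = Y r (Suc i) w" by (auto simp: L_def)
  have q: "vtx n r (Suc i) \<in> {1..n}" using vtx_in n_pos by blast
  have "w \<in> xmap M (vtx n r (Suc i)) ` V (prv n (vtx n r (Suc i)))"
    using class_vector_properties(6)[OF q assms(2)] w(1) by blast
  then obtain u where u: "u \<in> V (prv n (vtx n r (Suc i)))" "w = xmap M (vtx n r (Suc i)) u" by blast
  have u': "u \<in> V (vtx n r i)" using u(1) by (simp add: prv_vtx_Suc[OF n_pos])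
  have "l = scl M fps_X (Y r i u)"
    using w(2) u(2) ymap_xmap[OF q u(1)] Y_scale[OF r u'] by (simp add: Y_Suc)
  then show "l \<in> scl M fps_X ` L r i" using u' unfolding L_def by blast
qed

text \<open>The bound on the entry makes \<open>L r 1\<close> generated by \<open>X V r\<close> and
  the image of one vector \<open>z\<close>. Since \<open>v\<close> is not in \<open>X V r\<close>,
  its coefficient at that image is a unit, so \<open>v\<close> can take its place.\<close>

lemma L_1_almost_full:
  assumes r: "r \<in> {1..n}" and x: "class_vector k n M (vtx n r 1) \<ge> int m - 1"
    and v: "v \<in> L r 1" "v \<notin> scl M fps_X ` V r" and w: "w \<in> L r 1"
  obtains a u where "u \<in> V r" "w = scl M a v + scl M fps_X u"
proof -
  define q where "q = vtx n r 1"
  have q: "q \<in> {1..n}" using vtx_in n_pos unfolding q_def by blast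
  have pr: "prv n q = r" using prv_vtx_Suc[OF n_pos, of r 0] vtx_0[OF r] by (simp add: q_def)
  have L1: "L r 1 = ymap M q ` V q" by (auto simp: L_def Y_Suc q_def)
  obtain z where z: "z \<in> V q" "\<forall>w\<in>V q. \<exists>u\<in>V r. \<exists>a. w = xmap M q u + scl M a z"
    using class_vector_properties(7)[OF q] x unfolding q_def[symmetric] pr by blast
  have gen: "\<exists>u\<in>V r. \<exists>a. l = scl M fps_X u + scl M a (ymap M q z)" if l: "l \<in> L r 1" for l
  proof -
    obtain w where w: "w \<in> V q" "l = ymap M q w" using l unfolding L1 by blast
    obtain u a where u: "u \<in> V r" "w = xmap M q u + scl M a z" using z(2) w(1) by blast
    have "ymap M q w = scl M fps_X u + scl M a (ymap M q z)"
      using ymap_add[OF q xmap_in[OF q] subspace_scale[OF subspace_V[OF q] z(1)], of u a]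
        ymap_xmap[OF q, of u] ymap_scale[OF q z(1)] u pr by simp
    then show ?thesis using u(1) w(2) by blast
  qed
  have yz: "ymap M q z \<in> V r" using ymap_in[OF q z(1)] pr by simp
  note Vr = subspace_V[OF r]
  obtain u0 a0 where u0: "u0 \<in> V r" "v = scl M fps_X u0 + scl M a0 (ymap M q z)" using gen[OF v(1)] by blast
  have "fps_nth a0 0 \<noteq> 0"
  proof
    assume "fps_nth a0 0 = 0"
    then obtain d where "a0 = fps_X * d" using fps_X_dvd_iff unfolding dvd_def by blast
    then have "v = scl M fps_X (u0 + scl M d (ymap M q z))"
      using u0(2) by (simp add: scale_right_distrib)
    then show False using v(2) subspace_add[OF Vr u0(1) subspace_scale[OF Vr yz]] by blast
  qed
  then obtain c where c: "a0 * c = 1" using fps_dvd_one_iff unfolding dvd_def by metis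
  have "scl M c v = scl M fps_X (scl M c u0) + scl M (a0 * c) (ymap M q z)"
    unfolding u0(2) by (simp add: scale_right_distrib mult.commute)
  then have yz_eq: "ymap M q z = scl M c v - scl M fps_X (scl M c u0)" using c by simp
  obtain u a where u: "u \<in> V r" "w = scl M fps_X u + scl M a (ymap M q z)" using gen[OF w] by blast
  have "w = scl M (a * c) v + scl M fps_X (u - scl M (a * c) u0)"
    unfolding u(2) yz_eq by (simp add: scale_right_diff_distrib mult_ac)
  moreover have "u - scl M (a * c) u0 \<in> V r"
    using subspace_diff[OF Vr u(1) subspace_scale[OF Vr u0(1)]] .
  ultimately show ?thesis using that by blast
qed

text \<open>At an entry 2 the next lattice lies in \<open>X\<close> times the previous one. Dividing
  by \<open>X^(c i)\<close>, where \<open>c i\<close> counts the entries 2 passed so far, leaves a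
  chain above \<open>X^2 V r\<close> because \<open>c n\<close> is at least \<open>k - 2\<close>. A
  vector splitting this flag splits the original chain.\<close>

lemma rank2_decomposable:
  assumes m: "m = 2" and twos: "k \<le> card {q \<in> {1..n}. class_vector k n M q = 2} + 2"
  shows "\<not> indecomposable_module n M"
proof -
  define x where "x = class_vector k n M"
  define r where "r = n"
  have r: "r \<in> {1..n}" using n_pos by (simp add: r_def)
  note Vr = subspace_V[OF r]
  define c where "c i = card {j \<in> {1..i}. x (vtx n r j) = 2}" for i
  have c_Suc: "c (Suc i) = (if x (vtx n r (Suc i)) = 2 then Suc (c i) else c i)" for i
  proof -
    have "{j \<in> {1..Suc i}. x (vtx n r j) = 2} =
      (if x (vtx n r (Suc i)) = 2 then {Suc i} else {}) \<union> {j \<in> {1..i}. x (vtx n r j) = 2}"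
      by (auto simp: le_Suc_eq)
    then show ?thesis by (simp add: c_def)
  qed
  have c_n: "k \<le> c n + 2"
  proof -
    have img: "vtx n r ` {1..n} = {1..n}" by (rule bij_betw_imp_surj_on[OF bij_betw_vtx[OF r]])
    have "vtx n r ` {j \<in> {1..n}. x (vtx n r j) = 2} = {q \<in> {1..n}. x q = 2}"
    proof (intro equalityI subsetI)
      fix q assume "q \<in> vtx n r ` {j \<in> {1..n}. x (vtx n r j) = 2}"
      then obtain j where "x (vtx n r j) = 2" "q = vtx n r j" by blast
      then show "q \<in> {q \<in> {1..n}. x q = 2}" using vtx_in[OF n_pos, of r j] by simp
    next
      fix q assume q: "q \<in> {q \<in> {1..n}. x q = 2}"
      then have "q \<in> vtx n r ` {1..n}" unfolding img by simp
      then obtain j where "j \<in> {1..n}" "q = vtx n r j" by (rule imageE)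
      then show "q \<in> vtx n r ` {j \<in> {1..n}. x (vtx n r j) = 2}" using q by simp
    qed
    then have "bij_betw (vtx n r) {j \<in> {1..n}. x (vtx n r j) = 2} {q \<in> {1..n}. x q = 2}"
      by (intro bij_betw_subset[OF bij_betw_vtx[OF r]]) auto
    then have "c n = card {q \<in> {1..n}. x q = 2}" unfolding c_def by (rule bij_betw_same_card)
    then show ?thesis using twos by (simp add: x_def)
  qed
  define N where "N i = {u \<in> V r. scl M (fps_X ^ c i) u \<in> L r i}" for i
  have N_Suc: "N (Suc i) \<subseteq> N i" for i
  proof
    fix u assume u: "u \<in> N (Suc i)"
    then have uV: "u \<in> V r" by (simp add: N_def)
    show "u \<in> N i"
    proof (cases "x (vtx n r (Suc i)) = 2")
      case False
      then show ?thesis using u L_Suc_subset c_Suc by (auto simp: N_def)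
    next
      case True
      then have "scl M (fps_X ^ Suc (c i)) u \<in> scl M fps_X ` L r i"
        using L_step_full[OF r, of i] u m c_Suc by (auto simp: N_def x_def)
      then obtain l where l: "l \<in> L r i" "scl M fps_X (scl M (fps_X ^ c i) u) = scl M fps_X l" by auto
      have "scl M fps_X (scl M (fps_X ^ c i) u - l) = 0" using l(2) by (simp add: scale_right_diff_distrib)
      moreover have "scl M (fps_X ^ c i) u - l \<in> V r"
        using subspace_diff[OF Vr subspace_scale[OF Vr uV]] l(1) L_subset[OF r] by blast
      ultimately have "scl M (fps_X ^ c i) u = l" using torsion_free[OF r, of _ fps_X] by fastforce
      then show ?thesis using uV l(1) by (simp add: N_def)
    qed
  qed
  have N_antimono: "N j \<subseteq> N i" if "i \<le> j" for i j
    using lift_Suc_antimono_le[of N, OF N_Suc that] .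
  have L_c: "L r i \<subseteq> scl M (fps_X ^ c i) ` V r" for i
  proof (induction i)
    case (Suc i)
    show ?case
    proof (cases "x (vtx n r (Suc i)) = 2")
      case False
      then show ?thesis using subset_trans[OF L_Suc_subset Suc] c_Suc by simp
    next
      case True
      then have "L r (Suc i) \<subseteq> scl M fps_X ` L r i" using L_step_full[OF r, of i] m by (simp add: x_def)
      also have "\<dots> \<subseteq> scl M fps_X ` scl M (fps_X ^ c i) ` V r" using Suc by blast
      also have "\<dots> = scl M (fps_X ^ c (Suc i)) ` V r" using True c_Suc by (simp add: image_image)
      finally show ?thesis .
    qed
  qed (simp add: c_def L_0[OF r])
  have fl: "flag n (V r) N"
    unfolding flag_def
  proof (intro conjI allI impI ballI)
    show "N 0 = V r" by (auto simp: N_def c_def L_0[OF r])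
    show "subspace (N i)" for i
      using subspace_0[OF Vr] subspace_add[OF Vr] subspace_scale[OF Vr]
        subspace_0[OF subspace_L[OF r]] subspace_add[OF subspace_L[OF r]] subspace_scale[OF subspace_L[OF r]]
      by (intro subspaceI) (auto simp: N_def scale_right_distrib scale_left_commute[of "fps_X ^ c i"] simp del: scale_scale)
    show "scl M (fps_X\<^sup>2) u \<in> N i" if "i \<le> n" "u \<in> V r" for i u
    proof -
      \<comment> \<open>The difference \<open>c n + 2 - k\<close> is exact by
        \<open>c_n\<close>.\<close>
      have "scl M (fps_X ^ c n) (scl M (fps_X ^ 2) u) = scl M (fps_X ^ k) (scl M (fps_X ^ (c n + 2 - k)) u)"
        using c_n by (simp flip: power_add)
      also have "\<dots> \<in> L r n" unfolding L_n[OF r] using subspace_scale[OF Vr that(2)] by (rule imageI)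
      finally have "scl M (fps_X ^ 2) u \<in> N n" using subspace_scale[OF Vr that(2)] by (simp add: N_def)
      then show ?thesis using N_antimono[OF that(1)] by blast
    qed
    show "N j \<subseteq> N i" if "i \<le> j \<and> j \<le> n" for i j using N_antimono that by blast
  qed
  obtain b f where db: "dual_basis {..<m} (V r) b f" using free[OF r] by blast
  have "{..<m} \<noteq> {}" using m by (simp add: lessThan_empty_iff)
  from flag_split_vector[OF db this fl] obtain v g a where v: "v \<in> V r" and g: "functional (V r) g" "g v = 1"
    and a: "\<And>i. i \<le> n \<Longrightarrow> scl M (fps_X ^ a i) v \<in> N i" "\<And>i u. i \<le> n \<Longrightarrow> u \<in> N i \<Longrightarrow> fps_X ^ a i dvd g u"
    by metis
  show ?thesis
  proof (rule decomposable[OF r g(1) v g(2)])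
    fix i l assume i: "i \<in> {1..n}" and l: "l \<in> L r i"
    obtain u where u: "u \<in> V r" "l = scl M (fps_X ^ c i) u" using L_c l by blast
    then have "u \<in> N i" using l by (simp add: N_def)
    then obtain d where d: "g u = fps_X ^ a i * d" using a(2)[of i u] i by (auto simp: dvd_def)
    have "scl M (g l) v = scl M d (scl M (fps_X ^ c i) (scl M (fps_X ^ a i) v))"
      using functional_scale[OF g(1) u(1)] u(2) d by (simp add: mult_ac)
    also have "\<dots> \<in> L r i"
      using a(1)[of i] i by - (rule subspace_scale[OF subspace_L[OF r]], simp add: N_def)
    finally show "scl M (g l) v \<in> L r i" .
  qed (use m in simp)
qed

end

section \<open>Modules of rank 3 for k = 3\<close>

context cm_rep
begin

lemma rank3_decomposable:
  assumes m: "m = 3" and k: "k = 3" and q0: "q0 \<in> {1..n}" "class_vector k n M q0 \<ge> 2"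
    and nonzero: "card {q \<in> {1..n}. class_vector k n M q \<noteq> 0} \<le> 7"
  shows "\<not> indecomposable_module n M"
proof -
  define x where "x = class_vector k n M"
  \<comment> \<open>The base vertex precedes \<open>q0\<close>, so the large entry governs the step
    from \<open>L r 0\<close> to \<open>L r 1\<close>.\<close>
  define r where "r = prv n q0"
  have r: "r \<in> {1..n}" using prv_in[OF q0(1)] by (simp add: r_def)
  note Vr = subspace_V[OF r]
  have vtx1: "vtx n r 1 = q0"
    using nxt_vtx[OF n_pos, of r 0] vtx_0[OF r] nxt_prv[OF q0(1)] by (simp add: r_def)
  define XV where "XV = scl M fps_X ` V r"
  \<comment> \<open>Multiplication by \<open>X\<close> identifies \<open>N i\<close> with the
    intersection of \<open>L r i\<close> and \<open>X V r\<close>. These form a flag because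
    \<open>L r n\<close> is \<open>X^3 V r\<close>.\<close>
  define N where "N i = (if i = 0 then V r else {u \<in> V r. scl M fps_X u \<in> L r i})" for i
  have XL1: "scl M fps_X u \<in> L r 1" if "u \<in> V r" for u
    using X_L[OF r, of u 0] L_0[OF r] that by simp
  have XLn: "scl M (fps_X ^ 3) u \<in> L r n" if "u \<in> V r" for u
    using that k by (simp add: L_n[OF r])
  have N_antimono: "N j \<subseteq> N i" if "i \<le> j" for i j
    using L_antimono[OF that] that by (auto simp: N_def)
  have N_pos: "u \<in> N i \<longleftrightarrow> u \<in> V r \<and> scl M fps_X u \<in> L r i" if "1 \<le> i" for i u
    using that by (simp add: N_def)
  have N_sub: "subspace (N i)" for i
  proof (cases "i = 0")
    case False
    note Li = subspace_L[OF r, of i]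
    show ?thesis
    proof (rule subspaceI)
      show "0 \<in> N i" using subspace_0[OF Vr] subspace_0[OF Li] False by (simp add: N_def)
      fix u v c assume u: "u \<in> N i"
      have "scl M c (scl M fps_X u) \<in> L r i" using u False subspace_scale[OF Li] by (simp add: N_def del: scale_scale)
      then show "scl M c u \<in> N i"
        using u False subspace_scale[OF Vr] by (simp add: N_def mult.commute)
      assume "v \<in> N i"
      with u show "u + v \<in> N i"
        using False subspace_add[OF Vr] subspace_add[OF Li] by (simp add: N_def scale_right_distrib)
    qed
  qed (simp add: N_def Vr)
  have fl: "flag n (V r) N"
    unfolding flag_def
  proof (intro conjI allI impI ballI)
    show "N 0 = V r" by (simp add: N_def)
    show "subspace (N i)" for i by (rule N_sub)
    show "scl M (fps_X\<^sup>2) u \<in> N i" if "i \<le> n" "u \<in> V r" for i u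
    proof -
      have "scl M fps_X (scl M (fps_X^2) u) = scl M (fps_X ^ 3) u"
        by (simp add: power3_eq_cube power2_eq_square mult_ac)
      then show ?thesis using XLn[OF that(2)] L_antimono[OF that(1)] subspace_scale[OF Vr that(2)]
        by (auto simp: N_def)
    qed
    show "N j \<subseteq> N i" if "i \<le> j \<and> j \<le> n" for i j using N_antimono that by blast
  qed
  obtain b f where db: "dual_basis {..<m} (V r) b f" using free[OF r] by blast
  show ?thesis
  proof (cases "L r 1 \<subseteq> XV")
    \<comment> \<open>Here \<open>L r i\<close> is \<open>X\<close> times \<open>N i\<close> for all
      positive \<open>i\<close>, so a vector splitting the flag is enough.\<close>
    case True
    have "{..<m} \<noteq> {}" using m by (simp add: lessThan_empty_iff)
    from flag_split_vector[OF db this fl] obtain v g a where v: "v \<in> V r" and g: "functional (V r) g" "g v = 1"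
      and a: "\<And>i. i \<le> n \<Longrightarrow> scl M (fps_X ^ a i) v \<in> N i" "\<And>i u. i \<le> n \<Longrightarrow> u \<in> N i \<Longrightarrow> fps_X ^ a i dvd g u"
      by metis
    show ?thesis
    proof (rule decomposable[OF r g(1) v g(2)])
      fix i l assume i: "i \<in> {1..n}" and l: "l \<in> L r i"
      have "l \<in> XV" using True L_antimono[of 1 i r] i l by auto
      then obtain u where u: "u \<in> V r" "l = scl M fps_X u" by (auto simp: XV_def)
      then have "u \<in> N i" using l i by (simp add: N_def)
      then obtain d where d: "g u = fps_X ^ a i * d" using a(2)[of i u] i by (auto simp: dvd_def)
      have "scl M (g l) v = scl M d (scl M fps_X (scl M (fps_X ^ a i) v))"
        using functional_scale[OF g(1) u(1)] u(2) d by (simp add: mult_ac)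
      also have "\<dots> \<in> L r i"
        using a(1)[of i] i by - (rule subspace_scale[OF subspace_L[OF r]], simp add: N_def del: scale_scale)
      finally show "scl M (g l) v \<in> L r i" .
    qed (use m in simp)
  next
    case False
    have "1 \<le> n" using n_pos by simp
    \<comment> \<open>\<open>L r p\<close> is the last lattice that contains a vector outside
      \<open>X V r\<close>; after it, the lattices are \<open>X\<close> times members of the
      flag.\<close>
    from greatest_index[where P = "\<lambda>i. \<not> L r i \<subseteq> XV", OF False this]
    obtain p where p: "\<not> L r p \<subseteq> XV" "p \<le> n" and p_max: "\<And>i. p < i \<Longrightarrow> i \<le> n \<Longrightarrow> L r i \<subseteq> XV" by metis
    have "1 \<le> p" using p_max[of 1] False n_pos by (cases "p = 0") auto
    have "scl M (fps_X ^ 3) u \<in> XV" if "u \<in> V r" for u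
    proof -
      have "scl M (fps_X ^ 3) u = scl M fps_X (scl M (fps_X ^ 2) u)"
        by (simp add: power3_eq_cube power2_eq_square mult_ac)
      then show ?thesis unfolding XV_def using subspace_scale[OF Vr that] by blast
    qed
    then have "L r n \<subseteq> XV" unfolding L_n[OF r] k by blast
    then have "p < n" using p by (cases "p = n") auto
    obtain v where v: "v \<in> L r p" "v \<notin> XV" using p(1) by blast
    have vV: "v \<in> V r" using v(1) L_subset[OF r] by blast
    have v_low: "v \<in> L r i" if "i \<le> p" for i using L_antimono[OF that] v(1) by blast
    have vN: "v \<in> N (Suc p)" using X_L[OF r v(1)] vV by (simp add: N_def)
    obtain b f a where db: "dual_basis {..<m} (V r) b f"
      and Na: "\<And>i. i \<le> n \<Longrightarrow> N i = {u \<in> V r. \<forall>j\<in>{..<m}. fps_X ^ a j i dvd f j u}"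
      and a2: "\<And>i j. i \<le> n \<Longrightarrow> j \<in> {..<m} \<Longrightarrow> a j i \<le> (2 :: nat)"
      by (rule flag_split[OF db fl], rule that)
    note D = dual_basisD[OF db]
    have bN: "scl M d (b j) \<in> N i \<longleftrightarrow> fps_X ^ a j i dvd d" if "i \<le> n" "j < m" for i j d
    proof -
      have bj: "b j \<in> V r" using D(3) that(2) by simp
      have "f l (scl M d (b j)) = (if l = j then d else 0)" if "l < m" for l
        using functional_scale[OF D(4) bj, of l d] D(5)[of l j] that \<open>j < m\<close> by simp
      then have "(\<forall>l\<in>{..<m}. fps_X ^ a l i dvd f l (scl M d (b j))) \<longleftrightarrow> fps_X ^ a j i dvd d"
        using that(2) by auto
      then show ?thesis unfolding Na[OF that(1)] using subspace_scale[OF Vr bj] by simp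
    qed
    text \<open>
      For \<open>1 \<le> i \<le> p\<close>, \<open>L r i\<close> is generated by \<open>v\<close> and \<open>X (N i)\<close>; so besides the flag \<open>N\<close>,
      an idempotent only has to respect \<open>v\<close> modulo \<open>X (N p)\<close>.
    \<close>
    have finish: ?thesis if j: "j < m" and h: "functional (V r) h" "h (b j) = 1"
      and hN: "\<And>i u. 1 \<le> i \<Longrightarrow> i \<le> n \<Longrightarrow> u \<in> N i \<Longrightarrow> fps_X ^ a j i dvd h u"
      and hv: "fps_X ^ Suc (a j p) dvd h v" for j h
    proof (rule decomposable[OF r h(1) _ h(2)])
      show bj: "b j \<in> V r" using D(3) j by simp
      fix i l assume i: "i \<in> {1..n}" and l: "l \<in> L r i"
      have part: "scl M (h (scl M fps_X u)) (b j) \<in> L r i" if u: "u \<in> N i" for u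
      proof -
        have uV: "u \<in> V r" using u i by (simp add: N_def)
        have "scl M (h u) (b j) \<in> N i" using bN[of i j] hN[of i u] u i j by simp
        then have "scl M fps_X (scl M (h u) (b j)) \<in> L r i" using i by (simp add: N_def del: scale_scale)
        then show ?thesis using functional_scale[OF h(1) uV] by simp
      qed
      show "scl M (h l) (b j) \<in> L r i"
      proof (cases "i \<le> p")
        case False
        then have "l \<in> XV" using p_max[of i] i l by auto
        then obtain u where u: "u \<in> V r" "l = scl M fps_X u" by (auto simp: XV_def)
        then have "u \<in> N i" using l i by (simp add: N_def)
        then show ?thesis using part u(2) by simp
      next
        case True
        have l1: "l \<in> L r 1" "v \<in> L r 1" using L_antimono[of 1 i r] i l v_low[OF \<open>1 \<le> p\<close>] by auto
        obtain \<alpha> u where u: "u \<in> V r" "l = scl M \<alpha> v + scl M fps_X u"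
        proof -
          have "class_vector k n M (vtx n r 1) \<ge> int m - 1" using vtx1 q0(2) m by simp
          from L_1_almost_full[OF r this l1(2) v(2)[unfolded XV_def] l1(1)] that show thesis by blast
        qed
        note Li = subspace_L[OF r, of i]
        have av: "scl M \<alpha> v \<in> L r i" using subspace_scale[OF Li v_low[OF True]] .
        have "scl M fps_X u = l - scl M \<alpha> v" using u(2) by simp
        then have "scl M fps_X u \<in> L r i" using subspace_diff[OF Li l av] by simp
        then have uN: "u \<in> N i" using u(1) i by (simp add: N_def)
        obtain d where d: "h v = fps_X * (fps_X ^ a j p * d)" using hv by (auto simp: dvd_def mult.assoc)
        have "scl M (fps_X ^ a j p * d) (b j) \<in> N p" using bN[of p j] p(2) j by simp
        then have "scl M (fps_X ^ a j p * d) (b j) \<in> N i" using N_antimono[OF True] by blast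
        then have "scl M fps_X (scl M (fps_X ^ a j p * d) (b j)) \<in> L r i" using i by (simp add: N_def del: scale_scale)
        then have "scl M (h v) (b j) \<in> L r i" using d by simp
        then have "scl M \<alpha> (scl M (h v) (b j)) + scl M (h (scl M fps_X u)) (b j) \<in> L r i"
          using part[OF uN] subspace_add[OF Li] subspace_scale[OF Li] by blast
        moreover have "h l = \<alpha> * h v + h (scl M fps_X u)"
          using functional_add[OF h(1) subspace_scale[OF Vr vV] subspace_scale[OF Vr u(1)]]
            functional_scale[OF h(1) vV] u(2) by simp
        ultimately show ?thesis by (simp add: scale_left_distrib)
      qed
    qed (use m in simp)
    show ?thesis
    proof (cases "\<exists>j<m. fps_X ^ Suc (a j p) dvd f j v")
      case True
      then obtain j where j: "j < m" "fps_X ^ Suc (a j p) dvd f j v" by blast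
      show ?thesis
      proof (rule finish[of j "f j"])
        show "fps_X ^ a j i dvd f j u" if "1 \<le> i" "i \<le> n" "u \<in> N i" for i u
          using Na[OF that(2)] that(3) j(1) by auto
      qed (use j D in auto)
    next
      case unit: False
      have a_mono: "a j i \<le> a j i'" if "i \<le> i'" "i' \<le> n" "j < m" for i i' j
      proof -
        have "scl M (fps_X ^ a j i') (b j) \<in> N i'" using bN[of i' j] that by simp
        then have "scl M (fps_X ^ a j i') (b j) \<in> N i" using N_antimono[OF that(1)] by blast
        then show ?thesis using bN[of i j] that by (simp add: fps_X_power_dvd_iff)
      qed
      have a1: "a j 1 = 0" if "j < 3" for j
      proof -
        have "scl M (fps_X ^ 0) (b j) \<in> N 1" using D(3)[of j] that m XL1 by (simp add: N_def)
        then have "(fps_X :: complex fps) ^ a j 1 dvd fps_X ^ 0" using bN[of 1 j "fps_X ^ 0"] that m n_pos by simp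
        then show ?thesis unfolding fps_X_power_dvd_iff by simp
      qed
      have an: "a j n = 2" if j: "j < 3" for j
      proof -
        have bj: "b j \<in> V r" and fj: "functional (V r) (f j)" using D(3,4) j m by auto
        have "scl M (fps_X ^ a j n) (b j) \<in> N n" using bN[of n j] that m by simp
        then have "scl M fps_X (scl M (fps_X ^ a j n) (b j)) \<in> L r n" using n_pos by (simp add: N_def del: scale_scale)
        then obtain u where u: "u \<in> V r" "scl M (fps_X ^ Suc (a j n)) (b j) = scl M (fps_X ^ 3) u"
          using k unfolding L_n[OF r] by auto
        have "f j (scl M (fps_X ^ Suc (a j n)) (b j)) = fps_X ^ Suc (a j n)"
          using functional_scale[OF fj bj] D(5)[of j j] j m by simp
        then have "fps_X ^ Suc (a j n) = fps_X ^ 3 * f j u"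
          using functional_scale[OF fj u(1)] u(2) by simp
        then have "(fps_X :: complex fps) ^ 3 dvd fps_X ^ Suc (a j n)" by (rule dvdI)
        then have "3 \<le> Suc (a j n)" by (simp only: fps_X_power_dvd_iff)
        then show ?thesis using a2[of n j] j m by simp
      qed
      have a_step: "a j (Suc i) = a j i \<or> a j (Suc i) = Suc (a j i)"
        if j: "j < 3" and i: "1 \<le> i" "i < n" for j i
      proof -
        have "scl M (fps_X ^ a j i) (b j) \<in> N i" using bN[of i j] that m by simp
        then have "scl M fps_X (scl M fps_X (scl M (fps_X ^ a j i) (b j))) \<in> L r (Suc i)"
          using X_L[OF r] i by (simp add: N_def del: scale_scale)
        moreover have "scl M fps_X (scl M (fps_X ^ a j i) (b j)) \<in> V r"
          using D(3)[of j] j m subspace_scale[OF Vr] by simp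
        ultimately have "scl M (fps_X ^ Suc (a j i)) (b j) \<in> N (Suc i)" by (simp add: N_def)
        then have "a j (Suc i) \<le> Suc (a j i)"
          using bN[of "Suc i" j] i j m by (simp only: fps_X_power_dvd_iff Suc_leI)
        then show ?thesis using a_mono[of i "Suc i" j] i j m by auto
      qed
      have v_dvd: "fps_X ^ a j (Suc p) dvd f j v" if "j < 3" for j
        using vN Na[of "Suc p"] \<open>p < n\<close> that m by auto
      \<comment> \<open>\<open>v\<close> lies in \<open>N (Suc p)\<close>. If an exponent rose at
        this step, \<open>f j v\<close> would be divisible by \<open>X^(Suc (a j p))\<close>, which
        \<open>unit\<close> excludes.\<close>
      have ap: "a j (Suc p) = a j p" if "j < 3" for j
        using a_step[OF that \<open>1 \<le> p\<close> \<open>p < n\<close>] unit v_dvd[OF that] that m by auto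
      \<comment> \<open>A rising exponent changes \<open>N i\<close> and hence the lattice, which a
        zero entry would leave unchanged.\<close>
      have jump: "x (vtx n r i) \<noteq> 0" if "i \<in> {2..n}" "j < 3" "a j i \<noteq> a j (i - 1)" for i j
      proof
        assume "x (vtx n r i) = 0"
        moreover define i' where "i' = i - 1"
        then have i': "i = Suc i'" "1 \<le> i'" using that(1) by auto
        ultimately have "L r i = L r i'" using L_step_zero[OF r, of i'] by (simp add: x_def)
        then have "N i = N i'" using i' by (simp add: N_def)
        then have "fps_X ^ a j i dvd d \<longleftrightarrow> fps_X ^ a j i' dvd d" for d :: "complex fps"
          using bN[of i j d] bN[of i' j d] that i' m by simp
        from this[of "fps_X ^ a j i"] this[of "fps_X ^ a j i'"] have "a j i = a j i'"
          by (simp add: fps_X_power_dvd_iff)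
        then show False using that(3) i' by simp
      qed
      let ?J = "{i \<in> {2..n}. \<exists>j<3. a j i \<noteq> a j (i - 1)}"
      \<comment> \<open>The entries at positions 1 and \<open>Suc p\<close> are nonzero, but no jump
        is counted there. Of at most seven nonzero entries this leaves at most five for the
        jumps.\<close>
      have "insert 1 (insert (Suc p) ?J) \<subseteq> {i \<in> {1..n}. x (vtx n r i) \<noteq> 0}"
      proof -
        have "x (vtx n r 1) \<noteq> 0" using vtx1 q0(2) by (simp add: x_def)
        moreover have "x (vtx n r (Suc p)) \<noteq> 0"
        proof
          assume "x (vtx n r (Suc p)) = 0"
          then have "L r (Suc p) = L r p" using L_step_zero[OF r] by (simp add: x_def)
          then show False using p(1) p_max[of "Suc p"] \<open>p < n\<close> by auto
        qed
        ultimately show ?thesis using jump \<open>p < n\<close> n_pos by auto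
      qed
      then have "card (insert 1 (insert (Suc p) ?J)) \<le> card {i \<in> {1..n}. x (vtx n r i) \<noteq> 0}"
        by (intro card_mono) auto
      also have "\<dots> = card (vtx n r ` {i \<in> {1..n}. x (vtx n r i) \<noteq> 0})"
        using bij_betw_imp_inj_on[OF bij_betw_vtx[OF r]]
        by (intro card_image[symmetric]) (auto intro: inj_on_subset)
      also have "\<dots> \<le> card {q \<in> {1..n}. x q \<noteq> 0}"
        using vtx_in[OF n_pos, of r] by (intro card_mono) auto
      also have "\<dots> \<le> 7" using nonzero by (simp add: x_def)
      finally have "card (insert 1 (insert (Suc p) ?J)) \<le> 7" .
      moreover have "1 \<notin> insert (Suc p) ?J" using \<open>1 \<le> p\<close> by auto
      moreover have "Suc p \<notin> ?J" using ap by auto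
      ultimately have card_J: "card ?J \<le> 5" by simp
      obtain i j where ij: "i < 3" "j < 3" "i \<noteq> j"
        and comp: "\<And>q. 1 \<le> q \<Longrightarrow> q \<le> n \<Longrightarrow> a j q + a i p \<le> a i q + a j p"
        using comparable_cyclic_step_functions[of p n a, OF \<open>1 \<le> p\<close> \<open>p < n\<close> a1 an a_step ap card_J] by blast
      \<comment> \<open>At position 1 both exponents vanish, so the comparison there gives this
        bound, which makes the difference of exponents in \<open>c\<close> exact.\<close>
      have pij: "a i p \<le> a j p" using comp[of 1] a1[OF ij(1)] a1[OF ij(2)] n_pos by simp
      obtain e where e: "f i v = fps_X ^ a i p * e" using v_dvd[OF ij(1)] ap[OF ij(1)] by (auto simp: dvd_def)
      have "\<not> fps_X dvd e"
        using unit e ij(1) m by (auto simp: dvd_def mult.assoc mult.left_commute)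
      then obtain e' where e': "e * e' = 1" using fps_X_dvd_iff fps_dvd_one_iff unfolding dvd_def by metis
      obtain d where d: "f j v = fps_X ^ a j p * d" using v_dvd[OF ij(2)] ap[OF ij(2)] by (auto simp: dvd_def)
      \<comment> \<open>Chosen so that \<open>c * f i v = f j v\<close>, hence
        \<open>h v = 0\<close>; this uses that \<open>e\<close> is a unit. The comparison
        \<open>comp\<close> guarantees that subtracting \<open>c * f i u\<close> keeps the
        divisibility required on the flag.\<close>
      define c where "c = fps_X ^ (a j p - a i p) * (d * e')"
      define h where "h u = f j u - c * f i u" for u
      have fij: "functional (V r) (f i)" "functional (V r) (f j)" using D(4) ij m by auto
      show ?thesis
      proof (rule finish[of j h])
        show "functional (V r) h"
          using fij unfolding functional_def h_def by (auto simp: algebra_simps)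
        show "h (b j) = 1" using D(5) ij m by (auto simp: h_def)
        have "c * f i v = fps_X ^ (a j p - a i p) * fps_X ^ a i p * d * (e * e')"
          by (simp add: c_def e mult_ac)
        also have "\<dots> = f j v" using pij e' d by (simp flip: power_add)
        finally show "fps_X ^ Suc (a j p) dvd h v" by (simp add: h_def)
        show "fps_X ^ a j q dvd h u" if q: "1 \<le> q" "q \<le> n" "u \<in> N q" for q u
        proof -
          have 1: "fps_X ^ a j q dvd f j u" "fps_X ^ a i q dvd f i u" using Na[OF q(2)] q(3) ij m by auto
          have "(fps_X :: complex fps) ^ a j q dvd fps_X ^ (a j p - a i p + a i q)"
            using comp[OF q(1,2)] pij by (intro le_imp_power_dvd) linarith
          also have "\<dots> = fps_X ^ (a j p - a i p) * fps_X ^ a i q" by (rule power_add)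
          also have "\<dots> dvd c * f i u" unfolding c_def using 1(2) by (intro mult_dvd_mono) auto
          finally show ?thesis unfolding h_def using 1(1) by (rule dvd_diff[rotated])
        qed
      qed (use ij m in simp)
    qed
  qed
qed

end

section \<open>Roots\<close>

lemma root_form_simple_root:
  assumes "i \<in> {1..n}"
  shows "root_form k n c (simple_root i) = (\<Sum>a\<in>{1..n}. cartan k n a i * c a)"
  unfolding root_form_def
proof (intro sum.cong refl)
  fix a
  have "(\<Sum>j\<in>{1..n}. cartan k n a j * c a * simple_root i j)
    = (\<Sum>j\<in>{1..n}. if j = i then cartan k n a i * c a else 0)"
    by (intro sum.cong) (auto simp: simple_root_def)
  then show "(\<Sum>j\<in>{1..n}. cartan k n a j * c a * simple_root i j) = cartan k n a i * c a"
    using assms by simp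
qed

lemma simple_reflection_involution:
  assumes "i \<in> {1..n}"
  shows "simple_reflection k n i (simple_reflection k n i c) = c"
proof -
  define \<rho> where "\<rho> = root_form k n c (simple_root i)"
  have "root_form k n (simple_reflection k n i c) (simple_root i)
    = (\<Sum>a\<in>{1..n}. cartan k n a i * c a - (if a = i then 2 * \<rho> else 0))"
    unfolding root_form_simple_root[OF assms]
    by (intro sum.cong) (auto simp: simple_reflection_def \<rho>_def simple_root_def cartan_def algebra_simps)
  also have "\<dots> = \<rho> - 2 * \<rho>"
    using assms by (simp add: sum_subtractf \<rho>_def root_form_simple_root)
  finally show ?thesis
    by (auto simp: simple_reflection_def \<rho>_def[symmetric] fun_eq_iff)
qed

lemma J_roots_reflection:
  assumes "i \<in> {1..n}" "c \<in> J_roots k n"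
  shows "simple_reflection k n i c \<in> J_roots k n"
proof -
  have step: "simple_reflection k n i \<circ> w \<in> weyl_group k n" if "w \<in> weyl_group k n" for w
    using that assms(1) by (rule weyl_step)
  consider w j where "c = w (simple_root j)" "w \<in> weyl_group k n" "j \<in> {1..n}"
    | w d where "c = w d" "w \<in> weyl_group k n" "d \<in> fundamental_set k n \<or> - d \<in> fundamental_set k n"
    using assms(2) unfolding J_roots_def real_roots_def imaginary_roots_def by blast
  then show ?thesis
  proof cases
    case 1
    then have "simple_reflection k n i c = (simple_reflection k n i \<circ> w) (simple_root j)" by simp
    then show ?thesis using step[OF 1(2)] 1(3) unfolding J_roots_def real_roots_def by blast
  next
    case 2
    then have "simple_reflection k n i c = (simple_reflection k n i \<circ> w) d" by simp
    then show ?thesis using step[OF 2(2)] 2(3) unfolding J_roots_def imaginary_roots_def by blast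
  qed
qed

lemma lattice_to_Zn_simple_root:
  assumes "i \<in> {1..n}"
  shows "lattice_to_Zn k n (simple_root i) = simple_root_vector k n i"
proof
  fix l
  have "lattice_to_Zn k n (simple_root i) l = (\<Sum>j\<in>{1..n}. if j = i then simple_root_vector k n i l else 0)"
    unfolding lattice_to_Zn_def by (intro sum.cong) (auto simp: simple_root_def)
  then show "lattice_to_Zn k n (simple_root i) l = simple_root_vector k n i l" using assms by simp
qed

lemma lattice_to_Zn_reflection:
  assumes "i \<in> {1..n}"
  shows "lattice_to_Zn k n (simple_reflection k n i c) =
    (\<lambda>l. lattice_to_Zn k n c l - root_form k n c (simple_root i) * simple_root_vector k n i l)"
proof -
  have "lattice_to_Zn k n (simple_reflection k n i c) l =
    lattice_to_Zn k n c l - root_form k n c (simple_root i) * lattice_to_Zn k n (simple_root i) l" for l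
    unfolding lattice_to_Zn_def simple_reflection_def
    by (simp add: left_diff_distrib sum_subtractf sum_distrib_left mult.assoc)
  then show ?thesis unfolding lattice_to_Zn_simple_root[OF assms] by (rule ext)
qed

section \<open>Roots written as integer vectors\<close>

locale root_vectors =
  fixes k n :: nat
  assumes k_pos: "1 \<le> k" and k_less: "k < n"
begin

text \<open>In these coordinates the reflections in \<alpha>_1, ..., \<alpha>_(n-1) are swaps of
  neighbouring entries, and class vectors can be compared directly.\<close>

definition root_set :: "(nat \<Rightarrow> int) set" where
  "root_set = lattice_to_Zn k n ` (root_lattice n \<inter> J_roots k n)"

lemma inv_in_J_roots:
  assumes "x \<in> root_set"
  shows "inv_into (root_lattice n) (lattice_to_Zn k n) x \<in> J_roots k n"
  using assms bij_betw_imp_inj_on[OF bij_betw_lattice_to_Zn[OF k_pos k_less]]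
  by (auto simp: root_set_def inv_into_f_f)

lemma in_Zn_k_obtain:
  assumes "x \<in> Zn_k k n"
  obtains c where "c \<in> root_lattice n" "lattice_to_Zn k n c = x"
proof -
  have "x \<in> lattice_to_Zn k n ` root_lattice n"
    using assms unfolding bij_betw_imp_surj_on[OF bij_betw_lattice_to_Zn[OF k_pos k_less]] .
  then show ?thesis using that by blast
qed

text \<open>A reflection is its own inverse and preserves roots, so a vector is a root as soon as
  its reflection is one.\<close>

lemma root_set_reflection:
  assumes x: "c \<in> root_lattice n" and i: "i \<in> {1..n}"
    and root_set: "(\<lambda>l. lattice_to_Zn k n c l - root_form k n c (simple_root i) * simple_root_vector k n i l) \<in> root_set"
  shows "lattice_to_Zn k n c \<in> root_set"
proof -
  obtain d where d: "d \<in> root_lattice n" "d \<in> J_roots k n"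
    "lattice_to_Zn k n d = lattice_to_Zn k n (simple_reflection k n i c)"
    using root_set unfolding lattice_to_Zn_reflection[OF i, symmetric] root_set_def by auto
  have "simple_reflection k n i c \<in> root_lattice n"
    using x i by (auto simp: root_lattice_def simple_reflection_def simple_root_def)
  then have "d = simple_reflection k n i c"
    using d bij_betw_imp_inj_on[OF bij_betw_lattice_to_Zn[OF k_pos k_less]] by (auto dest: inj_onD)
  then have "c \<in> J_roots k n"
    using J_roots_reflection[OF i d(2)] simple_reflection_involution[OF i] by simp
  then show ?thesis using x by (auto simp: root_set_def)
qed

lemma root_form_eq_dot:
  assumes "j \<in> {1..n}"
  shows "of_int (root_form k n c (simple_root j)) = Zn_form k n (lattice_to_Zn k n c) (simple_root_vector k n j)"
  using Zn_form_lattice_to_Zn[OF k_pos k_less, of c "simple_root j"] lattice_to_Zn_simple_root[OF assms] by simp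

lemma root_form_adjacent:
  assumes "1 \<le> j" "j < n"
  shows "root_form k n c (simple_root j) = lattice_to_Zn k n c (j + 1) - lattice_to_Zn k n c j"
proof -
  have j: "j \<in> {1..n}" using assms by simp
  have "(of_int (root_form k n c (simple_root j)) :: rat) =
      of_int (lattice_to_Zn k n c (j + 1) - lattice_to_Zn k n c j)"
    unfolding root_form_eq_dot[OF j] Zn_form_def sum_simple_root_vector[OF k_pos k_less j]
      dot_simple_root_vector(1)[OF k_pos k_less j assms(2,1)]
    using assms by simp
  then show ?thesis by (simp only: of_int_eq_iff)
qed

lemma root_form_last:
  assumes "(\<Sum>l\<in>{1..n}. lattice_to_Zn k n c l) = int k * s"
  shows "root_form k n c (simple_root n) = (\<Sum>l\<in>{1..k}. lattice_to_Zn k n c l) + (2 - int k) * s"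
proof -
  have n: "n \<in> {1..n}" using k_less by simp
  have k0: "(of_nat k :: rat) \<noteq> 0" using k_pos by simp
  have "(of_int (root_form k n c (simple_root n)) :: rat) =
      of_int ((\<Sum>l\<in>{1..k}. lattice_to_Zn k n c l) + (2 - int k) * s)"
    unfolding root_form_eq_dot[OF n] Zn_form_def sum_simple_root_vector[OF k_pos k_less n]
      dot_simple_root_vector(2)[OF k_pos k_less n] assms
    using k0 by (simp add: power2_eq_square)
  then show ?thesis by (simp only: of_int_eq_iff)
qed

definition adj_swap :: "nat \<Rightarrow> nat \<Rightarrow> nat" where
  "adj_swap j i = (if i = j then j + 1 else if i = j + 1 then j else i)"

lemma sum_adj_swap:
  assumes "1 \<le> j" "j < n"
  shows "(\<Sum>i\<in>{1..n}. g (adj_swap j i)) = (\<Sum>i\<in>{1..n}. (g i :: int))"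
  by (rule sum.reindex_bij_witness[of _ "adj_swap j" "adj_swap j"]) (use assms in \<open>auto simp: adj_swap_def\<close>)

text \<open>The right-hand side is the reflection in \<alpha>_j, whose inner product with
  \<open>x\<close> is \<open>x (j + 1) - x j\<close>.\<close>

lemma swap_eq:
  assumes "1 \<le> j" "j < n"
  shows "(\<lambda>i. x (adj_swap j i)) = (\<lambda>l. x l - (x (j + 1) - x j) * simple_root_vector k n j l)"
  using assms by (auto simp: adj_swap_def simple_root_vector_def fun_eq_iff)

lemma root_set_swap:
  assumes x: "x \<in> Zn_k k n" and j: "1 \<le> j" "j < n" and root_set: "(\<lambda>i. x (adj_swap j i)) \<in> root_set"
  shows "x \<in> root_set"
proof -
  obtain c where c: "c \<in> root_lattice n" "lattice_to_Zn k n c = x" using in_Zn_k_obtain[OF x] .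
  have "j \<in> {1..n}" using j by simp
  from root_set_reflection[OF c(1) this] show ?thesis
    using root_set unfolding swap_eq[OF j] root_form_adjacent[OF j] c(2) by simp
qed

text \<open>Assumption \<open>A\<close> says that the inner product with \<beta> is 1, so reflecting
  in \<beta> subtracts it once.\<close>

lemma root_set_subtract:
  assumes x: "x \<in> Zn_k k n" and s: "(\<Sum>l\<in>{1..n}. x l) = int k * s"
    and A: "(\<Sum>l\<in>{1..k}. x l) = (int k - 2) * s + 1"
    and root_set: "(\<lambda>l. x l - (if l \<in> {1..k} then 1 else 0)) \<in> root_set"
  shows "x \<in> root_set"
proof -
  obtain c where c: "c \<in> root_lattice n" "lattice_to_Zn k n c = x" using in_Zn_k_obtain[OF x] .
  have n: "n \<in> {1..n}" using k_less by simp
  have "root_form k n c (simple_root n) = 1"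
    using root_form_last[of c s] s A unfolding c(2) by (simp add: algebra_simps)
  then show ?thesis
    using root_set_reflection[OF c(1) n] root_set unfolding c(2) by (simp add: simple_root_vector_def)
qed

lemma root_set_beta: "(\<lambda>l. if l \<in> {1..k} then 1 else 0) \<in> root_set"
proof -
  have n: "n \<in> {1..n}" using k_less by simp
  have "simple_root n \<in> real_roots k n"
    unfolding real_roots_def using n weyl_id[of k n] by (auto intro!: exI[of _ id])
  moreover have "simple_root n \<in> root_lattice n" using n by (auto simp: root_lattice_def simple_root_def)
  moreover have "lattice_to_Zn k n (simple_root n) = (\<lambda>l. if l \<in> {1..k} then 1 else 0)"
    unfolding lattice_to_Zn_simple_root[OF n] by (simp add: simple_root_vector_def)
  ultimately show ?thesis unfolding root_set_def J_roots_def by (metis IntI UnI1 imageI)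
qed

section \<open>Sorting a vector by reflections\<close>

definition decreasing :: "(nat \<Rightarrow> int) \<Rightarrow> bool" where
  "decreasing x \<longleftrightarrow> (\<forall>j. 1 \<le> j \<and> j < n \<longrightarrow> x (j + 1) \<le> x j)"

lemma decreasingD:
  assumes "decreasing x" "1 \<le> i" "i \<le> j" "j \<le> n"
  shows "x j \<le> x i"
  using assms(3,4)
proof (induction j rule: dec_induct)
  case (step j)
  then have "x (j + 1) \<le> x j" using assms(1,2) unfolding decreasing_def by auto
  then show ?case using step by simp
qed simp

text \<open>Swapping an ascending pair of neighbours lowers the sum of the \<open>i * x i\<close>.
  As this sum is nonnegative, swaps that preserve \<open>P\<close> end in a sorted vector.\<close>

lemma sort_induct:
  assumes P: "P x"
    and swap: "\<And>x j. P x \<Longrightarrow> 1 \<le> j \<Longrightarrow> j < n \<Longrightarrow> P (\<lambda>i. x (adj_swap j i))"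
    and Zn: "\<And>x. P x \<Longrightarrow> x \<in> Zn_k k n" and nonneg: "\<And>x i. P x \<Longrightarrow> 0 \<le> x i"
    and sorted: "\<And>x. P x \<Longrightarrow> decreasing x \<Longrightarrow> x \<in> root_set"
  shows "x \<in> root_set"
  using P
proof (induction "nat (\<Sum>i\<in>{1..n}. int i * x i)" arbitrary: x rule: less_induct)
  case less
  show ?case
  proof (cases "decreasing x")
    case False
    then obtain j where j: "1 \<le> j" "j < n" "x j < x (j + 1)" unfolding decreasing_def by force
    have jn: "j \<in> {1..n}" using j by simp
    let ?y = "\<lambda>i. x (adj_swap j i)"
    have y: "x (adj_swap j i) = x i - (x (j + 1) - x j) * simple_root_vector k n j i" for i
      using fun_cong[OF swap_eq[OF j(1,2), of x]] .
    have "(\<Sum>i\<in>{1..n}. int i * ?y i) =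
      (\<Sum>i\<in>{1..n}. int i * x i - (x (j + 1) - x j) * (int i * simple_root_vector k n j i))"
      unfolding y by (intro sum.cong) (auto simp: algebra_simps)
    also have "\<dots> = (\<Sum>i\<in>{1..n}. int i * x i) - (x (j + 1) - x j)"
      using dot_simple_root_vector(1)[OF k_pos k_less jn j(2,1), of int]
      by (simp add: sum_subtractf sum_distrib_left[symmetric])
    finally have "(\<Sum>i\<in>{1..n}. int i * ?y i) < (\<Sum>i\<in>{1..n}. int i * x i)" using j by simp
    moreover have "0 \<le> (\<Sum>i\<in>{1..n}. int i * ?y i)"
      using nonneg[OF less(2)] by (intro sum_nonneg) auto
    ultimately have "?y \<in> root_set" using less(1)[of ?y] swap[OF less(2) j(1,2)] by simp
    then show ?thesis using root_set_swap[OF Zn[OF less(2)] j(1,2)] by blast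
  qed (use sorted less in blast)
qed

section \<open>Recognising imaginary roots among sorted vectors\<close>

lemma sum_split:
  assumes "m \<le> n"
  shows "(\<Sum>l\<in>{1..n}. (x l :: int)) = (\<Sum>l\<in>{1..m}. x l) + (\<Sum>l\<in>{m + 1..n}. x l)"
proof -
  have "{1..n} = {1..m} \<union> {m + 1..n}" using assms by auto
  then show ?thesis by (simp add: sum.union_disjoint)
qed

lemma sum_beta: "(\<Sum>i\<in>{1..n}. if i \<in> {1..k} then 1 else 0) = int k"
proof -
  have "(\<Sum>i\<in>{1..n}. if i \<in> {1..k} then 1 else 0) = (\<Sum>i\<in>{1..n} \<inter> {1..k}. 1 :: int)"
    by (rule sum.inter_restrict[symmetric]) simp
  also have "{1..n} \<inter> {1..k} = {1..k}" using k_less by auto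
  finally show ?thesis by simp
qed

text \<open>Sortedness gives nonpositive products with \<alpha>_1, ..., \<alpha>_(n-1), and
  \<open>A\<close> gives one with \<beta>. By the bounds on the entries, the coefficients along the
  line increase up to node \<open>k\<close> and decrease after it, with \<open>c k\<close> positive.
  So the support is an interval around \<open>k\<close> together with node \<open>n\<close>, hence
  connected.\<close>

lemma root_set_fundamental:
  assumes x: "x \<in> Zn_k k n" and dec: "decreasing x" and bd: "\<And>l. 0 \<le> x l" "\<And>l. x l \<le> s" and s: "1 \<le> s"
    and sum: "(\<Sum>l\<in>{1..n}. x l) = int k * s"
    and A: "(\<Sum>l\<in>{1..k}. x l) \<le> (int k - 2) * s"
  shows "x \<in> root_set"
proof -
  obtain c where c: "c \<in> root_lattice n" "lattice_to_Zn k n c = x" using in_Zn_k_obtain[OF x] .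
  have psum: "(\<Sum>l\<in>{1..m}. x l) = int (min m k) * c n - (if 1 \<le> m \<and> m < n then c m else 0)" if "m \<le> n" for m
    using sum_lattice_to_Zn[OF k_pos k_less that, of c] unfolding c(2) .
  have cn: "c n = s" using psum[of n] sum k_less k_pos by simp
  have cm: "c m = int (min m k) * s - (\<Sum>l\<in>{1..m}. x l)" if "1 \<le> m" "m < n" for m
    using psum[of m] that cn by simp
  have c_up: "c m \<le> c (Suc m)" if "1 \<le> m" "m < k" for m
  proof -
    have "min m k = m" "min (Suc m) k = Suc m" "m < n" "Suc m < n" using that k_less by auto
    then show ?thesis using cm[of m] cm[of "Suc m"] that bd(2)[of "Suc m"] by (simp add: algebra_simps)
  qed
  have c_down: "c (Suc m) \<le> c m" if "k \<le> m" "Suc m < n" for m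
  proof -
    have "min m k = k" "min (Suc m) k = k" "1 \<le> m" using that k_pos by auto
    then show ?thesis using cm[of m] cm[of "Suc m"] that bd(1)[of "Suc m"] by simp
  qed
  have c_nonneg: "0 \<le> c m" for m
  proof -
    consider "m \<notin> {1..n}" | "m = n" | "1 \<le> m" "m \<le> k" | "k < m" "m < n" by fastforce
    then show ?thesis
    proof cases
      case 1 then show ?thesis using c(1) by (simp add: root_lattice_def)
    next
      case 2 then show ?thesis using cn s by simp
    next
      case 3
      have "(\<Sum>l\<in>{1..m}. x l) \<le> (\<Sum>l\<in>{1..m}. s)" using bd by (intro sum_mono) auto
      then show ?thesis using cm[of m] 3 k_less by (simp add: min_def)
    next
      case 4
      \<comment> \<open>Beyond \<open>k\<close> the coefficient \<open>c m\<close> is the sum of the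
        entries after \<open>m\<close>.\<close>
      have "0 \<le> (\<Sum>l\<in>{m + 1..n}. x l)" using bd by (intro sum_nonneg) auto
      then show ?thesis using cm[of m] 4 sum sum_split[of m x] by simp
    qed
  qed
  have ck: "0 < c k" using cm[OF k_pos k_less] A s by (simp add: algebra_simps)
  have connected: "connected_support k n c"
  proof -
    define S where "S = {i \<in> {1..n}. c i \<noteq> 0}"
    define E where "E = {(a, b). a \<in> S \<and> b \<in> S \<and> J_adj k n a b}"
    have S_iff: "i \<in> S \<longleftrightarrow> 1 \<le> i \<and> i \<le> n \<and> 0 < c i" for i
      using c_nonneg[of i] by (auto simp: S_def)
    have kS: "k \<in> S" using ck k_pos k_less by (simp add: S_iff)
    have E_sym: "(b, a) \<in> E" if "(a, b) \<in> E" for a b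
      using that by (auto simp: E_def J_adj_def)
    have up: "1 \<le> i \<Longrightarrow> 0 < c i \<Longrightarrow> (i, k) \<in> E\<^sup>*" if "i \<le> k" for i
      using that
    proof (induction i rule: inc_induct)
      case (step i)
      have "0 < c (Suc i)" using c_up[of i] step by simp
      moreover from this have "(i, Suc i) \<in> E"
        using step k_less by (auto simp: E_def S_iff J_adj_def)
      ultimately show ?case using step by (auto intro: converse_rtrancl_into_rtrancl)
    qed simp
    have down: "i < n \<Longrightarrow> 0 < c i \<Longrightarrow> (i, k) \<in> E\<^sup>*" if "k \<le> i" for i
      using that
    proof (induction i rule: dec_induct)
      case (step i)
      have "0 < c i" using c_down[of i] step by simp
      moreover from this have "(Suc i, i) \<in> E"
        using step k_pos by (auto simp: E_def S_iff J_adj_def)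
      ultimately show ?case using step by (auto intro: converse_rtrancl_into_rtrancl)
    qed simp
    have to_k: "(i, k) \<in> E\<^sup>*" if i: "i \<in> S" for i
    proof -
      consider "i = n" | "i \<le> k" | "k \<le> i" "i < n" using i by (fastforce simp: S_iff)
      then show ?thesis
      proof cases
        case 1
        then have "(i, k) \<in> E" using i kS by (auto simp: E_def J_adj_def)
        then show ?thesis by blast
      qed (use up down i in \<open>auto simp: S_iff\<close>)
    qed
    have "E\<inverse> = E" by (auto intro: E_sym)
    then have "(k, i) \<in> E\<^sup>*" if "i \<in> S" for i
      using to_k[OF that] by (metis rtrancl_converseI)
    then show ?thesis
      unfolding connected_support_def Let_def S_def[symmetric] E_def[symmetric]
      using to_k by (blast intro: rtrancl_trans)
  qed
  have form: "root_form k n c (simple_root i) \<le> 0" if "i \<in> {1..n}" for i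
  proof (cases "i = n")
    case True
    then show ?thesis using root_form_last[of c s] sum A unfolding c(2) by (simp add: algebra_simps)
  next
    case False
    then have "1 \<le> i" "i < n" using that by auto
    then show ?thesis using root_form_adjacent[of i c] dec unfolding c(2) decreasing_def by simp
  qed
  have "c \<noteq> (\<lambda>i. 0)" using ck by auto
  then have "c \<in> fundamental_set k n"
    unfolding fundamental_set_def using c(1) c_nonneg form connected by blast
  then have "c \<in> imaginary_roots k n"
    unfolding imaginary_roots_def using weyl_id[of k n] by (auto intro!: exI[of _ id])
  then show ?thesis using c unfolding root_set_def J_roots_def by blast
qed

text \<open>In a sorted nonnegative vector the nonzero entries come first: a zero at
  \<open>l\<close> confines them to the first \<open>l - 1\<close> places.\<close>

lemma decreasing_positive:
  assumes dec: "decreasing x" and bd: "\<And>l. 0 \<le> x l" and N: "int N \<le> (\<Sum>i\<in>{1..n}. if x i \<noteq> 0 then 1 else 0)"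
    and l: "1 \<le> l" "l \<le> N"
  shows "l \<le> n" "1 \<le> x l"
proof -
  have "(\<Sum>i\<in>{1..n}. if x i \<noteq> 0 then 1 else 0) = int (card {i \<in> {1..n}. x i \<noteq> 0})"
    by (simp add: sum.If_cases Int_def)
  then have card: "N \<le> card {i \<in> {1..n}. x i \<noteq> 0}" using N by simp
  have "card {i \<in> {1..n}. x i \<noteq> 0} \<le> card {1..n}" by (intro card_mono) auto
  then show ln: "l \<le> n" using card l by simp
  show "1 \<le> x l"
  proof (rule ccontr)
    assume "\<not> 1 \<le> x l"
    then have "x l = 0" using bd[of l] by simp
    have "{i \<in> {1..n}. x i \<noteq> 0} \<subseteq> {1..<l}"
    proof
      fix i assume i: "i \<in> {i \<in> {1..n}. x i \<noteq> 0}"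
      have "i < l"
      proof (rule ccontr)
        assume "\<not> i < l"
        then have "x i \<le> x l" using decreasingD[OF dec l(1), of i] i by simp
        then show False using \<open>x l = 0\<close> bd[of i] i by simp
      qed
      then show "i \<in> {1..<l}" using i by simp
    qed
    then have "card {i \<in> {1..n}. x i \<noteq> 0} \<le> card {1..<l}" by (intro card_mono) auto
    then show False using card l by simp
  qed
qed

section \<open>Real and imaginary roots of rank 1, 2 and 3\<close>

lemma Zn_kI: "(\<And>i. i \<notin> {1..n} \<Longrightarrow> x i = 0) \<Longrightarrow> (\<Sum>i\<in>{1..n}. x i) = int k * s \<Longrightarrow> x \<in> Zn_k k n"
  by (simp add: Zn_k_def)

text \<open>Sorting a 0-1 vector with \<open>k\<close> ones yields the simple root \<beta>.\<close>

lemma root_set_rank1: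
  assumes "\<And>i. i \<notin> {1..n} \<Longrightarrow> x i = 0" "\<And>i. 0 \<le> x i" "\<And>i. x i \<le> 1" "(\<Sum>i\<in>{1..n}. x i) = int k"
  shows "x \<in> root_set"
proof -
  define P where "P x \<longleftrightarrow> (\<forall>i. i \<notin> {1..n} \<longrightarrow> x i = 0) \<and> (\<forall>i. 0 \<le> x i \<and> x i \<le> 1) \<and> (\<Sum>i\<in>{1..n}. x i) = int k"
    for x :: "nat \<Rightarrow> int"
  show ?thesis
  proof (rule sort_induct[of P])
    show "P x" using assms by (auto simp: P_def)
    show "P (\<lambda>i. x (adj_swap j i))" if "P x" "1 \<le> j" "j < n" for x j
    proof -
      have "adj_swap j i \<notin> {1..n}" if "i \<notin> {1..n}" for i using that \<open>1 \<le> j\<close> \<open>j < n\<close> by (auto simp: adj_swap_def)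
      then show ?thesis using \<open>P x\<close> sum_adj_swap[OF that(2,3), of x] by (simp add: P_def)
    qed
    show "x \<in> Zn_k k n" if "P x" for x using that by (intro Zn_kI[of x 1]) (auto simp: P_def)
    show "0 \<le> x i" if "P x" for x i using that by (simp add: P_def)
    show "x \<in> root_set" if "P x" "decreasing x" for x
    proof -
      have bd: "0 \<le> x i" "x i \<le> 1" for i using that by (auto simp: P_def)
      have "(\<Sum>i\<in>{1..n}. if x i \<noteq> 0 then 1 else 0) = (\<Sum>i\<in>{1..n}. x i)"
      proof (intro sum.cong refl)
        show "(if x i \<noteq> 0 then 1 else 0) = x i" for i using bd[of i] by auto
      qed
      then have "int k \<le> (\<Sum>i\<in>{1..n}. if x i \<noteq> 0 then 1 else 0)" using that by (simp add: P_def)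
      then have one: "x l = 1" if "1 \<le> l" "l \<le> k" for l
        using decreasing_positive(2)[OF \<open>decreasing x\<close> bd(1) _ that] bd(2)[of l] by simp
      then have "(\<Sum>l\<in>{1..k}. x l) = int k" by simp
      then have "(\<Sum>l\<in>{k + 1..n}. x l) = 0" using sum_split[of k x] that k_less by (simp add: P_def)
      then have "\<forall>l\<in>{k + 1..n}. x l = 0" using bd by (subst (asm) sum_nonneg_eq_0_iff) auto
      then have "x = (\<lambda>l. if l \<in> {1..k} then 1 else 0)"
        using one that by (force simp: P_def fun_eq_iff)
      then show ?thesis using root_set_beta by simp
    qed
  qed
qed

text \<open>After sorting, at least three entries beyond \<open>k\<close> are positive, so the first
  \<open>k\<close> sum to at most \<open>2 * k - 3\<close>. Below this value the vector is in the
  fundamental set. At this value the tail consists of zeros and ones, and subtracting \<beta> leaves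
  a vector of rank 1.\<close>

lemma root_set_rank2:
  assumes "\<And>i. i \<notin> {1..n} \<Longrightarrow> x i = 0" "\<And>i. 0 \<le> x i" "\<And>i. x i \<le> 2" "(\<Sum>i\<in>{1..n}. x i) = 2 * int k"
    and "int (k + 3) \<le> (\<Sum>i\<in>{1..n}. if x i \<noteq> 0 then 1 else 0)"
  shows "x \<in> root_set"
proof -
  define P where "P x \<longleftrightarrow> (\<forall>i. i \<notin> {1..n} \<longrightarrow> x i = 0) \<and> (\<forall>i. 0 \<le> x i \<and> x i \<le> 2) \<and>
    (\<Sum>i\<in>{1..n}. x i) = 2 * int k \<and> int (k + 3) \<le> (\<Sum>i\<in>{1..n}. if x i \<noteq> 0 then 1 else 0)"
    for x :: "nat \<Rightarrow> int"
  show ?thesis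
  proof (rule sort_induct[of P])
    show "P x" using assms by (auto simp: P_def)
    show "P (\<lambda>i. x (adj_swap j i))" if "P x" "1 \<le> j" "j < n" for x j
    proof -
      have "adj_swap j i \<notin> {1..n}" if "i \<notin> {1..n}" for i using that \<open>1 \<le> j\<close> \<open>j < n\<close> by (auto simp: adj_swap_def)
      then show ?thesis
        using \<open>P x\<close> sum_adj_swap[OF that(2,3), of x] sum_adj_swap[OF that(2,3), of "\<lambda>i. if x i \<noteq> 0 then 1 else 0"]
        by (simp add: P_def)
    qed
    show Zn: "x \<in> Zn_k k n" if "P x" for x using that by (intro Zn_kI[of x 2]) (auto simp: P_def)
    show "0 \<le> x i" if "P x" for x i using that by (simp add: P_def)
    show "x \<in> root_set" if "P x" "decreasing x" for x
    proof -
      have bd: "0 \<le> x i" "x i \<le> 2" for i using that by (auto simp: P_def)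
      have sum: "(\<Sum>i\<in>{1..n}. x i) = int k * 2" and out: "\<And>i. i \<notin> {1..n} \<Longrightarrow> x i = 0"
        using that by (auto simp: P_def)
      have pos: "1 \<le> x l" "l \<le> n" if "1 \<le> l" "l \<le> k + 3" for l
        using decreasing_positive[OF \<open>decreasing x\<close> bd(1) _ that] \<open>P x\<close> by (auto simp: P_def)
      have kn: "k + 3 \<le> n" using pos(2)[of "k + 3"] by simp
      have "x (k + 1) + x (k + 2) + x (k + 3) = (\<Sum>l\<in>{k + 1, k + 2, k + 3}. x l)" by simp
      also have "\<dots> \<le> (\<Sum>l\<in>{k + 1..n}. x l)" using bd kn by (intro sum_mono2) auto
      finally have B: "x (k + 1) + x (k + 2) + x (k + 3) \<le> (\<Sum>l\<in>{k + 1..n}. x l)" .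
      have pk: "1 \<le> x (k + 1)" "1 \<le> x (k + 2)" "1 \<le> x (k + 3)" using pos[of "k + 1"] pos[of "k + 2"] pos[of "k + 3"] by auto
      have split: "(\<Sum>l\<in>{1..k}. x l) + (\<Sum>l\<in>{k + 1..n}. x l) = int k * 2"
        using sum_split[of k x] sum k_less by simp
      show ?thesis
      proof (cases "(\<Sum>l\<in>{1..k}. x l) \<le> (int k - 2) * 2")
        case True
        then show ?thesis using root_set_fundamental[OF Zn[OF \<open>P x\<close>] \<open>decreasing x\<close> bd _ sum] by simp
      next
        case False
        then have A: "(\<Sum>l\<in>{1..k}. x l) = (int k - 2) * 2 + 1" and x1: "x (k + 1) = 1"
          using B pk split by auto
        show ?thesis
        proof (rule root_set_subtract[OF Zn[OF \<open>P x\<close>] sum A], rule root_set_rank1)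
          fix i
          show "i \<notin> {1..n} \<Longrightarrow> x i - (if i \<in> {1..k} then 1 else 0) = 0" using out[of i] k_less by auto
          show "0 \<le> x i - (if i \<in> {1..k} then 1 else 0)" using bd[of i] pos(1)[of i] by auto
          have "x i \<le> 1" if "k < i"
            using x1 decreasingD[OF \<open>decreasing x\<close>, of "k + 1" i] that out[of i] by (cases "i \<le> n") auto
          then show "x i - (if i \<in> {1..k} then 1 else 0) \<le> 1" using bd[of i] out[of i] by (cases "i = 0") auto
        next
          show "(\<Sum>i\<in>{1..n}. x i - (if i \<in> {1..k} then 1 else 0)) = int k"
            unfolding sum_subtractf sum_beta sum by simp
        qed
      qed
    qed
  qed
qed

text \<open>After sorting, at least five entries beyond the third are positive, so the first three
  sum to at most 4. A sum of at most 3 puts the vector into the fundamental set. If the sum is 4,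
  subtracting \<beta> leaves a 0-1 vector with six ones, and six is the bound \<open>k + 3\<close>
  of \<open>root_set_rank2\<close>.\<close>

lemma root_set_rank3:
  assumes k: "k = 3"
    and "\<And>i. i \<notin> {1..n} \<Longrightarrow> x i = 0" "\<And>i. 0 \<le> x i" "(\<Sum>i\<in>{1..n}. x i) = 9"
    and "8 \<le> (\<Sum>i\<in>{1..n}. if x i \<noteq> 0 then 1 else 0 :: int)"
  shows "x \<in> root_set"
proof -
  define P where "P x \<longleftrightarrow> (\<forall>i. i \<notin> {1..n} \<longrightarrow> x i = 0) \<and> (\<forall>i. 0 \<le> x i) \<and>
    (\<Sum>i\<in>{1..n}. x i) = 9 \<and> 8 \<le> (\<Sum>i\<in>{1..n}. if x i \<noteq> 0 then 1 else 0 :: int)"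
    for x :: "nat \<Rightarrow> int"
  show ?thesis
  proof (rule sort_induct[of P])
    show "P x" using assms by (auto simp: P_def)
    show "P (\<lambda>i. x (adj_swap j i))" if "P x" "1 \<le> j" "j < n" for x j
    proof -
      have "adj_swap j i \<notin> {1..n}" if "i \<notin> {1..n}" for i using that \<open>1 \<le> j\<close> \<open>j < n\<close> by (auto simp: adj_swap_def)
      then show ?thesis
        using \<open>P x\<close> sum_adj_swap[OF that(2,3), of x] sum_adj_swap[OF that(2,3), of "\<lambda>i. if x i \<noteq> 0 then 1 else 0"]
        by (simp add: P_def)
    qed
    show Zn: "x \<in> Zn_k k n" if "P x" for x using that k by (intro Zn_kI[of x 3]) (auto simp: P_def)
    show "0 \<le> x i" if "P x" for x i using that by (simp add: P_def)
    show "x \<in> root_set" if "P x" "decreasing x" for x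
    proof -
      have bd: "0 \<le> x i" for i using that by (auto simp: P_def)
      have sum: "(\<Sum>i\<in>{1..n}. x i) = int k * 3" and out: "\<And>i. i \<notin> {1..n} \<Longrightarrow> x i = 0"
        using that k by (auto simp: P_def)
      have pos: "1 \<le> x l" "l \<le> n" if "1 \<le> l" "l \<le> 8" for l
        using decreasing_positive[OF \<open>decreasing x\<close> bd _ that] \<open>P x\<close> by (auto simp: P_def)
      have n8: "8 \<le> n" using pos(2)[of 8] by simp
      have "x 4 + x 5 + x 6 + x 7 + x 8 = (\<Sum>l\<in>{4, 5, 6, 7, 8}. x l)" by simp
      also have "\<dots> \<le> (\<Sum>l\<in>{k + 1..n}. x l)" using bd n8 k by (intro sum_mono2) auto
      finally have B: "x 4 + x 5 + x 6 + x 7 + x 8 \<le> (\<Sum>l\<in>{k + 1..n}. x l)" .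
      have p: "1 \<le> x 1" "1 \<le> x 2" "1 \<le> x 3" "1 \<le> x 4" "1 \<le> x 5" "1 \<le> x 6" "1 \<le> x 7" "1 \<le> x 8"
        using pos(1) by simp_all
      have split: "(\<Sum>l\<in>{1..k}. x l) + (\<Sum>l\<in>{k + 1..n}. x l) = 9"
        using sum_split[of k x] sum k k_less by simp
      have "{1..k} = {1, 2, 3}" using k by auto
      then have A: "(\<Sum>l\<in>{1..k}. x l) = x 1 + x 2 + x 3" by simp
      show ?thesis
      proof (cases "(\<Sum>l\<in>{1..k}. x l) \<le> 3")
        case True
        have "x l \<le> 3" for l
          using decreasingD[OF \<open>decreasing x\<close>, of 1 l] out[of l] True A p by (cases "l \<in> {1..n}") auto
        then show ?thesis using root_set_fundamental[OF Zn[OF \<open>P x\<close>] \<open>decreasing x\<close> bd _ _ sum] True k by simp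
      next
        case False
        then have A4: "x 1 + x 2 + x 3 = 4" and x4: "x 4 = 1"
          using A B p split by auto
        let ?y = "\<lambda>l. x l - (if l \<in> {1..k} then 1 else 0)"
        have y: "0 \<le> ?y i" "?y i \<le> 1" for i
        proof -
          show "0 \<le> ?y i" using bd[of i] pos(1)[of i] k by auto
          have x3: "x 1 \<le> 2" "x 2 \<le> 2" "x 3 \<le> 2" using A4 p by linarith+
          have x_tail: "x i \<le> 1" if "4 \<le> i"
            using x4 decreasingD[OF \<open>decreasing x\<close>, of 4 i] that out[of i] by (cases "i \<le> n") auto
          show "?y i \<le> 1"
          proof (cases "i \<in> {1..k}")
            case True
            then have "i = 1 \<or> i = 2 \<or> i = 3" using k by auto
            then have "x i \<le> 2" using x3 by blast
            then show ?thesis using True by simp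
          next
            case False
            then have "i = 0 \<or> 4 \<le> i" using k by auto
            then have "x i \<le> 1" using x_tail out[of 0] by auto
            then show ?thesis using False by simp
          qed
        qed
        have y_sum: "(\<Sum>i\<in>{1..n}. ?y i) = 2 * int k"
          unfolding sum_subtractf sum_beta sum by simp
        have y_nz: "(\<Sum>i\<in>{1..n}. if ?y i \<noteq> 0 then 1 else 0) = (\<Sum>i\<in>{1..n}. ?y i)"
        proof (intro sum.cong refl)
          show "(if ?y i \<noteq> 0 then 1 else 0) = ?y i" for i using y[of i] by auto
        qed
        have "(\<Sum>l\<in>{1..k}. x l) = (int k - 2) * 3 + 1" using A A4 k by simp
        then show ?thesis
        proof (rule root_set_subtract[OF Zn[OF \<open>P x\<close>] sum], intro root_set_rank2)
          show "int (k + 3) \<le> (\<Sum>i\<in>{1..n}. if ?y i \<noteq> 0 then 1 else 0)"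
            unfolding y_nz y_sum using k by simp
          show "?y i = 0" if "i \<notin> {1..n}" for i using out[OF that] that k_less by auto
          show "?y i \<le> 2" for i using y(2)[of i] by simp
        qed (use y y_sum in simp_all)
      qed
    qed
  qed
qed

end

theorem theorem1:
  fixes k n :: nat
  assumes "4 \<le> n" and "1 \<le> k" and "2 * k \<le> n"
  shows "(\<forall>M :: 'a::ab_group_add quiver_rep.
            CM_module k n 2 M \<and> indecomposable_module n M \<longrightarrow> phi k n M \<in> J_roots k n) \<and>
         (2 * 3 \<le> n \<longrightarrow>
           (\<forall>M :: 'a::ab_group_add quiver_rep.
              CM_module 3 n 3 M \<and> indecomposable_module n M \<longrightarrow> phi 3 n M \<in> J_roots 3 n))"
proof (intro conjI allI impI)
  fix M :: "'a quiver_rep"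
  assume M: "CM_module k n 2 M \<and> indecomposable_module n M"
  interpret cm_rep k n 2 M using M assms by unfold_locales auto
  interpret root_vectors k n using assms by unfold_locales auto
  define x where "x = class_vector k n M"
  note x = class_vector_properties(1-4)[folded x_def]
  \<comment> \<open>Contraposition of \<open>rank2_decomposable\<close>: fewer than
    \<open>k - 2\<close> entries are 2.\<close>
  have "card {q \<in> {1..n}. x q = 2} + 3 \<le> k"
    using rank2_decomposable M by (fastforce simp: x_def)
  \<comment> \<open>All entries are 0, 1 or 2, so the number of nonzero ones is the total
    \<open>2 * k\<close> minus the number of entries 2.\<close>
  moreover have "(\<Sum>i\<in>{1..n}. if x i \<noteq> 0 then 1 else 0) = (\<Sum>i\<in>{1..n}. x i - (if x i = 2 then 1 else 0))"
  proof (intro sum.cong refl)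
    fix i
    have "x i = 0 \<or> x i = 1 \<or> x i = 2" using x(2)[of i] x(3)[of i] by (simp, linarith)
    then show "(if x i \<noteq> 0 then 1 else 0) = x i - (if x i = 2 then 1 else 0)" by auto
  qed
  moreover have "(\<Sum>i\<in>{1..n}. if x i = 2 then 1 else 0) = int (card {q \<in> {1..n}. x q = 2})"
    by (simp add: sum.If_cases Int_def)
  ultimately have "int (k + 3) \<le> (\<Sum>i\<in>{1..n}. if x i \<noteq> 0 then 1 else 0)"
    using x(4) unfolding sum_subtractf by simp
  moreover have "x i \<le> 2" for i using x(3)[of i] by simp
  moreover have "(\<Sum>i\<in>{1..n}. x i) = 2 * int k" using x(4) by simp
  ultimately have "x \<in> root_set" using x(1,2) by (intro root_set_rank2)
  then show "phi k n M \<in> J_roots k n" unfolding phi_def x_def by (rule inv_in_J_roots)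
next
  fix M :: "'a quiver_rep"
  assume n: "2 * 3 \<le> n" and M: "CM_module 3 n 3 M \<and> indecomposable_module n M"
  interpret cm_rep 3 n 3 M using M n by unfold_locales auto
  interpret root_vectors 3 n using n by unfold_locales auto
  define x where "x = class_vector 3 n M"
  note x = class_vector_properties(1-4)[folded x_def]
  have "8 \<le> (\<Sum>i\<in>{1..n}. if x i \<noteq> 0 then 1 else 0 :: int)"
  proof (cases "\<exists>q\<in>{1..n}. 2 \<le> x q")
    case True
    then have "8 \<le> card {q \<in> {1..n}. x q \<noteq> 0}"
      using rank3_decomposable M by (fastforce simp: x_def)
    then show ?thesis by (simp add: sum.If_cases Int_def)
  next
    \<comment> \<open>All entries are 0 or 1 here, so nine of them are nonzero.\<close>
    case False
    have "(\<Sum>i\<in>{1..n}. if x i \<noteq> 0 then 1 else 0) = (\<Sum>i\<in>{1..n}. x i)"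
    proof (intro sum.cong refl)
      fix i assume "i \<in> {1..n}"
      then have "x i = 0 \<or> x i = 1" using False x(2)[of i] by force
      then show "(if x i \<noteq> 0 then 1 else 0) = x i" by auto
    qed
    then show ?thesis using x(4) by simp
  qed
  moreover have "(\<Sum>i\<in>{1..n}. x i) = 9" using x(4) by simp
  ultimately have "x \<in> root_set" using x(1,2) by (intro root_set_rank3) auto
  then show "phi 3 n M \<in> J_roots 3 n" unfolding phi_def x_def by (rule inv_in_J_roots)
qed

end
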